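(* For every $n\ge2$, the metric space $(\mathcal K_0^n,d_{AW})$ is homeomorphic to the Hilbert cube $Q$.
   Context: $\mathcal K_0^n$ is the family of closed convex subsets of $\mathbb R^n$ containing the origin, with the Attouch–Wets metric $d_{AW}(A,K)=\sup_{j\in\mathbb N}\min\{\frac1j,\sup_{\|x\|<j}|d(x,A)-d(x,K)|\}$, $d(x,A)=\inf_{a\in A}\|x-a\|$. $Q=\prod_{i=1}^\infty[-1,1]$ with the product topology. *)

theory Defs
  imports "HOL-Analysis.Analysis"
begin

definition K0 :: "('a::euclidean_space) set set" where
  "K0 = {A. closed A \<and> convex A \<and> 0 \<in> A}"

definition dAW :: "('a::euclidean_space) set \<Rightarrow> 'a set \<Rightarrow> real" where
  "dAW A K = (SUP j\<in>{1::nat..}. min (1 / real j)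
                 (SUP x\<in>ball 0 (real j). \<bar>infdist x A - infdist x K\<bar>))"

definition hilbert_cube :: "(nat \<Rightarrow> real) topology" where
  "hilbert_cube = product_topology (\<lambda>i. top_of_set {-1..1}) UNIV"

end

theory Submission
  imports Defs
begin

text \<open>
  A closed convex set \<open>A\<close> containing the origin is determined by its truncations \<open>A \<inter> cball 0 j\<close>, and the nearest
  point of \<open>A\<close> to \<open>x\<close> has norm at most \<open>norm x\<close>; so the Attouch-Wets topology is that of the inverse limit of the
  spaces \<open>S 0 j\<close> of compact convex sets \<open>0 \<in> A \<subseteq> cball 0 j\<close>, bonded by truncation. By an approximation argument
  (Brown) it suffices that each \<open>S 0 j\<close> is a Hilbert cube and that the bonding maps are uniform limits of
  homeomorphisms.

  The first claim is Keller's theorem for the compact convex set of support functions, sampled at a dense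
  sequence of directions. It is proved by straightening one coordinate at a time: an \<open>(n+1)\<close>-dimensional
  projection is moved radially, by a small amount, onto the part over a slightly shrunken \<open>n\<close>-dimensional
  projection, over which it is a product with an interval. The argument works with parameters.

  For the second claim, polarity turns truncation into the map \<open>h \<mapsto> max h a'\<close> on support functions. Its graph is
  thickened to a relation whose fibres over both sides are convex bodies varying continuously. By the parametric
  Keller theorem both projections of the relation are trivial Hilbert cube bundles over Hilbert cubes, hence
  uniform limits of homeomorphisms, and composing one with the inverse of the other approximates the map.
\<close>

section \<open>Inverse limits with approximately commuting ladders\<close>

text \<open>Keller's theorem is available only for the bounded pieces \<open>S a b\<close>, which
  are compact and convex; the whole space comes with no such structure. So
  \<open>approximate_inverse_limit\<close> serves on two levels: inside Keller's theorem, with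
  projections to finitely many coordinates on both sides, and for the final limit, with the constant
  target \<open>S 0 1\<close> and \<open>q j = id\<close>. Truncation is awkward on support
  functions, since intersecting bodies is not a pointwise operation there. Polars turn an
  intersection into a convex hull, whose support function is a pointwise maximum. But polarity needs
  a ball inside every body, and \<open>S 0 l\<close> contains bodies with the origin on the
  boundary. The map \<open>h \<mapsto> max h d\<close> with tiny \<open>d\<close> repairs this too:
  it is close to the identity, so a homeomorphism near it carries \<open>S 0 l\<close> onto
  \<open>S d l\<close> almost without distortion. Dimension at least 2 enters through the sampled
  directions: infinitely many distinct unit vectors, any finite number of which see support values
  that vary independently. This makes every finite-dimensional projection full-dimensional.\<close>

lemma dist_fun_lipschitz:
  fixes v w v' w' :: "nat \<Rightarrow> 'a::metric_space"
  assumes "\<And>i. dist (v i) (w i) \<le> dist (v' i) (w' i)"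
  shows "dist v w \<le> dist v' w'"
  unfolding dist_fun_def
proof (rule suminf_le)
  fix n
  show "(1/2)^n * min (dist (v (from_nat n)) (w (from_nat n))) 1
      \<le> (1/2)^n * min (dist (v' (from_nat n)) (w' (from_nat n))) (1::real)"
    by (rule mult_left_mono, rule min.mono) (use assms in auto)
qed (rule summable_comparison_test'[of "\<lambda>n. (1/2)^n"], auto simp add: summable_geometric_iff)+

lemma dist_fun_le:
  fixes v w :: "nat \<Rightarrow> 'a::metric_space"
  assumes "\<And>i. dist (v i) (w i) \<le> e"
  shows "dist v w \<le> 2 * e"
proof -
  have "0 \<le> e" using assms[of 0] zero_le_dist order_trans by blast
  have "dist v w \<le> (\<Sum>n. (1/2)^n * e)"
    unfolding dist_fun_def
  proof (rule suminf_le)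
    fix n
    show "(1/2)^n * min (dist (v (from_nat n)) (w (from_nat n))) 1 \<le> (1/2)^n * e"
      using assms[of "from_nat n"] by (intro mult_left_mono) auto
  next
    show "summable (\<lambda>n. (1/2::real)^n * e)"
      by (intro summable_mult2 summable_geometric) auto
  qed (rule summable_comparison_test'[of "\<lambda>n. (1/2)^n"], auto simp add: summable_geometric_iff)
  also have "\<dots> = 2 * e"
    using suminf_mult2[of "\<lambda>n. (1/2::real)^n" e] suminf_geometric[of "1/2::real"]
    by (simp add: summable_geometric)
  finally show ?thesis .
qed

lemma dist_fun_eventually_agree:
  fixes e :: real
  assumes "e > 0"
  shows "\<exists>k. \<forall>v w :: nat \<Rightarrow> 'a::metric_space. (\<forall>i<k. v i = w i) \<longrightarrow> dist v w < e"
proof -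
  obtain N where N: "(1/2::real)^N < e"
    using real_arch_pow_inv[OF assms, of "1/2"] by auto
  \<comment> \<open>The metric enumerates indices through \<open>from_nat\<close>, so
    \<open>k\<close> has to exceed every index occurring in the summands up to \<open>N\<close>; the
    remaining summands contribute at most \<open>(1/2)^N\<close>.\<close>
  define k where "k = Suc (Max ((from_nat :: nat \<Rightarrow> nat) ` {..N}))"
  have k: "from_nat n < k" if "n \<le> N" for n
    unfolding k_def using that by (intro le_imp_less_Suc Max_ge) auto
  have "dist v w < e" if vw: "\<forall>i<k. v i = w i" for v w :: "nat \<Rightarrow> 'a"
  proof -
    have "{dist (v (from_nat n)) (w (from_nat n)) |n. n \<le> N} = {0}"
      using vw k by (auto intro!: exI[of _ 0])
    then have "dist v w \<le> (1/2)^N"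
      using dist_fun_le_dist_first_terms[of v w N] by simp
    with N show ?thesis by simp
  qed
  then show ?thesis by blast
qed

text \<open>Tychonoff's theorem, transferred from the abstract product topology to the topology of
  the function type.\<close>

lemma compact_box:
  fixes A :: "nat \<Rightarrow> 'a::topological_space set"
  assumes "\<And>i. compact (A i)"
  shows "compact {v. \<forall>i. v i \<in> A i}"
proof -
  have "compactin (product_topology (\<lambda>i. euclidean) UNIV) (Pi\<^sub>E UNIV A)"
    using assms by (subst compactin_PiE) auto
  moreover have "Pi\<^sub>E UNIV A = {v. \<forall>i. v i \<in> A i}" by auto
  ultimately show ?thesis
    by (simp add: euclidean_product_topology)
qed

text \<open>On a compact domain with Hausdorff target this is a homeomorphism;
  \<open>iso_onto_inv\<close> supplies the inverse.\<close>

definition iso_onto :: "'a::topological_space set \<Rightarrow> 'b::topological_space set \<Rightarrow> ('a \<Rightarrow> 'b) \<Rightarrow> bool" where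
  "iso_onto X Y h \<longleftrightarrow> continuous_on X h \<and> inj_on h X \<and> h ` X = Y"

lemma iso_onto_comp:
  assumes "iso_onto X Y f" "iso_onto Y Z g"
  shows "iso_onto X Z (g \<circ> f)"
  using assms unfolding iso_onto_def
  by (metis comp_inj_on continuous_on_compose image_comp)

lemma iso_onto_inv:
  fixes X :: "'a::topological_space set" and Y :: "'b::t2_space set"
  assumes "iso_onto X Y f" "compact X"
  shows "iso_onto Y X (the_inv_into X f)"
  using assms the_inv_into_onto[of f X] inj_on_the_inv_into[of f X] continuous_on_inv_into[of X f]
  unfolding iso_onto_def by auto

text \<open>Outside the open \<open>\<delta>\<close>-neighbourhood of the pairs identified by
  \<open>h\<close>, the continuous function \<open>dist (h x) (h x')\<close> is positive on a
  compact set and so has a positive minimum. As \<open>h\<close> may fail to be injective, the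
  conclusion can only place \<open>x\<close> and \<open>x'\<close> near points with equal
  image.\<close>

lemma compact_kernel_separation:
  fixes h :: "'a::metric_space \<Rightarrow> 'b::metric_space"
  assumes "compact X" "continuous_on X h" "\<delta> > 0"
  shows "\<exists>\<kappa>>0. \<forall>x\<in>X. \<forall>x'\<in>X. dist (h x) (h x') < \<kappa> \<longrightarrow>
           (\<exists>z\<in>X. \<exists>z'\<in>X. h z = h z' \<and> dist x z < \<delta> \<and> dist x' z' < \<delta>)"
proof -
  define E where "E = {(z,z'). z \<in> X \<and> z' \<in> X \<and> h z = h z'}"
  define U where "U = (\<Union>(z,z')\<in>E. ball z \<delta> \<times> ball z' \<delta>)"
  define P where "P = X \<times> X - U"
  have "open U" unfolding U_def by (auto intro!: open_UN open_Times)
  then have cP: "compact P"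
    unfolding P_def by (intro compact_diff compact_Times assms)
  have cont: "continuous_on P (\<lambda>p. dist (h (fst p)) (h (snd p)))"
    unfolding P_def
    by (intro continuous_intros continuous_on_compose2[OF assms(2)]) auto
  show ?thesis
  proof (cases "P = {}")
    case True
    have "\<exists>z\<in>X. \<exists>z'\<in>X. h z = h z' \<and> dist x z < \<delta> \<and> dist x' z' < \<delta>" if "x \<in> X" "x' \<in> X" for x x'
    proof -
      have "(x,x') \<in> U" using that True P_def by blast
      then show ?thesis unfolding U_def E_def by (auto simp: dist_commute)
    qed
    then show ?thesis by (intro exI[of _ 1]) auto
  next
    case False
    obtain p where p: "p \<in> P" "\<And>q. q \<in> P \<Longrightarrow> dist (h (fst p)) (h (snd p)) \<le> dist (h (fst q)) (h (snd q))"
      using continuous_attains_inf[OF cP False cont] by blast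
    have "dist (h (fst p)) (h (snd p)) > 0"
    proof (rule ccontr)
      assume "\<not> ?thesis"
      then have "h (fst p) = h (snd p)" by simp
      with p(1) have "p \<in> E" unfolding P_def E_def by auto
      then have "p \<in> U" unfolding U_def using \<open>\<delta> > 0\<close>
        by (intro UN_I[of p]) (auto simp: case_prod_beta mem_Times_iff)
      with p(1) show False unfolding P_def by auto
    qed
    moreover have "\<exists>z\<in>X. \<exists>z'\<in>X. h z = h z' \<and> dist x z < \<delta> \<and> dist x' z' < \<delta>"
      if "x \<in> X" "x' \<in> X" "dist (h x) (h x') < dist (h (fst p)) (h (snd p))" for x x'
    proof -
      have "(x,x') \<in> U" using that p(2)[of "(x,x')"] P_def by force
      then show ?thesis unfolding U_def E_def by (auto simp: dist_commute)
    qed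
    ultimately show ?thesis by blast
  qed
qed

text \<open>\<open>X\<close> plays the inverse limit and \<open>\<rho> j\<close> its projection to
  stage \<open>j\<close>; by \<open>\<rho>_mono\<close> stage \<open>j\<close> is a function of
  stage \<open>Suc j\<close>, so the bonding maps stay implicit. The target is exhausted by the
  images of the \<open>q j\<close>, which tend uniformly to the identity. Hypothesis
  \<open>step\<close> lifts any homeomorphism between stages to the next stage up to a prescribed
  error. Choosing each error after the map it must protect makes \<open>h j \<circ> \<rho> j\<close>
  converge to a homeomorphism.\<close>

theorem approximate_inverse_limit:
  fixes X :: "'a::metric_space set" and T :: "'b::complete_space set"
    and \<rho> :: "nat \<Rightarrow> 'a \<Rightarrow> 'c::metric_space" and q :: "nat \<Rightarrow> 'b \<Rightarrow> 'b"
  assumes X: "compact X" and T: "compact T"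
    and \<rho>: "\<And>j. continuous_on X (\<rho> j)"
    and \<rho>_mono: "\<And>j x x'. x \<in> X \<Longrightarrow> x' \<in> X \<Longrightarrow> \<rho> (Suc j) x = \<rho> (Suc j) x' \<Longrightarrow> \<rho> j x = \<rho> j x'"
    and \<rho>_sep: "\<And>x x'. x \<in> X \<Longrightarrow> x' \<in> X \<Longrightarrow> (\<And>j. \<rho> j x = \<rho> j x') \<Longrightarrow> x = x'"
    and qT: "\<And>j. q j ` T \<subseteq> T"
    and q_lip: "\<And>j a b. a \<in> T \<Longrightarrow> b \<in> T \<Longrightarrow> dist (q j a) (q j b) \<le> dist a b"
    and qq: "\<And>i j a. a \<in> T \<Longrightarrow> i \<le> j \<Longrightarrow> q i (q j a) = q i a"
    and q_lim: "\<And>e. e > 0 \<Longrightarrow> \<exists>J. \<forall>j\<ge>J. \<forall>a\<in>T. dist (q j a) a < e"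
    and h0: "iso_onto (\<rho> 0 ` X) (q 0 ` T) h0"
    and step: "\<And>j h \<eta>. iso_onto (\<rho> j ` X) (q j ` T) h \<Longrightarrow> \<eta> > 0 \<Longrightarrow>
        \<exists>h'. iso_onto (\<rho> (Suc j) ` X) (q (Suc j) ` T) h' \<and>
             (\<forall>x\<in>X. dist (q j (h' (\<rho> (Suc j) x))) (h (\<rho> j x)) \<le> \<eta>)"
    and "\<epsilon> > 0"
  shows "\<exists>f. iso_onto X T f \<and> (\<forall>x\<in>X. dist (q 0 (f x)) (h0 (\<rho> 0 x)) \<le> \<epsilon>)"
proof -
  \<comment> \<open>A pair is good if \<open>\<eta>\<close> is so small that later corrections, which move stage \<open>j\<close> by at most
    \<open>2 * \<eta> j\<close>, cannot identify points that \<open>\<rho> j\<close> keeps clearly apart; this yields injectivity of the limit.\<close>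
  define close where "close j h \<eta> \<longleftrightarrow> (\<forall>x\<in>X. \<forall>x'\<in>X. dist (h (\<rho> j x)) (h (\<rho> j x')) < 5 * \<eta> \<longrightarrow>
           (\<exists>z\<in>X. \<exists>z'\<in>X. \<rho> j z = \<rho> j z' \<and> dist x z < 1 / Suc j \<and> dist x' z' < 1 / Suc j))"
    for j and h :: "'c \<Rightarrow> 'b" and \<eta> :: real
  define good where "good j p \<longleftrightarrow> iso_onto (\<rho> j ` X) (q j ` T) (fst p) \<and> 0 < snd p \<and> close j (fst p) (snd p)" for j p
  have ex_close: "\<exists>\<eta>>0. \<eta> \<le> b \<and> close j h \<eta>" if h: "iso_onto (\<rho> j ` X) (q j ` T) h" and "b > 0" for j h b
  proof -
    have "continuous_on X (\<lambda>x. h (\<rho> j x))"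
      by (rule continuous_on_compose2[where t="\<rho> j ` X", OF _ \<rho>[of j]]) (use h in \<open>simp_all add: iso_onto_def\<close>)
    then obtain \<kappa> where \<kappa>: "\<kappa> > 0" "\<forall>x\<in>X. \<forall>x'\<in>X. dist (h (\<rho> j x)) (h (\<rho> j x')) < \<kappa> \<longrightarrow>
           (\<exists>z\<in>X. \<exists>z'\<in>X. h (\<rho> j z) = h (\<rho> j z') \<and> dist x z < 1 / Suc j \<and> dist x' z' < 1 / Suc j)"
      using compact_kernel_separation[OF X, of "\<lambda>x. h (\<rho> j x)" "1 / Suc j"] by auto
    have eq: "\<rho> j z = \<rho> j z'" if "z \<in> X" "z' \<in> X" "h (\<rho> j z) = h (\<rho> j z')" for z z'
      using that h unfolding iso_onto_def by (meson imageI inj_onD)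
    show ?thesis
    proof (intro exI[of _ "min b (\<kappa>/5)"] conjI)
      show "close j h (min b (\<kappa>/5))"
        unfolding close_def
      proof (intro ballI impI)
        fix x x' assume "x \<in> X" "x' \<in> X" "dist (h (\<rho> j x)) (h (\<rho> j x')) < 5 * min b (\<kappa>/5)"
        then have "dist (h (\<rho> j x)) (h (\<rho> j x')) < \<kappa>" by linarith
        then show "\<exists>z\<in>X. \<exists>z'\<in>X. \<rho> j z = \<rho> j z' \<and> dist x z < 1 / Suc j \<and> dist x' z' < 1 / Suc j"
          using \<kappa>(2) \<open>x \<in> X\<close> \<open>x' \<in> X\<close> eq by meson
      qed
    qed (use \<open>b > 0\<close> \<kappa> in auto)
  qed
  \<comment> \<open>Halving the tolerance at every stage makes all corrections from stage
    \<open>i\<close> on sum to at most twice the first one.\<close>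
  define R where "R j p p' \<longleftrightarrow> snd p' \<le> snd p / 2 \<and>
      (\<forall>x\<in>X. dist (q j (fst p' (\<rho> (Suc j) x))) (fst p (\<rho> j x)) \<le> snd p)" for j p and p' :: "('c \<Rightarrow> 'b) \<times> real"
  obtain \<eta>0 where \<eta>0: "0 < \<eta>0" "\<eta>0 \<le> \<epsilon>/2" "close 0 h0 \<eta>0"
    using ex_close[OF h0, of "\<epsilon>/2"] \<open>\<epsilon> > 0\<close> by auto
  have "\<exists>s. \<forall>n. (good n (s n) \<and> (n = 0 \<longrightarrow> s n = (h0, \<eta>0))) \<and> R n (s n) (s (Suc n))"
  proof (rule dependent_nat_choice)
    show "\<exists>p. good 0 p \<and> (0 = (0::nat) \<longrightarrow> p = (h0, \<eta>0))"
      using h0 \<eta>0 by (auto simp: good_def)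
  next
    fix p j assume "good j p \<and> (j = 0 \<longrightarrow> p = (h0, \<eta>0))"
    then have p: "iso_onto (\<rho> j ` X) (q j ` T) (fst p)" "0 < snd p" by (auto simp: good_def)
    obtain h' where h': "iso_onto (\<rho> (Suc j) ` X) (q (Suc j) ` T) h'"
        "\<forall>x\<in>X. dist (q j (h' (\<rho> (Suc j) x))) (fst p (\<rho> j x)) \<le> snd p"
      using step[OF p] by blast
    obtain \<eta> where "\<eta> > 0" "\<eta> \<le> snd p / 2" "close (Suc j) h' \<eta>"
      using ex_close[OF h'(1), of "snd p / 2"] p(2) by auto
    then show "\<exists>p'. (good (Suc j) p' \<and> (Suc j = 0 \<longrightarrow> p' = (h0, \<eta>0))) \<and> R j p p'"
      using h' by (intro exI[of _ "(h', \<eta>)"]) (auto simp: good_def R_def)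
  qed
  then obtain s where s: "\<And>n. good n (s n)" "s 0 = (h0, \<eta>0)" "\<And>n. R n (s n) (s (Suc n))" by blast
  define h where "h j = fst (s j)" for j
  define \<eta> where "\<eta> j = snd (s j)" for j
  have h: "iso_onto (\<rho> j ` X) (q j ` T) (h j)" for j using s(1)[of j] by (auto simp: good_def h_def)
  have \<eta>: "0 < \<eta> j" "\<eta> (Suc j) \<le> \<eta> j / 2" "close j (h j) (\<eta> j)" for j
    using s(1)[of j] s(3)[of j] by (auto simp: good_def h_def \<eta>_def R_def)
  have hh: "dist (q j (h (Suc j) (\<rho> (Suc j) x))) (h j (\<rho> j x)) \<le> \<eta> j" if "x \<in> X" for j x
    using s(3)[of j] that by (auto simp: h_def \<eta>_def R_def)
  define H where "H j x = h j (\<rho> j x)" for j x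
  have HX: "H j ` X = q j ` T" for j
    using h[of j] by (auto simp: iso_onto_def H_def)
  then have HT: "H j x \<in> T" if "x \<in> X" for j x
    using imageI[OF that, of "H j"] qT[of j] by auto
  have contH: "continuous_on X (H j)" for j
  proof -
    have "continuous_on (\<rho> j ` X) (h j)" using h[of j] unfolding iso_onto_def by blast
    then show ?thesis unfolding H_def by (rule continuous_on_compose2[OF _ \<rho>[of j] order_refl])
  qed
  have qH: "q j (H j x) = H j x" if "x \<in> X" for j x
  proof -
    have "H j x \<in> q j ` T" using imageI[OF that, of "H j"] HX[of j] by simp
    then obtain a where "a \<in> T" "H j x = q j a" by (rule imageE)
    then show ?thesis using qq[of a j j] by simp
  qed
  \<comment> \<open>The subtracted term is what lets the induction telescope: a step costs at most
    \<open>\<eta> m\<close>, and halving gives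
    \<open>\<eta> m \<le> 2 * \<eta> m - 2 * \<eta> (Suc m)\<close>.\<close>
  have A: "dist (q i (H m x)) (H i x) \<le> 2 * \<eta> i - 2 * \<eta> m" if "x \<in> X" "i \<le> m" for i m x
    using that(2)
  proof (induction m rule: dec_induct)
    case base
    then show ?case using qH[OF that(1)] by simp
  next
    case (step m)
    have "dist (q i (H (Suc m) x)) (q i (H m x)) = dist (q i (q m (H (Suc m) x))) (q i (H m x))"
      using qq HT that step by simp
    also have "\<dots> \<le> dist (q m (H (Suc m) x)) (H m x)"
      using q_lip HT that qT by (meson image_subset_iff)
    also have "\<dots> \<le> \<eta> m" using hh that by (simp add: H_def)
    finally show ?case
      using step \<eta>(2)[of m] dist_triangle[of "q i (H (Suc m) x)" "H i x" "q i (H m x)"] by linarith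
  qed
  have \<eta>_small: "\<exists>J. \<forall>j\<ge>J. \<eta> j < e" if "e > 0" for e
  proof -
    have le: "\<eta> j \<le> \<eta> 0 * (1/2)^j" for j
    proof (induction j)
      case (Suc j)
      then show ?case using \<eta>(2)[of j] by simp
    qed simp
    have "(\<lambda>j. \<eta> 0 * (1/2)^j) \<longlonglongrightarrow> \<eta> 0 * 0"
      by (intro tendsto_intros LIMSEQ_power_zero) auto
    then have "\<forall>\<^sub>F j in sequentially. \<eta> 0 * (1/2)^j < e"
      using order_tendstoD(2) that by fastforce
    then show ?thesis
      using le unfolding eventually_sequentially by (meson order_le_less_trans)
  qed
  have cauchy: "uniformly_Cauchy_on X H"
  proof (rule uniformly_Cauchy_onI)
    fix e :: real assume "e > 0"
    obtain J1 where J1: "\<And>j a. j \<ge> J1 \<Longrightarrow> a \<in> T \<Longrightarrow> dist (q j a) a < e/4"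
      using q_lim[of "e/4"] \<open>e > 0\<close> by auto
    obtain J2 where J2: "\<And>j. j \<ge> J2 \<Longrightarrow> \<eta> j < e/8" using \<eta>_small[of "e/8"] \<open>e > 0\<close> by auto
    define M where "M = max J1 J2"
    \<comment> \<open>Stages are only comparable after applying \<open>q M\<close>, which hardly
      moves points of \<open>T\<close> once \<open>M\<close> is large.\<close>
    have "dist (H m x) (H M x) < e/2" if "m \<ge> M" "x \<in> X" for m x
    proof -
      have "dist (q M (H m x)) (H m x) < e/4" using J1 HT that by (simp add: M_def)
      moreover have "dist (q M (H m x)) (H M x) < e/4"
        using A[OF that(2) that(1)] J2[of M] \<eta>(1)[of m] by (simp add: M_def)
      ultimately show ?thesis
        using dist_triangle3[of "H m x" "H M x" "q M (H m x)"] by linarith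
    qed
    then show "\<exists>M. \<forall>x\<in>X. \<forall>m\<ge>M. \<forall>n\<ge>M. dist (H m x) (H n x) < e"
      by (metis dist_triangle_half_l dist_commute)
  qed
  then have "uniformly_convergent_on X H"
    by (rule Cauchy_uniformly_convergent)
  then obtain f where f: "uniform_limit X H f sequentially"
    unfolding uniformly_convergent_on_def by blast
  have contf: "continuous_on X f"
    by (rule uniform_limit_theorem[OF _ f]) (use contH in auto)
  have limf: "(\<lambda>j. H j x) \<longlonglongrightarrow> f x" if "x \<in> X" for x
    using tendsto_uniform_limitI[OF f that] .
  have fT: "f x \<in> T" if "x \<in> X" for x
    by (rule closed_sequentially[OF compact_imp_closed[OF T] HT[OF that] limf[OF that]])
  have B: "dist (q i (f x)) (H i x) \<le> 2 * \<eta> i" if xX: "x \<in> X" for i x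
  proof (rule field_le_epsilon)
    fix e :: real assume "e > 0"
    obtain m where m: "m \<ge> i" "dist (H m x) (f x) < e"
      using limf[OF xX] \<open>e > 0\<close> unfolding LIMSEQ_def by (meson max.cobounded1 max.cobounded2)
    have "dist (q i (f x)) (q i (H m x)) \<le> e"
      using q_lip[OF fT[OF xX] HT[OF xX], of i m] m(2) by (simp add: dist_commute)
    then show "dist (q i (f x)) (H i x) \<le> 2 * \<eta> i + e"
      using A[OF xX m(1)] \<eta>(1)[of m] dist_triangle[of "q i (f x)" "H i x" "q i (H m x)"] by linarith
  qed
  have inj: "inj_on f X"
  proof (rule inj_onI)
    fix x x' assume x: "x \<in> X" "x' \<in> X" "f x = f x'"
    \<comment> \<open>Equal limits force the stage values to differ by at most
      \<open>4 * \<eta> j\<close>, inside the margin \<open>5 * \<eta> j\<close> reserved by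
      \<open>close\<close>.\<close>
    have "\<exists>z z'. z \<in> X \<and> z' \<in> X \<and> \<rho> j z = \<rho> j z' \<and> dist x z < 1 / Suc j \<and> dist x' z' < 1 / Suc j" for j
    proof -
      have "dist (H j x) (H j x') \<le> 4 * \<eta> j"
        using B[OF x(1), of j] B[OF x(2), of j, folded x(3)] dist_triangle3[of "H j x" "H j x'" "q j (f x)"] by linarith
      then have "dist (h j (\<rho> j x)) (h j (\<rho> j x')) < 5 * \<eta> j" using \<eta>(1)[of j] by (simp add: H_def)
      then show ?thesis using \<eta>(3)[of j] x unfolding close_def by blast
    qed
    then obtain z z' where z: "\<And>j. z j \<in> X" "\<And>j. z' j \<in> X" "\<And>j. \<rho> j (z j) = \<rho> j (z' j)"
      "\<And>j. dist x (z j) < 1 / Suc j" "\<And>j. dist x' (z' j) < 1 / Suc j" by metis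
    have lim: "y \<longlonglongrightarrow> a" if "\<And>j. dist a (y j) < 1 / Suc j" for a :: 'a and y
      by (rule metric_tendsto_imp_tendsto[OF LIMSEQ_inverse_real_of_nat])
         (use that in \<open>auto intro!: always_eventually simp: inverse_eq_divide dist_commute less_imp_le\<close>)
    have "\<rho> i x = \<rho> i x'" for i
    proof -
      \<comment> \<open>Points identified at stage \<open>j + i\<close> are identified at every
        earlier stage. Continuity of \<open>\<rho> i\<close> then carries the identification to the
        limits \<open>x\<close> and \<open>x'\<close>.\<close>
      have "\<rho> i (z (j + i)) = \<rho> i (z' (j + i))" for j
      proof -
        have "\<rho> m (z (j + i)) = \<rho> m (z' (j + i))" if "m \<le> j + i" for m
          using that
        proof (induction m rule: inc_induct)
          case base
          then show ?case by (rule z(3))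
        next
          case (step m)
          then show ?case using \<rho>_mono z(1,2) by blast
        qed
        then show ?thesis by simp
      qed
      moreover have "(\<lambda>j. \<rho> i (z (j + i))) \<longlonglongrightarrow> \<rho> i x"
        using LIMSEQ_ignore_initial_segment[OF lim[OF z(4)], of i] \<rho>[of i] x(1) z(1)
        by (simp add: continuous_on_sequentially comp_def)
      moreover have "(\<lambda>j. \<rho> i (z' (j + i))) \<longlonglongrightarrow> \<rho> i x'"
        using LIMSEQ_ignore_initial_segment[OF lim[OF z(5)], of i] \<rho>[of i] x(2) z(2)
        by (simp add: continuous_on_sequentially comp_def)
      ultimately show ?thesis using LIMSEQ_unique by fastforce
    qed
    then show "x = x'" using \<rho>_sep x by blast
  qed
  have surj: "\<tau> \<in> f ` X" if "\<tau> \<in> T" for \<tau>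
  proof -
    \<comment> \<open>Each stage attains \<open>q j \<tau>\<close> exactly. Since \<open>H j\<close>
      is uniformly near \<open>f\<close> and \<open>q j \<tau>\<close> tends to
      \<open>\<tau>\<close>, an accumulation point of these preimages is mapped to
      \<open>\<tau>\<close> by \<open>f\<close>.\<close>
    have "q j \<tau> \<in> H j ` X" for j using HX[of j] that by simp
    then have "\<forall>j. \<exists>x. x \<in> X \<and> H j x = q j \<tau>" by (metis imageE)
    then obtain x where x: "\<And>j. x j \<in> X" "\<And>j. H j (x j) = q j \<tau>" by metis
    have lim: "(\<lambda>j. f (x j)) \<longlonglongrightarrow> \<tau>"
    proof (rule metric_LIMSEQ_I)
      fix e :: real assume "e > 0"
      obtain J1 where J1: "\<And>j a. j \<ge> J1 \<Longrightarrow> a \<in> T \<Longrightarrow> dist (q j a) a < e/2"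
        using q_lim[of "e/2"] \<open>e > 0\<close> by auto
      have "\<forall>\<^sub>F j in sequentially. \<forall>x\<in>X. dist (H j x) (f x) < e/2"
        by (rule uniform_limitD[OF f]) (use \<open>e > 0\<close> in simp)
      then obtain J2 where J2: "\<And>j x. j \<ge> J2 \<Longrightarrow> x \<in> X \<Longrightarrow> dist (H j x) (f x) < e/2"
        unfolding eventually_sequentially by auto
      have "dist (f (x j)) \<tau> < e" if "j \<ge> max J1 J2" for j
        using J1[of j \<tau>] J2[of j "x j"] x that \<open>\<tau> \<in> T\<close> dist_triangle3[of "f (x j)" \<tau> "q j \<tau>"]
        by auto
      then show "\<exists>J. \<forall>j\<ge>J. dist (f (x j)) \<tau> < e" by blast
    qed
    obtain l r where l: "l \<in> X" "strict_mono (r :: nat \<Rightarrow> nat)" "(x \<circ> r) \<longlonglongrightarrow> l"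
      using X x(1) unfolding compact_def by metis
    have "(\<lambda>j. f (x (r j))) \<longlonglongrightarrow> f l"
      using contf l x(1) by (simp add: continuous_on_sequentially comp_def)
    moreover have "(\<lambda>j. f (x (r j))) \<longlonglongrightarrow> \<tau>"
      using LIMSEQ_subseq_LIMSEQ[OF lim l(2)] by (simp add: comp_def)
    ultimately have "f l = \<tau>" using LIMSEQ_unique by blast
    then show ?thesis using l(1) by blast
  qed
  have "dist (q 0 (f x)) (h0 (\<rho> 0 x)) \<le> \<epsilon>" if "x \<in> X" for x
    using B[OF that, of 0] s(2) \<eta>0(2) by (simp add: H_def h_def \<eta>_def)
  then show ?thesis
    using contf inj surj fT unfolding iso_onto_def by (intro exI[of _ f]) auto
qed

section \<open>A parametric form of Keller's theorem\<close>

text \<open>Projection to the first \<open>m\<close> coordinates, padded by zeros so that all stages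
  live in one type, as \<open>approximate_inverse_limit\<close> demands.\<close>

definition trunc :: "nat \<Rightarrow> (nat \<Rightarrow> real) \<Rightarrow> nat \<Rightarrow> real" where
  "trunc m v = (\<lambda>i. if i < m then v i else 0)"

definition tr :: "nat \<Rightarrow> 'y \<times> (nat \<Rightarrow> real) \<Rightarrow> 'y \<times> (nat \<Rightarrow> real)" where
  "tr m p = (fst p, trunc m (snd p))"

definition cube :: "(nat \<Rightarrow> real) set" where
  "cube = {v. \<forall>i. v i \<in> {-1..1}}"

lemma compact_cube: "compact cube"
  unfolding cube_def by (intro compact_box) auto

lemma continuous_on_coord:
  fixes f :: "'a::topological_space \<Rightarrow> nat \<Rightarrow> 'b::topological_space"
  shows "continuous_on S f \<Longrightarrow> continuous_on S (\<lambda>x. f x i)"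
  by (rule continuous_on_product_then_coordinatewise)

lemma continuous_on_trunc [continuous_intros]:
  "continuous_on S f \<Longrightarrow> continuous_on S (\<lambda>x. trunc m (f x))"
  unfolding trunc_def
proof (rule continuous_on_coordinatewise_then_product)
  fix i assume "continuous_on S f"
  then show "continuous_on S (\<lambda>x. if i < m then f x i else 0)"
    by (cases "i < m") (simp_all add: continuous_on_coord)
qed

lemma continuous_on_tr:
  fixes S :: "('y::topological_space \<times> (nat \<Rightarrow> real)) set"
  shows "continuous_on S (tr m)"
  unfolding tr_def by (intro continuous_intros)

lemma dist_trunc_le: "dist (trunc m v) (trunc m w) \<le> dist v w"
  by (rule dist_fun_lipschitz) (auto simp: trunc_def)

lemma dist_tr_le:
  fixes p p' :: "'y::metric_space \<times> (nat \<Rightarrow> real)"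
  shows "dist (tr m p) (tr m p') \<le> dist p p'"
  unfolding dist_prod_def tr_def using dist_trunc_le[of m "snd p" "snd p'"]
  by (auto intro!: real_sqrt_le_mono add_mono power_mono)

lemma trunc_trunc: "trunc m (trunc n v) = trunc (min m n) v"
  by (auto simp: trunc_def)

lemma tr_tr: "tr m (tr n p) = tr (min m n) p"
  by (simp add: tr_def trunc_trunc)

definition ins :: "nat \<Rightarrow> ('y \<times> (nat \<Rightarrow> real)) \<times> real \<Rightarrow> 'y \<times> (nat \<Rightarrow> real)" where
  "ins n p = (fst (fst p), \<lambda>i. if i = n then snd p else snd (fst p) i)"

lemma continuous_on_ins:
  fixes A :: "(('y::topological_space \<times> (nat \<Rightarrow> real)) \<times> real) set"
  shows "continuous_on A (ins n)"
proof -
  have "continuous_on A (\<lambda>p i. if i = n then snd p else snd (fst p) i)"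
  proof (rule continuous_on_coordinatewise_then_product)
    fix i
    have "continuous_on A (\<lambda>p. snd (fst p) i)"
      by (rule continuous_on_coord) (intro continuous_on_snd continuous_on_fst continuous_on_id)
    moreover have "continuous_on A snd" by (rule continuous_on_snd[OF continuous_on_id])
    ultimately show "continuous_on A (\<lambda>p. if i = n then snd p else snd (fst p) i)"
      by (cases "i = n") simp_all
  qed
  then show ?thesis
    unfolding ins_def by (intro continuous_on_Pair continuous_on_fst continuous_on_id)
qed

lemma inj_on_ins: "inj_on (ins n) ((tr n ` P) \<times> R)"
proof (rule inj_onI)
  fix p1 p2 :: "('a \<times> (nat \<Rightarrow> real)) \<times> real"
  assume p: "p1 \<in> tr n ` P \<times> R" "p2 \<in> tr n ` P \<times> R" "ins n p1 = ins n p2"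
  have zero: "snd x n = 0" if "x \<in> tr n ` P" for x :: "'a \<times> (nat \<Rightarrow> real)"
    using that by (elim imageE) (simp add: tr_def trunc_def)
  have z: "snd (fst p1) n = 0" "snd (fst p2) n = 0"
    using p(1,2) zero[of "fst p1"] zero[of "fst p2"] by (simp_all only: mem_Times_iff)
  have 1: "fst (fst p1) = fst (fst p2)" using p(3) by (simp add: ins_def)
  have eq: "(if i = n then snd p1 else snd (fst p1) i) = (if i = n then snd p2 else snd (fst p2) i)" for i
    using arg_cong[OF p(3), of "\<lambda>x. snd x i"] by (simp only: ins_def snd_conv)
  have 2: "snd p1 = snd p2" using eq[of n] by simp
  have "snd (fst p1) i = snd (fst p2) i" for i
    using eq[of i] z by (cases "i = n") simp_all
  then have "snd (fst p1) = snd (fst p2)" by blast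
  with 1 2 show "p1 = p2" by (simp add: prod_eq_iff)
qed

lemma tr_ins: "ins n (tr n (y, v), t) = tr (Suc n) (y, v(n := t))"
  by (auto simp: ins_def tr_def trunc_def)

lemma iso_onto_ins:
  fixes Y :: "'y::topological_space set"
  shows "iso_onto (tr n ` (Y \<times> cube) \<times> {-1..1}) (tr (Suc n) ` (Y \<times> cube)) (ins n)"
proof -
  have "ins n ` (tr n ` (Y \<times> cube) \<times> {-1..1}) = tr (Suc n) ` (Y \<times> cube)" (is "?A = ?B")
  proof
    show "?A \<subseteq> ?B"
    proof
      fix p assume "p \<in> ?A"
      then obtain y v t where *: "y \<in> Y" "v \<in> cube" "t \<in> {-1..1}" "p = ins n (tr n (y, v), t)"
        by blast
      then have "v(n := t) \<in> cube" by (auto simp: cube_def)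
      with * show "p \<in> ?B" by (simp add: tr_ins)
    qed
    show "?B \<subseteq> ?A"
    proof
      fix p assume "p \<in> ?B"
      then obtain y v where *: "y \<in> Y" "v \<in> cube" "p = tr (Suc n) (y, v)" by blast
      then have "p = ins n (tr n (y, v), v n)" by (simp add: tr_ins)
      moreover have "v n \<in> {-1..1}" using * by (auto simp: cube_def)
      ultimately show "p \<in> ?A" using * by blast
    qed
  qed
  then show ?thesis
    by (simp add: iso_onto_def continuous_on_ins inj_on_ins)
qed

text \<open>Lower semicontinuity of the fibres keeps nearby suprema from dropping. The closed graph
  and the uniform bound keep them from jumping up, because a limit of large suprema would itself
  belong to \<open>D z\<close>.\<close>

lemma continuous_on_Sup_fibre:
  fixes D :: "'z::metric_space \<Rightarrow> real set"
  assumes ne: "\<And>z. z \<in> R \<Longrightarrow> D z \<noteq> {}" and bd: "\<And>z s. z \<in> R \<Longrightarrow> s \<in> D z \<Longrightarrow> \<bar>s\<bar> \<le> M"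
    and closed: "\<And>z s zs ss. z \<in> R \<Longrightarrow> (\<And>n. zs n \<in> R) \<Longrightarrow> (\<And>n::nat. ss n \<in> D (zs n)) \<Longrightarrow>
       zs \<longlonglongrightarrow> z \<Longrightarrow> ss \<longlonglongrightarrow> s \<Longrightarrow> s \<in> D z"
    and lsc: "\<And>z s e. z \<in> R \<Longrightarrow> s \<in> D z \<Longrightarrow> e > 0 \<Longrightarrow>
       \<exists>d>0. \<forall>z'\<in>R. dist z' z < d \<longrightarrow> (\<exists>s'\<in>D z'. \<bar>s' - s\<bar> < e)"
  shows "continuous_on R (\<lambda>z. Sup (D z))"
    and "\<And>z. z \<in> R \<Longrightarrow> Sup (D z) \<in> D z"
proof -
  have bdd: "bdd_above (D z)" if "z \<in> R" for z
    using bd[OF that] by (meson abs_le_D1 bdd_aboveI)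
  show mem: "Sup (D z) \<in> D z" if "z \<in> R" for z
  proof -
    have "\<exists>s\<in>D z. Sup (D z) - 1 / Suc n < s" for n
      using less_cSup_iff[OF ne[OF that] bdd[OF that], of "Sup (D z) - 1 / Suc n"] by simp
    then obtain ss where ss: "\<And>n. ss n \<in> D z" "\<And>n. Sup (D z) - 1 / Suc n < ss n" by metis
    have "ss \<longlonglongrightarrow> Sup (D z)"
    proof (rule tendsto_sandwich)
      show "(\<lambda>n. Sup (D z) - 1 / Suc n) \<longlonglongrightarrow> Sup (D z)"
        using tendsto_diff[OF tendsto_const LIMSEQ_inverse_real_of_nat, of "Sup (D z)"]
        by (simp add: inverse_eq_divide)
      show "\<forall>\<^sub>F n in sequentially. Sup (D z) - 1 / Suc n \<le> ss n"
        by (intro always_eventually allI less_imp_le ss(2))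
      show "\<forall>\<^sub>F n in sequentially. ss n \<le> Sup (D z)"
        by (intro always_eventually allI cSup_upper ss(1) bdd[OF that])
    qed (rule tendsto_const)
    then show ?thesis using closed[of z "\<lambda>n. z" ss] ss that by auto
  qed
  show "continuous_on R (\<lambda>z. Sup (D z))"
    unfolding continuous_on_def
  proof (intro ballI order_tendstoI)
    fix z a assume z: "z \<in> R" and a: "a < Sup (D z)"
    obtain d where d: "d > 0" "\<And>z'. z' \<in> R \<Longrightarrow> dist z' z < d \<Longrightarrow> \<exists>s'\<in>D z'. \<bar>s' - Sup (D z)\<bar> < Sup (D z) - a"
      using lsc[OF z mem[OF z], of "Sup (D z) - a"] a by auto
    have "a < Sup (D z')" if z': "z' \<in> R" "dist z' z < d" for z'
    proof -
      obtain s' where "s' \<in> D z'" "\<bar>s' - Sup (D z)\<bar> < Sup (D z) - a" using d(2)[OF z'] by blast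
      then show ?thesis using cSup_upper[OF _ bdd[OF z'(1)], of s'] by linarith
    qed
    then show "\<forall>\<^sub>F z' in at z within R. a < Sup (D z')"
      unfolding eventually_at using d(1) by blast
  next
    fix z a assume z: "z \<in> R" and a: "Sup (D z) < a"
    show "\<forall>\<^sub>F z' in at z within R. Sup (D z') < a"
    proof (rule ccontr)
      assume "\<not> ?thesis"
      then have *: "\<not> (\<exists>d>0. \<forall>z'\<in>R. z' \<noteq> z \<and> dist z' z < d \<longrightarrow> Sup (D z') < a)"
        by (simp add: eventually_at)
      have "\<exists>z'. z' \<in> R \<and> dist z' z < 1 / Suc n \<and> a \<le> Sup (D z')" for n
      proof -
        have "0 < 1 / real (Suc n)" by simp
        with * have "\<not> (\<forall>z'\<in>R. z' \<noteq> z \<and> dist z' z < 1 / Suc n \<longrightarrow> Sup (D z') < a)" by blast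
        then show ?thesis by (meson not_less)
      qed
      then obtain zs where zs: "\<And>n. zs n \<in> R" "\<And>n. dist (zs n) z < 1 / Suc n" "\<And>n. a \<le> Sup (D (zs n))"
        by metis
      have zl: "zs \<longlonglongrightarrow> z"
        by (rule metric_tendsto_imp_tendsto[OF LIMSEQ_inverse_real_of_nat])
           (use zs in \<open>auto intro!: always_eventually simp: inverse_eq_divide less_imp_le\<close>)
      have "\<forall>n. Sup (D (zs n)) \<in> {-M..M}" using bd[OF zs(1) mem[OF zs(1)]] by (simp add: abs_le_iff minus_le_iff)
      then obtain l r where l: "strict_mono (r :: nat \<Rightarrow> nat)" "((\<lambda>n. Sup (D (zs n))) \<circ> r) \<longlonglongrightarrow> l"
        using compact_Icc[of "-M" M] unfolding compact_def by meson
      have "l \<in> D z"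
      proof (rule closed[OF z])
        show "(zs \<circ> r) n \<in> R" for n using zs(1) by simp
        show "((\<lambda>n. Sup (D (zs n))) \<circ> r) n \<in> D ((zs \<circ> r) n)" for n using mem zs(1) by simp
      qed (rule LIMSEQ_subseq_LIMSEQ[OF zl l(1)], rule l(2))
      moreover have "a \<le> l"
      proof (rule LIMSEQ_le_const[OF l(2)], intro exI allI impI)
        fix n show "a \<le> ((\<lambda>n. Sup (D (zs n))) \<circ> r) n" using zs(3) by simp
      qed
      ultimately show False using cSup_upper[OF _ bdd[OF z], of l] a by linarith
    qed
  qed
qed

lemma continuous_on_Inf_fibre:
  fixes D :: "'z::metric_space \<Rightarrow> real set"
  assumes ne: "\<And>z. z \<in> R \<Longrightarrow> D z \<noteq> {}" and bd: "\<And>z s. z \<in> R \<Longrightarrow> s \<in> D z \<Longrightarrow> \<bar>s\<bar> \<le> M"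
    and closed: "\<And>z s zs ss. z \<in> R \<Longrightarrow> (\<And>n. zs n \<in> R) \<Longrightarrow> (\<And>n::nat. ss n \<in> D (zs n)) \<Longrightarrow>
       zs \<longlonglongrightarrow> z \<Longrightarrow> ss \<longlonglongrightarrow> s \<Longrightarrow> s \<in> D z"
    and lsc: "\<And>z s e. z \<in> R \<Longrightarrow> s \<in> D z \<Longrightarrow> e > 0 \<Longrightarrow>
       \<exists>d>0. \<forall>z'\<in>R. dist z' z < d \<longrightarrow> (\<exists>s'\<in>D z'. \<bar>s' - s\<bar> < e)"
  shows "continuous_on R (\<lambda>z. Inf (D z))"
    and "\<And>z. z \<in> R \<Longrightarrow> Inf (D z) \<in> D z"
proof -
  let ?D = "\<lambda>z. uminus ` D z"
  have 1: "?D z \<noteq> {}" if "z \<in> R" for z using ne that by auto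
  have 2: "\<bar>s\<bar> \<le> M" if "z \<in> R" "s \<in> ?D z" for z s using bd that by auto
  have 3: "s \<in> ?D z" if z: "z \<in> R" and zs: "\<And>n. zs n \<in> R" "\<And>n::nat. ss n \<in> ?D (zs n)" "zs \<longlonglongrightarrow> z" "ss \<longlonglongrightarrow> s"
    for z s zs ss
  proof -
    have "- ss n \<in> D (zs n)" for n using zs(2)[of n] by auto
    moreover have "(\<lambda>n. - ss n) \<longlonglongrightarrow> - s" using zs(4) by (rule tendsto_minus)
    ultimately have "- s \<in> D z"
      by (rule closed[where zs=zs and ss="\<lambda>n. - ss n", OF z zs(1) _ zs(3)])
    then show ?thesis by force
  qed
  have 4: "\<exists>d>0. \<forall>z'\<in>R. dist z' z < d \<longrightarrow> (\<exists>s'\<in>?D z'. \<bar>s' - s\<bar> < e)"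
    if z: "z \<in> R" "s \<in> ?D z" "e > 0" for z s e
  proof -
    have "- s \<in> D z" using z(2) by auto
    from lsc[OF z(1) this z(3)] obtain d where d: "d > 0"
      "\<And>z'. z' \<in> R \<Longrightarrow> dist z' z < d \<Longrightarrow> \<exists>s'\<in>D z'. \<bar>s' - - s\<bar> < e" by blast
    have "\<exists>s'\<in>?D z'. \<bar>s' - s\<bar> < e" if "z' \<in> R" "dist z' z < d" for z'
      using d(2)[OF that] by (force simp: abs_minus_commute)
    with d(1) show ?thesis by blast
  qed
  have eq: "Inf (D z) = - Sup (?D z)" for z by (simp add: Inf_real_def)
  show "continuous_on R (\<lambda>z. Inf (D z))"
    unfolding eq by (rule continuous_on_minus[OF continuous_on_Sup_fibre(1)[of R ?D M, OF 1 2 3 4]])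
  fix z assume z: "z \<in> R"
  have "Sup (?D z) \<in> ?D z"
  proof (rule continuous_on_Sup_fibre(2)[of R ?D M])
    show "z \<in> R" by fact
  qed (fact 1 2 3 4)+
  then obtain s where "s \<in> D z" "Sup (?D z) = - s" by blast
  then show "Inf (D z) \<in> D z" by (simp add: eq)
qed

section \<open>Families of compact convex fibres and their finite projections\<close>

definition cyl :: "('y \<times> (nat \<Rightarrow> real)) set \<Rightarrow> nat \<Rightarrow> 'y \<Rightarrow> (nat \<Rightarrow> real) \<Rightarrow> bool" where
  "cyl \<Gamma> m y w \<longleftrightarrow> (\<exists>v. (y, v) \<in> \<Gamma> \<and> (\<forall>i<m. w i = v i))"

lemma tendsto_fun_iff:
  fixes f :: "'a \<Rightarrow> nat \<Rightarrow> 'b::topological_space"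
  shows "(f \<longlongrightarrow> l) F \<longleftrightarrow> (\<forall>i. ((\<lambda>x. f x i) \<longlongrightarrow> l i) F)"
  using limitin_componentwise[of "\<lambda>i. euclidean" UNIV f l F]
  by (simp add: euclidean_product_topology)

text \<open>\<open>fibre_lsc\<close> is lower semicontinuity of the fibres, uniform in the base
  point and in the coordinates; the upper half of continuity is compactness of
  \<open>\<Gamma>\<close>, exploited through \<open>cyl_closed\<close>.\<close>

locale convex_fibres =
  fixes Y :: "'y::metric_space set" and \<Gamma> :: "('y \<times> (nat \<Rightarrow> real)) set" and M :: real
  assumes compact_base: "compact Y" and compact_total: "compact \<Gamma>"
    and base: "\<And>y v. (y, v) \<in> \<Gamma> \<Longrightarrow> y \<in> Y"
    and bound: "\<And>y v i. (y, v) \<in> \<Gamma> \<Longrightarrow> \<bar>v i\<bar> \<le> M"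
    and fibre_convex: "\<And>y v w t. (y, v) \<in> \<Gamma> \<Longrightarrow> (y, w) \<in> \<Gamma> \<Longrightarrow> 0 \<le> t \<Longrightarrow> t \<le> 1 \<Longrightarrow>
       (y, \<lambda>i. (1 - t) * v i + t * w i) \<in> \<Gamma>"
    and fibre_lsc: "\<And>e. e > 0 \<Longrightarrow> \<exists>d>0. \<forall>y v y'. (y, v) \<in> \<Gamma> \<and> y' \<in> Y \<and> dist y' y < d \<longrightarrow>
       (\<exists>v'. (y', v') \<in> \<Gamma> \<and> (\<forall>i. \<bar>v' i - v i\<bar> \<le> e))"
begin

lemma cyl_iff: "cyl \<Gamma> m y w \<longleftrightarrow> (y, trunc m w) \<in> tr m ` \<Gamma>"
proof
  assume "cyl \<Gamma> m y w"
  then obtain v where v: "(y, v) \<in> \<Gamma>" "\<forall>i<m. w i = v i" unfolding cyl_def by blast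
  then have "trunc m w = trunc m v" by (auto simp: trunc_def)
  then show "(y, trunc m w) \<in> tr m ` \<Gamma>"
    by (intro image_eqI[OF _ v(1)]) (simp add: tr_def)
next
  assume "(y, trunc m w) \<in> tr m ` \<Gamma>"
  then obtain p where p: "p \<in> \<Gamma>" "(y, trunc m w) = tr m p" by blast
  then have "fst p = y" "trunc m w = trunc m (snd p)" by (simp_all add: tr_def)
  moreover from this(2) have "w i = snd p i" if "i < m" for i
    using that unfolding trunc_def by (metis (full_types))
  ultimately show "cyl \<Gamma> m y w" unfolding cyl_def using p(1) by (metis prod.collapse)
qed

lemma compact_tr: "compact (tr m ` \<Gamma>)"
  by (rule compact_continuous_image[OF continuous_on_tr compact_total])

lemma cyl_cong: "(\<And>i. i < m \<Longrightarrow> w i = w' i) \<Longrightarrow> cyl \<Gamma> m y w \<longleftrightarrow> cyl \<Gamma> m y w'"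
  unfolding cyl_def by simp

lemma cyl_mono: "m \<le> m' \<Longrightarrow> cyl \<Gamma> m' y w \<Longrightarrow> cyl \<Gamma> m y w"
  unfolding cyl_def using less_le_trans by blast

lemma cyl_convex:
  assumes "cyl \<Gamma> m y v" "cyl \<Gamma> m y w" "0 \<le> t" "t \<le> 1"
  shows "cyl \<Gamma> m y (\<lambda>i. (1 - t) * v i + t * w i)"
proof -
  obtain v' w' where *: "(y, v') \<in> \<Gamma>" "\<forall>i<m. v i = v' i" "(y, w') \<in> \<Gamma>" "\<forall>i<m. w i = w' i"
    using assms(1,2) unfolding cyl_def by blast
  show ?thesis unfolding cyl_def
    using fibre_convex[OF *(1,3) assms(3,4)] *(2,4) by (intro exI[of _ "\<lambda>i. (1 - t) * v' i + t * w' i"]) simp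
qed

lemma cyl_closed:
  assumes "\<And>n::nat. cyl \<Gamma> m (ys n) (ws n)" "ys \<longlonglongrightarrow> y" "ws \<longlonglongrightarrow> w"
  shows "cyl \<Gamma> m y w"
proof -
  have "(\<lambda>n. trunc m (ws n)) \<longlonglongrightarrow> trunc m w"
    unfolding tendsto_fun_iff trunc_def
  proof
    fix i
    have "(\<lambda>n. ws n i) \<longlonglongrightarrow> w i" using assms(3) tendsto_fun_iff by blast
    then show "(\<lambda>n. if i < m then ws n i else 0) \<longlonglongrightarrow> (if i < m then w i else 0)"
      by (cases "i < m") simp_all
  qed
  then have lim: "(\<lambda>n. (ys n, trunc m (ws n))) \<longlonglongrightarrow> (y, trunc m w)"
    by (intro tendsto_Pair assms(2))
  show ?thesis
    unfolding cyl_iff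
    by (rule closed_sequentially[OF compact_imp_closed[OF compact_tr] assms(1)[unfolded cyl_iff] lim])
qed

end

section \<open>Minkowski gauges of the projected fibres\<close>

locale centred_fibres = convex_fibres Y \<Gamma> M
  for Y :: "'y::metric_space set" and \<Gamma> M +
  fixes k :: nat and c :: "'y \<Rightarrow> nat \<Rightarrow> real" and s :: real
  assumes c_cont: "continuous_on Y c" and s_pos: "s > 0"
    and box_k: "\<And>y w. y \<in> Y \<Longrightarrow> (\<And>i. i < k \<Longrightarrow> \<bar>w i - c y i\<bar> \<le> s) \<Longrightarrow> cyl \<Gamma> k y w"
begin

text \<open>The Minkowski gauge, centred at \<open>c y\<close>, of the projection of the fibre to the first \<open>m\<close> coordinates;
  the argument \<open>w\<close> is a displacement from the centre.\<close>

definition J :: "nat \<Rightarrow> 'y \<Rightarrow> (nat \<Rightarrow> real) \<Rightarrow> real" where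
  "J m y w = Inf {t. 0 < t \<and> cyl \<Gamma> m y (\<lambda>i. c y i + w i / t)}"

lemma box:
  assumes "y \<in> Y" "m \<le> k" "\<And>i. i < m \<Longrightarrow> \<bar>w i - c y i\<bar> \<le> s"
  shows "cyl \<Gamma> m y w"
proof -
  have "cyl \<Gamma> k y (\<lambda>i. if i < m then w i else c y i)"
    using assms s_pos by (intro box_k) auto
  then have "cyl \<Gamma> m y (\<lambda>i. if i < m then w i else c y i)" by (rule cyl_mono[OF assms(2)])
  then show ?thesis by (rule cyl_cong[THEN iffD1, rotated]) simp
qed

text \<open>The projection is convex and contains the centre, hence is star-shaped about it: the new
  point is a convex combination of the old one and \<open>c y\<close> with weight
  \<open>t / t'\<close>.\<close>

lemma gauge_up:
  assumes "y \<in> Y" "m \<le> k" "0 < t" "t \<le> t'" "cyl \<Gamma> m y (\<lambda>i. c y i + w i / t)"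
  shows "cyl \<Gamma> m y (\<lambda>i. c y i + w i / t')"
proof -
  have "cyl \<Gamma> m y (\<lambda>i. (1 - t/t') * c y i + t/t' * (c y i + w i / t))"
    using assms s_pos by (intro cyl_convex[OF _ assms(5)] box) auto
  moreover have "(1 - t/t') * c y i + t/t' * (c y i + w i / t) = c y i + w i / t'" for i
    using assms by (simp add: field_simps)
  ultimately show ?thesis by simp
qed

lemma gauge_ex:
  assumes "y \<in> Y" "m \<le> k"
  shows "\<exists>t>0. cyl \<Gamma> m y (\<lambda>i. c y i + w i / t)"
proof -
  \<comment> \<open>The sum dominates each \<open>\<bar>w i\<bar>\<close> with \<open>i < m\<close>,
    so division by \<open>t\<close> brings the displacement into the box of half-width
    \<open>s\<close>; the summand 1 keeps \<open>t\<close> positive.\<close>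
  define t where "t = (\<Sum>i<m. \<bar>w i\<bar>) / s + 1"
  have t: "t > 0" unfolding t_def using s_pos by (intro add_nonneg_pos divide_nonneg_pos sum_nonneg) auto
  have "\<bar>w i\<bar> / t \<le> s" if "i < m" for i
  proof -
    have "\<bar>w i\<bar> \<le> (\<Sum>i<m. \<bar>w i\<bar>)" using that by (intro member_le_sum) auto
    also have "\<dots> \<le> s * t" using s_pos by (simp add: t_def field_simps)
    finally show ?thesis using t by (simp add: field_simps)
  qed
  then have "cyl \<Gamma> m y (\<lambda>i. c y i + w i / t)"
    using t by (intro box assms) (auto simp: abs_divide)
  with t show ?thesis by blast
qed

lemma J_nonneg:
  assumes "y \<in> Y" "m \<le> k" shows "0 \<le> J m y w"
  unfolding J_def using gauge_ex[OF assms] by (intro cInf_greatest) (auto intro: less_imp_le)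

text \<open>The infimum supplies only scales slightly above \<open>t\<close>; closedness of the
  projection makes \<open>t\<close> itself admissible. Positivity of \<open>t\<close> matters, as
  the gauge may be 0.\<close>

lemma J_le_iff:
  assumes "y \<in> Y" "m \<le> k" "t > 0"
  shows "J m y w \<le> t \<longleftrightarrow> cyl \<Gamma> m y (\<lambda>i. c y i + w i / t)"
proof
  assume "cyl \<Gamma> m y (\<lambda>i. c y i + w i / t)"
  then show "J m y w \<le> t"
    unfolding J_def using assms(3) by (intro cInf_lower) (auto intro!: bdd_belowI[of _ 0])
next
  assume le: "J m y w \<le> t"
  define ts where "ts n = t + 1 / Suc n" for n
  have ts: "0 < ts n" for n using assms(3) by (simp add: ts_def add_pos_pos)
  have tl: "ts \<longlonglongrightarrow> t"
    using tendsto_add[OF tendsto_const[of t] LIMSEQ_inverse_real_of_nat] unfolding ts_def by (simp add: inverse_eq_divide)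
  have mem: "cyl \<Gamma> m y (\<lambda>i. c y i + w i / ts n)" for n
  proof -
    have "J m y w < ts n" using le by (intro le_less_trans[OF le]) (simp add: ts_def)
    then obtain t' where "0 < t'" "t' < ts n" "cyl \<Gamma> m y (\<lambda>i. c y i + w i / t')"
      unfolding J_def using gauge_ex[OF assms(1,2), of w] cInf_lessD[of "{t. 0 < t \<and> cyl \<Gamma> m y (\<lambda>i. c y i + w i / t)}" "ts n"]
      by auto
    then show ?thesis using gauge_up[OF assms(1,2), of t' "ts n" w] by simp
  qed
  have lim: "(\<lambda>n i. c y i + w i / ts n) \<longlonglongrightarrow> (\<lambda>i. c y i + w i / t)"
    unfolding tendsto_fun_iff using assms(3) tl by (auto intro!: tendsto_intros)
  show "cyl \<Gamma> m y (\<lambda>i. c y i + w i / t)"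
    by (rule cyl_closed[OF mem tendsto_const lim])
qed

lemma J_cong: "(\<And>i. i < m \<Longrightarrow> w i = w' i) \<Longrightarrow> J m y w = J m y w'"
  unfolding J_def using cyl_cong[of m "\<lambda>i. c y i + w i / t" "\<lambda>i. c y i + w' i / t" y for t] by simp

lemma J_mono:
  assumes "y \<in> Y" "m \<le> m'" "m' \<le> k"
  shows "J m y w \<le> J m' y w"
proof (rule field_le_epsilon)
  fix e :: real assume "e > 0"
  with J_nonneg[OF assms(1,3), of w] have pos: "J m' y w + e > 0" by simp
  have "J m' y w \<le> J m' y w + e" using \<open>e > 0\<close> by simp
  then show "J m y w \<le> J m' y w + e"
    using J_le_iff[OF assms(1,3) pos, of w] J_le_iff[OF assms(1) _ pos, of m w] cyl_mono[OF assms(2)] assms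
    by (meson order_trans)
qed

text \<open>Subadditivity is convexity of the projection: the weights \<open>a/(a+b)\<close> and
  \<open>b/(a+b)\<close> combine \<open>c + v/a\<close> and \<open>c + w/b\<close> to
  \<open>c + (v+w)/(a+b)\<close>. Half an \<open>e\<close> is added to each gauge so that
  \<open>a\<close> and \<open>b\<close> are positive.\<close>

lemma J_add:
  assumes "y \<in> Y" "m \<le> k"
  shows "J m y (\<lambda>i. v i + w i) \<le> J m y v + J m y w"
proof (rule field_le_epsilon)
  fix e :: real assume "e > 0"
  define a where "a = J m y v + e/2"
  define b where "b = J m y w + e/2"
  have ab: "a > 0" "b > 0" unfolding a_def b_def
    using J_nonneg[OF assms, of v] J_nonneg[OF assms, of w] \<open>e > 0\<close> by simp_all
  have "cyl \<Gamma> m y (\<lambda>i. c y i + v i / a)" "cyl \<Gamma> m y (\<lambda>i. c y i + w i / b)"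
    using J_le_iff[OF assms ab(1), of v] J_le_iff[OF assms ab(2), of w] \<open>e > 0\<close>
    by (simp_all add: a_def b_def)
  then have "cyl \<Gamma> m y (\<lambda>i. (1 - b/(a+b)) * (c y i + v i / a) + b/(a+b) * (c y i + w i / b))"
    using ab by (intro cyl_convex) auto
  moreover have "(1 - b/(a+b)) * (c y i + v i / a) + b/(a+b) * (c y i + w i / b) = c y i + (v i + w i)/(a+b)" for i
  proof -
    have "1 - b/(a+b) = a/(a+b)" using ab by (simp add: field_simps)
    moreover have "a/(a+b) * (c y i + v i / a) + b/(a+b) * (c y i + w i / b) = c y i * ((a+b)/(a+b)) + (v i + w i)/(a+b)"
    proof -
      have "a/(a+b) * (v i / a) = v i / (a+b)" "b/(a+b) * (w i / b) = w i / (a+b)" using ab by simp_all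
      moreover have "(v i + w i)/(a+b) = v i / (a+b) + w i / (a+b)" "(a+b)/(a+b) = a/(a+b) + b/(a+b)"
        by (simp_all only: add_divide_distrib)
      ultimately show ?thesis by (simp only: distrib_left mult.commute[of "c y i"] distrib_right add_ac)
    qed
    ultimately show ?thesis using ab by simp
  qed
  ultimately have "J m y (\<lambda>i. v i + w i) \<le> a + b"
    using J_le_iff[OF assms, of "a+b" "\<lambda>i. v i + w i"] ab by simp
  then show "J m y (\<lambda>i. v i + w i) \<le> J m y v + J m y w + e" by (simp add: a_def b_def)
qed

lemma J_zero: 
  assumes "y \<in> Y" "m \<le> k" "\<And>i. i < m \<Longrightarrow> w i = 0"
  shows "J m y w = 0"
proof -
  have "J m y w \<le> t" if "t > 0" for t
    using J_le_iff[OF assms(1,2) that] box[OF assms(1,2)] assms(3) s_pos by simp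
  then have "J m y w \<le> 0" by (rule field_le_epsilon[of _ 0, simplified])
  then show ?thesis using J_nonneg[OF assms(1,2)] by (simp add: antisym)
qed

lemma J_scale:
  assumes "y \<in> Y" "m \<le> k" "r \<ge> 0"
  shows "J m y (\<lambda>i. r * w i) = r * J m y w"
proof (cases "r = 0")
  case True
  then show ?thesis using J_zero[OF assms(1,2)] by simp
next
  case False
  then have r: "r > 0" using assms by simp
  have le: "J m y (\<lambda>i. r * w i) \<le> r * J m y w" if r: "r > 0" for r w
  proof (rule field_le_epsilon)
    fix e :: real assume e: "e > 0"
    define t where "t = J m y w + e / r"
    have t: "t > 0" "J m y w \<le> t" using J_nonneg[OF assms(1,2), of w] r e by (simp_all add: t_def add_nonneg_pos)
    then have "cyl \<Gamma> m y (\<lambda>i. c y i + w i / t)" using J_le_iff[OF assms(1,2)] by simp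
    moreover have "r * w i / (r * t) = w i / t" for i using r by simp
    ultimately have "J m y (\<lambda>i. r * w i) \<le> r * t"
      using J_le_iff[OF assms(1,2), of "r * t" "\<lambda>i. r * w i"] r t by simp
    moreover have "r * t = r * J m y w + e" using r by (simp add: t_def distrib_left)
    ultimately show "J m y (\<lambda>i. r * w i) \<le> r * J m y w + e" by simp
  qed
  have "J m y w = J m y (\<lambda>i. (1/r) * (r * w i))" using r by simp
  also have "\<dots> \<le> 1/r * J m y (\<lambda>i. r * w i)" using r by (intro le) simp
  finally have "r * J m y w \<le> J m y (\<lambda>i. r * w i)" using r by (simp add: field_simps)
  with le[OF r, of w] show ?thesis by simp
qed

text \<open>The centre and all fibre points have coordinates of modulus at most \<open>M\<close>, so
  a displacement of gauge 1 has coordinates at most \<open>2 * M\<close>. In particular the gauge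
  vanishes only at the centre.\<close>

lemma coord_le_J:
  assumes "y \<in> Y" "m \<le> k" "i < m"
  shows "\<bar>w i\<bar> \<le> 2 * M * J m y w"
proof -
  have b: "\<bar>v i\<bar> \<le> M" if "cyl \<Gamma> m y v" for v
    using that bound assms(3) unfolding cyl_def by metis
  have c: "\<bar>c y i\<bar> \<le> M" using b[OF box[OF assms(1,2), of "c y"]] s_pos by simp
  then have "0 \<le> M" by linarith
  have le: "\<bar>w i\<bar> \<le> 2 * M * t" if "t > 0" "J m y w \<le> t" for t
  proof -
    have "cyl \<Gamma> m y (\<lambda>i. c y i + w i / t)" using J_le_iff[OF assms(1,2)] that by simp
    then have "\<bar>c y i + w i / t\<bar> \<le> M" by (rule b)
    then have "\<bar>w i / t\<bar> \<le> 2 * M" using c by linarith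
    then show ?thesis using that by (simp add: abs_divide field_simps)
  qed
  show ?thesis
  proof (rule field_le_epsilon)
    fix e :: real assume e: "e > 0"
    define d where "d = e / (2 * M + 1)"
    have d: "d > 0" "2 * M * d \<le> e" using e \<open>0 \<le> M\<close> by (auto simp: d_def field_simps)
    have "\<bar>w i\<bar> \<le> 2 * M * (J m y w + d)" using d J_nonneg[OF assms(1,2), of w] by (intro le) auto
    then show "\<bar>w i\<bar> \<le> 2 * M * J m y w + e" using d by (simp add: algebra_simps)
  qed
qed

lemma J_le_box:
  assumes "y \<in> Y" "m \<le> k" "0 \<le> r" "\<And>i. i < m \<Longrightarrow> \<bar>w i\<bar> \<le> r * s"
  shows "J m y w \<le> r"
proof (cases "r = 0")
  case True
  then show ?thesis using J_zero[OF assms(1,2), of w] assms(4) by simp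
next
  case False
  then have r: "r > 0" using assms by simp
  have "\<bar>w i / r\<bar> \<le> s" if "i < m" for i
    using assms(4)[OF that] r by (simp add: abs_divide field_simps)
  then have "cyl \<Gamma> m y (\<lambda>i. c y i + w i / r)" by (intro box assms) simp
  then show ?thesis using J_le_iff[OF assms(1,2) r] by simp
qed

text \<open>Upper estimates come from lower semicontinuity of the fibres, with the error absorbed by
  the box around the centre; lower estimates come from the closed graph, applied along a subsequence
  of small gauges.\<close>

lemma J_continuous:
  assumes "m \<le> k"
  shows "continuous_on (Y \<times> UNIV) (\<lambda>p. J m (fst p) (snd p))"
  unfolding continuous_on_sequentially
proof (intro allI ballI impI, elim conjE)
  fix xs :: "nat \<Rightarrow> 'y \<times> (nat \<Rightarrow> real)" and p assume "p \<in> Y \<times> (UNIV :: (nat \<Rightarrow> real) set)" "\<forall>n. xs n \<in> Y \<times> UNIV" and lim: "xs \<longlonglongrightarrow> p"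
  define y w ys ws where "y = fst p" and "w = snd p" and "ys n = fst (xs n)" and "ws n = snd (xs n)" for n
  have yY: "y \<in> Y" "\<And>n. ys n \<in> Y"
    using \<open>p \<in> _\<close> \<open>\<forall>n. xs n \<in> _\<close> by (auto simp: y_def ys_def mem_Times_iff)
  have ys: "ys \<longlonglongrightarrow> y" unfolding y_def ys_def by (rule tendsto_fst[OF lim])
  have "ws \<longlonglongrightarrow> w" unfolding w_def ws_def by (rule tendsto_snd[OF lim])
  then have ws: "(\<lambda>n. ws n i) \<longlonglongrightarrow> w i" for i using tendsto_fun_iff[of ws] by blast
  have "(\<lambda>n. c (ys n)) \<longlonglongrightarrow> c y"
    using c_cont yY ys unfolding continuous_on_sequentially comp_def by blast
  then have cs: "(\<lambda>n. c (ys n) i) \<longlonglongrightarrow> c y i" for i using tendsto_fun_iff[of "\<lambda>n. c (ys n)"] by blast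
  have up: "\<forall>\<^sub>F n in sequentially. J m (ys n) (ws n) < a" if a: "J m y w < a" for a
  proof -
    obtain t where t: "J m y w < t" "t < a" using dense[OF a] by blast
    have t0: "t > 0" using J_nonneg[OF yY(1) assms, of w] t by linarith
    \<comment> \<open>Two errors of size \<open>\<beta>\<close> arise, one from moving the fibre
      point and one from moving centre and displacement. Together they stay below
      \<open>\<sigma> * s\<close>, which costs gauge at most \<open>\<sigma>\<close>; and
      \<open>t * (1 + \<sigma>)\<close> is still below \<open>a\<close>.\<close>
    define \<sigma> where "\<sigma> = (a - t) / (2 * t)"
    have \<sigma>: "\<sigma> > 0" "t * (1 + \<sigma>) < a" using t t0 by (simp_all add: \<sigma>_def field_simps)
    define \<beta> where "\<beta> = \<sigma> * s / 3"
    have \<beta>: "\<beta> > 0" using \<sigma> s_pos by (simp add: \<beta>_def)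
    obtain d where d: "d > 0" "\<And>y v y'. (y, v) \<in> \<Gamma> \<Longrightarrow> y' \<in> Y \<Longrightarrow> dist y' y < d \<Longrightarrow>
       (\<exists>v'. (y', v') \<in> \<Gamma> \<and> (\<forall>i. \<bar>v' i - v i\<bar> \<le> \<beta>))"
      using fibre_lsc[OF \<beta>] by blast
    have "cyl \<Gamma> m y (\<lambda>i. c y i + w i / t)" using J_le_iff[OF yY(1) assms t0, of w] t by simp
    then obtain v where v: "(y, v) \<in> \<Gamma>" "\<forall>i<m. c y i + w i / t = v i" unfolding cyl_def by blast
    have e1: "\<forall>\<^sub>F n in sequentially. dist (ys n) y < d" using tendstoD[OF ys d(1)] .
    have "\<forall>\<^sub>F n in sequentially. \<bar>(c (ys n) i + ws n i / t) - (c y i + w i / t)\<bar> < \<beta>" for i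
    proof -
      have "(\<lambda>n. c (ys n) i + ws n i / t) \<longlonglongrightarrow> c y i + w i / t"
        using t0 by (intro tendsto_intros cs ws) auto
      from tendstoD[OF this \<beta>] show ?thesis by (simp add: dist_real_def)
    qed
    then have e2: "\<forall>\<^sub>F n in sequentially. \<forall>i\<in>{..<m}. \<bar>(c (ys n) i + ws n i / t) - (c y i + w i / t)\<bar> < \<beta>"
      by (intro eventually_ball_finite) auto
    show ?thesis
      using e1 e2
    proof eventually_elim
      case (elim n)
      obtain v' where v': "(ys n, v') \<in> \<Gamma>" "\<And>i. \<bar>v' i - v i\<bar> \<le> \<beta>"
        using d(2)[OF v(1) yY(2) elim(1)] by blast
      define e where "e i = c (ys n) i + ws n i / t - v' i" for i
      have e: "\<bar>e i\<bar> \<le> \<sigma> * s" if "i < m" for i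
      proof -
        have "\<bar>(c (ys n) i + ws n i / t) - v i\<bar> < \<beta>" using elim(2) v(2) that by auto
        then have "\<bar>e i\<bar> \<le> 2 * \<beta>" unfolding e_def using v'(2)[of i] by linarith
        then show ?thesis using \<beta> by (simp add: \<beta>_def)
      qed
      have "cyl \<Gamma> m (ys n) v'" unfolding cyl_def using v'(1) by blast
      then have "J m (ys n) (\<lambda>i. v' i - c (ys n) i) \<le> 1"
        using J_le_iff[OF yY(2) assms, of 1 n "\<lambda>i. v' i - c (ys n) i"] by simp
      moreover have "J m (ys n) e \<le> \<sigma>"
        using J_le_box[OF yY(2) assms, of \<sigma> e] e \<sigma> by simp
      moreover have "J m (ys n) (\<lambda>i. ws n i / t) \<le> J m (ys n) (\<lambda>i. v' i - c (ys n) i) + J m (ys n) e"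
        using J_add[OF yY(2) assms, of n "\<lambda>i. v' i - c (ys n) i" e] by (simp add: e_def)
      ultimately have "J m (ys n) (\<lambda>i. ws n i / t) \<le> 1 + \<sigma>" by linarith
      moreover have "J m (ys n) (\<lambda>i. t * (ws n i / t)) = t * J m (ys n) (\<lambda>i. ws n i / t)"
        using t0 by (intro J_scale[OF yY(2) assms]) simp
      moreover have "(\<lambda>i. t * (ws n i / t)) = ws n" using t0 by simp
      ultimately have "J m (ys n) (ws n) \<le> t * (1 + \<sigma>)" using t0 by (simp add: mult_left_mono)
      with \<sigma>(2) show ?case by simp
    qed
  qed
  have low: "\<forall>\<^sub>F n in sequentially. a < J m (ys n) (ws n)" if a: "a < J m y w" for a
  proof (cases "a < 0")
    case True
    show ?thesis
    proof (intro always_eventually allI)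
      fix n show "a < J m (ys n) (ws n)" using True J_nonneg[OF yY(2) assms, of n "ws n"] by linarith
    qed
  next
    case False
    obtain t where t: "a < t" "t < J m y w" using dense[OF a] by blast
    have t0: "t > 0" using t False by simp
    show ?thesis
    proof (rule ccontr)
      assume "\<not> ?thesis"
      then have "\<exists>\<^sub>F n in sequentially. J m (ys n) (ws n) \<le> a"
        by (simp add: not_eventually not_less)
      then obtain r where r: "strict_mono (r :: nat \<Rightarrow> nat)" "\<And>n. J m (ys (r n)) (ws (r n)) \<le> a"
        using infinite_enumerate[of "{n. J m (ys n) (ws n) \<le> a}"]
        unfolding cofinite_eq_sequentially[symmetric] frequently_cofinite by blast
      have mem: "cyl \<Gamma> m (ys (r n)) (\<lambda>i. c (ys (r n)) i + ws (r n) i / t)" for n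
        using J_le_iff[OF yY(2) assms t0, of "r n" "ws (r n)"] r(2)[of n] t by simp
      have lim: "(\<lambda>n i. c (ys (r n)) i + ws (r n) i / t) \<longlonglongrightarrow> (\<lambda>i. c y i + w i / t)"
        unfolding tendsto_fun_iff
      proof
        fix i
        have "(\<lambda>n. c (ys n) i + ws n i / t) \<longlonglongrightarrow> c y i + w i / t"
          using t0 by (intro tendsto_intros cs ws) auto
        from LIMSEQ_subseq_LIMSEQ[OF this r(1)]
        show "(\<lambda>n. c (ys (r n)) i + ws (r n) i / t) \<longlonglongrightarrow> c y i + w i / t" by (simp add: comp_def)
      qed
      have "(\<lambda>n. ys (r n)) \<longlonglongrightarrow> y" using LIMSEQ_subseq_LIMSEQ[OF ys r(1)] by (simp add: comp_def)
      from cyl_closed[OF mem this lim] have "J m y w \<le> t" using J_le_iff[OF yY(1) assms t0, of w] by simp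
      with t show False by simp
    qed
  qed
  have "(\<lambda>n. J m (ys n) (ws n)) \<longlonglongrightarrow> J m y w"
    using low up by (rule order_tendstoI)
  then show "((\<lambda>p. J m (fst p) (snd p)) \<circ> xs) \<longlonglongrightarrow> J m (fst p) (snd p)"
    by (simp add: comp_def y_def w_def ys_def ws_def)
qed

end

context convex_fibres
begin

lemma in_tr_iff: "p \<in> tr m ` \<Gamma> \<longleftrightarrow> cyl \<Gamma> m (fst p) (snd p) \<and> trunc m (snd p) = snd p"
proof
  assume "p \<in> tr m ` \<Gamma>"
  then obtain q where "q \<in> \<Gamma>" "p = tr m q" by blast
  then have t: "trunc m (snd p) = snd p" by (simp add: tr_def trunc_trunc)
  then have "(fst p, trunc m (snd p)) \<in> tr m ` \<Gamma>" using \<open>p \<in> tr m ` \<Gamma>\<close> by simp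
  with t show "cyl \<Gamma> m (fst p) (snd p) \<and> trunc m (snd p) = snd p" by (simp add: cyl_iff)
next
  assume "cyl \<Gamma> m (fst p) (snd p) \<and> trunc m (snd p) = snd p"
  then show "p \<in> tr m ` \<Gamma>" using cyl_iff[of m "fst p" "snd p"] by (metis prod.collapse)
qed

lemma cyl_base: "cyl \<Gamma> m y v \<Longrightarrow> y \<in> Y"
  unfolding cyl_def using base by blast

end

context centred_fibres
begin

lemma J_convex:
  assumes "y \<in> Y" "m \<le> k" "0 \<le> t" "t \<le> 1"
  shows "J m y (\<lambda>i. (1 - t) * v i + t * w i) \<le> (1 - t) * J m y v + t * J m y w"
  using J_add[OF assms(1,2), of "\<lambda>i. (1 - t) * v i" "\<lambda>i. t * w i"]
    J_scale[OF assms(1,2), of "1 - t" v] J_scale[OF assms(1,2,3), of w] assms(4) by simp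

end

section \<open>Straightening one coordinate\<close>

locale keller_step = centred_fibres Y \<Gamma> M "Suc n" c s
  for Y :: "'y::metric_space set" and \<Gamma> M n c s +
  fixes \<delta> :: real
  assumes \<delta>: "0 < \<delta>" "\<delta> \<le> 1/2"
begin

definition j0 where "j0 p = J n (fst p) (snd p)"
definition j1 where "j1 p = J (Suc n) (fst p) (snd p)"

definition R :: "('y \<times> (nat \<Rightarrow> real)) set" where
  "R = {p. fst p \<in> Y \<and> j0 p \<le> 1 - \<delta>}"

definition D :: "('y \<times> (nat \<Rightarrow> real)) \<Rightarrow> real set" where
  "D p = {r. J (Suc n) (fst p) ((snd p)(n := r)) \<le> 1}"

lemma cont_j: "continuous_on (Y \<times> UNIV) j0" "continuous_on (Y \<times> UNIV) j1"
  using J_continuous[of n] J_continuous[of "Suc n"] by (simp_all add: j0_def[abs_def] j1_def[abs_def])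

lemma j_nonneg: "fst p \<in> Y \<Longrightarrow> 0 \<le> j0 p" "fst p \<in> Y \<Longrightarrow> 0 \<le> j1 p"
  unfolding j0_def j1_def by (auto intro: J_nonneg)

lemma j0_le_j1: "fst p \<in> Y \<Longrightarrow> j0 p \<le> j1 p"
  unfolding j0_def j1_def by (auto intro: J_mono)

text \<open>The projection to \<open>n\<close> coordinates is the image of the projection to
  \<open>Suc n\<close> coordinates, so a displacement lifts at every positive scale without
  increasing its gauge.\<close>

lemma extend:
  assumes "y \<in> Y" "\<tau> > 0" "J n y w \<le> \<tau>"
  shows "\<exists>r. J (Suc n) y (w(n := r)) \<le> \<tau>"
proof -
  have "cyl \<Gamma> n y (\<lambda>i. c y i + w i / \<tau>)" using J_le_iff[of y n \<tau> w] assms by simp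
  then obtain v where v: "(y, v) \<in> \<Gamma>" "\<forall>i<n. c y i + w i / \<tau> = v i" unfolding cyl_def by blast
  define r where "r = \<tau> * (v n - c y n)"
  have "c y i + (w(n := r)) i / \<tau> = v i" if "i < Suc n" for i
    using that v(2) assms(2) by (cases "i = n") (auto simp: r_def)
  then have "cyl \<Gamma> (Suc n) y (\<lambda>i. c y i + (w(n := r)) i / \<tau>)" unfolding cyl_def using v(1) by blast
  then show ?thesis using J_le_iff[of y "Suc n" \<tau> "w(n := r)"] assms by blast
qed

lemma upd_convex:
  "(\<lambda>i. (1 - t) * (w(n := r)) i + t * (w(n := r')) i) = w(n := (1 - t) * r + t * (r'::real))"
  by (auto simp: algebra_simps)

lemma cont_upd:
  "continuous_on S (\<lambda>p :: 'y \<times> (nat \<Rightarrow> real). (fst p, (snd p)(n := r)))"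
proof (rule continuous_on_Pair[OF continuous_on_fst[OF continuous_on_id]])
  show "continuous_on S (\<lambda>p :: 'y \<times> (nat \<Rightarrow> real). (snd p)(n := r))"
  proof (rule continuous_on_coordinatewise_then_product)
    fix i
    have "continuous_on S (\<lambda>p :: 'y \<times> (nat \<Rightarrow> real). snd p i)"
      by (rule continuous_on_coord[OF continuous_on_snd[OF continuous_on_id]])
    then show "continuous_on S (\<lambda>p :: 'y \<times> (nat \<Rightarrow> real). ((snd p)(n := r)) i)" by (cases "i = n") simp_all
  qed
qed

text \<open>A lift of gauge at most \<open>1 - \<delta>\<close> leaves \<open>\<delta>\<close> of
  gauge to spend, and by the box around the centre a change of the last coordinate by
  \<open>\<delta> * s\<close> costs no more than that.\<close>

lemma D_wide:
  assumes "p \<in> R"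
  shows "\<exists>r0. J (Suc n) (fst p) ((snd p)(n := r0)) \<le> 1 - \<delta> \<and> (\<forall>\<sigma>. \<bar>\<sigma>\<bar> \<le> \<delta> * s \<longrightarrow> r0 + \<sigma> \<in> D p)"
proof -
  have y: "fst p \<in> Y" and j: "J n (fst p) (snd p) \<le> 1 - \<delta>" using assms by (auto simp: R_def j0_def)
  obtain r0 where r0: "J (Suc n) (fst p) ((snd p)(n := r0)) \<le> 1 - \<delta>"
    using extend[OF y _ j] \<delta> by auto
  have "r0 + \<sigma> \<in> D p" if "\<bar>\<sigma>\<bar> \<le> \<delta> * s" for \<sigma>
  proof -
    have "J (Suc n) (fst p) (\<lambda>i. if i = n then \<sigma> else 0) \<le> \<delta>"
      using that \<delta> s_pos by (intro J_le_box[OF y]) auto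
    moreover have "(\<lambda>i. ((snd p)(n := r0)) i + (if i = n then \<sigma> else 0)) = (snd p)(n := r0 + \<sigma>)" by auto
    ultimately have "J (Suc n) (fst p) ((snd p)(n := r0 + \<sigma>)) \<le> 1"
      using J_add[OF y order_refl, of "(snd p)(n := r0)" "\<lambda>i. if i = n then \<sigma> else 0"] r0 by simp
    then show ?thesis by (simp add: D_def)
  qed
  with r0 show ?thesis by blast
qed

lemma D_ne: "p \<in> R \<Longrightarrow> D p \<noteq> {}"
  using D_wide[of p] \<delta> s_pos by (metis abs_zero empty_iff mult_pos_pos less_imp_le)

lemma D_bound:
  assumes "p \<in> R" "r \<in> D p" shows "\<bar>r\<bar> \<le> 2 * M"
proof -
  have y: "fst p \<in> Y" using assms by (simp add: R_def)
  have "\<bar>c (fst p) 0\<bar> \<le> M"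
  proof -
    have "cyl \<Gamma> (Suc n) (fst p) (c (fst p))" using box[OF y order_refl, of "c (fst p)"] s_pos by simp
    then show ?thesis unfolding cyl_def using bound by (metis zero_less_Suc)
  qed
  then have "0 \<le> M" by linarith
  have "\<bar>r\<bar> \<le> 2 * M * J (Suc n) (fst p) ((snd p)(n := r))"
    using coord_le_J[OF y order_refl, of n "(snd p)(n := r)"] by simp
  also have "\<dots> \<le> 2 * M * 1" using assms(2) \<open>0 \<le> M\<close> by (intro mult_left_mono) (auto simp: D_def)
  finally show ?thesis by simp
qed

lemma D_closed:
  assumes "p \<in> R" "\<And>n. ps n \<in> R" "\<And>m::nat. rs m \<in> D (ps m)" "ps \<longlonglongrightarrow> p" "rs \<longlonglongrightarrow> r"
  shows "r \<in> D p"
proof -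
  have lim: "(\<lambda>m. (snd (ps m))(n := rs m)) \<longlonglongrightarrow> (snd p)(n := r)"
    unfolding tendsto_fun_iff
  proof
    fix i
    have "(\<lambda>m. snd (ps m)) \<longlonglongrightarrow> snd p" by (rule tendsto_snd[OF assms(4)])
    then have "(\<lambda>m. snd (ps m) i) \<longlonglongrightarrow> snd p i" using tendsto_fun_iff[of "\<lambda>m. snd (ps m)"] by blast
    then show "(\<lambda>m. ((snd (ps m))(n := rs m)) i) \<longlonglongrightarrow> ((snd p)(n := r)) i"
      using assms(5) by (cases "i = n") simp_all
  qed
  define qs where "qs m = (fst (ps m), (snd (ps m))(n := rs m))" for m
  define q where "q = (fst p, (snd p)(n := r))"
  have "qs \<longlonglongrightarrow> q" unfolding qs_def q_def by (rule tendsto_Pair[OF tendsto_fst[OF assms(4)] lim])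
  moreover have "q \<in> Y \<times> UNIV" "\<forall>m. qs m \<in> Y \<times> UNIV" using assms(1,2) by (auto simp: R_def q_def qs_def)
  ultimately have "(\<lambda>m. j1 (qs m)) \<longlonglongrightarrow> j1 q"
    using cont_j(2) unfolding continuous_on_sequentially comp_def by blast
  moreover have "j1 (qs m) \<le> 1" for m using assms(3)[of m] by (simp add: j1_def qs_def D_def)
  ultimately have "j1 q \<le> 1" by (intro LIMSEQ_le_const2) auto
  then show ?thesis by (simp add: D_def q_def j1_def)
qed

lemma D_convex:
  assumes "fst p \<in> Y" "r \<in> D p" "r' \<in> D p" "0 \<le> t" "t \<le> 1"
  shows "(1 - t) * r + t * r' \<in> D p"
proof -
  have "J (Suc n) (fst p) ((snd p)(n := (1 - t) * r + t * r')) \<le>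
      (1 - t) * J (Suc n) (fst p) ((snd p)(n := r)) + t * J (Suc n) (fst p) ((snd p)(n := r'))"
    using J_convex[OF assms(1) order_refl assms(4,5), of "(snd p)(n := r)" "(snd p)(n := r')"]
    unfolding upd_convex .
  also have "\<dots> \<le> (1 - t) * 1 + t * 1"
    using assms by (intro add_mono mult_left_mono) (auto simp: D_def)
  finally show ?thesis by (simp add: D_def)
qed

text \<open>Moving \<open>r\<close> a little towards the value \<open>r0\<close> of
  \<open>D_wide\<close> makes the gauge strictly less than 1, and a strict inequality persists
  nearby by continuity. The fraction \<open>t\<close> limits the move to
  \<open>e / 2\<close>.\<close>

lemma D_lsc:
  assumes "p \<in> R" "r \<in> D p" "e > 0"
  shows "\<exists>d>0. \<forall>p'\<in>R. dist p' p < d \<longrightarrow> (\<exists>r'\<in>D p'. \<bar>r' - r\<bar> < e)"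
proof -
  have y: "fst p \<in> Y" using assms by (simp add: R_def)
  obtain r0 where r0: "J (Suc n) (fst p) ((snd p)(n := r0)) \<le> 1 - \<delta>" using D_wide[OF assms(1)] by blast
  define t where "t = min 1 (e / (2 * (\<bar>r0 - r\<bar> + 1)))"
  have pos: "0 < \<bar>r0 - r\<bar> + 1" by simp
  have t: "0 < t" "t \<le> 1" using assms(3) pos by (auto simp: t_def)
  have "t \<le> e / (2 * (\<bar>r0 - r\<bar> + 1))" by (simp add: t_def)
  then have te: "t * (\<bar>r0 - r\<bar> + 1) \<le> e / 2" using pos by (simp add: field_simps)
  define r1 where "r1 = (1 - t) * r + t * r0"
  have "\<bar>r1 - r\<bar> = t * \<bar>r0 - r\<bar>"
  proof -
    have "r1 - r = t * (r0 - r)" by (simp add: r1_def algebra_simps)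
    then show ?thesis using t by (simp add: abs_mult)
  qed
  also have "\<dots> \<le> t * (\<bar>r0 - r\<bar> + 1)" using t by simp
  finally have r1: "\<bar>r1 - r\<bar> < e" using te assms(3) by linarith
  have "J (Suc n) (fst p) ((snd p)(n := r1)) \<le>
      (1 - t) * J (Suc n) (fst p) ((snd p)(n := r)) + t * J (Suc n) (fst p) ((snd p)(n := r0))"
    using J_convex[OF y order_refl _ t(2), of "(snd p)(n := r)" "(snd p)(n := r0)"] t(1)
    unfolding upd_convex r1_def by simp
  also have "\<dots> \<le> (1 - t) * 1 + t * (1 - \<delta>)"
    using t r0 assms(2) by (intro add_mono mult_left_mono) (auto simp: D_def)
  also have "\<dots> < 1" using t \<delta> by (simp add: algebra_simps)
  finally have less: "j1 (fst p, (snd p)(n := r1)) < 1" by (simp add: j1_def)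
  have "continuous_on (Y \<times> UNIV) (\<lambda>p. j1 (fst p, (snd p)(n := r1)))"
    by (rule continuous_on_compose2[OF cont_j(2) cont_upd]) auto
  moreover have "p \<in> Y \<times> UNIV" using y by (simp add: mem_Times_iff)
  ultimately have "((\<lambda>p. j1 (fst p, (snd p)(n := r1))) \<longlongrightarrow> j1 (fst p, (snd p)(n := r1))) (at p within Y \<times> UNIV)"
    unfolding continuous_on_def by blast
  from order_tendstoD(2)[OF this less] obtain d where d: "d > 0"
    "\<And>p'. p' \<in> Y \<times> UNIV \<Longrightarrow> p' \<noteq> p \<Longrightarrow> dist p' p < d \<Longrightarrow> j1 (fst p', (snd p')(n := r1)) < 1"
    unfolding eventually_at by auto
  have "r1 \<in> D p'" if "p' \<in> R" "dist p' p < d" for p'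
  proof -
    have "p' \<in> Y \<times> UNIV" using that by (simp add: R_def mem_Times_iff)
    then have "j1 (fst p', (snd p')(n := r1)) < 1" using d(2)[of p'] less that by (cases "p' = p") auto
    then show ?thesis by (simp add: D_def j1_def)
  qed
  with d(1) r1 show ?thesis by blast
qed

definition lo where "lo p = Inf (D p)"
definition hi where "hi p = Sup (D p)"

lemma cont_lo: "continuous_on R lo" and lo_mem: "p \<in> R \<Longrightarrow> lo p \<in> D p"
  and cont_hi: "continuous_on R hi" and hi_mem: "p \<in> R \<Longrightarrow> hi p \<in> D p"
proof -
  show "continuous_on R lo"
    unfolding lo_def[abs_def] by (rule continuous_on_Inf_fibre(1)[OF D_ne D_bound D_closed D_lsc])
  show "continuous_on R hi"
    unfolding hi_def[abs_def] by (rule continuous_on_Sup_fibre(1)[OF D_ne D_bound D_closed D_lsc])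
  show "lo p \<in> D p" if "p \<in> R"
    unfolding lo_def by (rule continuous_on_Inf_fibre(2)[OF D_ne D_bound D_closed D_lsc that])
  show "hi p \<in> D p" if "p \<in> R"
    unfolding hi_def by (rule continuous_on_Sup_fibre(2)[OF D_ne D_bound D_closed D_lsc that])
qed

lemma D_le:
  assumes "p \<in> R" "r \<in> D p" shows "lo p \<le> r" "r \<le> hi p"
proof -
  have "bdd_below (D p)" "bdd_above (D p)"
    using D_bound[OF assms(1)] by (auto intro!: bdd_belowI[of _ "- (2*M)"] bdd_aboveI[of _ "2*M"] simp: abs_le_iff minus_le_iff)
  then show "lo p \<le> r" "r \<le> hi p"
    unfolding lo_def hi_def using assms(2) by (auto intro: cInf_lower cSup_upper)
qed

lemma lo_less_hi: "p \<in> R \<Longrightarrow> lo p < hi p"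
proof -
  assume p: "p \<in> R"
  obtain r0 where r0: "\<And>\<sigma>. \<bar>\<sigma>\<bar> \<le> \<delta> * s \<Longrightarrow> r0 + \<sigma> \<in> D p" using D_wide[OF p] by blast
  have pos: "\<delta> * s > 0" using \<delta> s_pos by simp
  have "lo p \<le> r0 + - (\<delta> * s)" "r0 + \<delta> * s \<le> hi p"
    using D_le(1)[OF p r0[of "- (\<delta> * s)"]] D_le(2)[OF p r0[of "\<delta> * s"]] pos by simp_all
  with pos show ?thesis by linarith
qed

lemma D_cong: "(\<And>i. i < n \<Longrightarrow> w i = w' i) \<Longrightarrow> D (y, w) = D (y, w')"
proof -
  assume *: "\<And>i. i < n \<Longrightarrow> w i = w' i"
  have "J (Suc n) y (w(n := r)) = J (Suc n) y (w'(n := r))" for r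
  proof (rule J_cong)
    fix i assume "i < Suc n" then show "(w(n := r)) i = (w'(n := r)) i"
      using *[of i] by (cases "i = n") auto
  qed
  then show ?thesis by (simp add: D_def)
qed

text \<open>Multiplication by \<open>phi\<close> pushes the fibre radially onto its part over the \<open>(1 - \<delta>)\<close>-shrunken lower
  projection, where the interval of admissible last coordinates is nondegenerate and varies continuously.
  Since \<open>j0 \<le> j1\<close>, the factor lies in \<open>{1 - \<delta>..1}\<close> (or is the junk value \<open>0 / 0 = 0\<close> at the centre).\<close>

definition mx where "mx p = max (j1 p) (j0 p / (1 - \<delta>))"
definition phi where "phi p = j1 p / mx p"

lemma mx_nonneg: "fst p \<in> Y \<Longrightarrow> 0 \<le> mx p"
  using j_nonneg by (auto simp: mx_def le_max_iff_disj)

lemma phi_bounds: "fst p \<in> Y \<Longrightarrow> 0 \<le> phi p" "fst p \<in> Y \<Longrightarrow> phi p \<le> 1"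
  using j_nonneg mx_nonneg[of p] by (auto simp: phi_def mx_def divide_le_eq)

lemma j_scale:
  assumes "y \<in> Y" "r \<ge> 0"
  shows "j0 (y, \<lambda>i. r * w i) = r * j0 (y, w)" "j1 (y, \<lambda>i. r * w i) = r * j1 (y, w)"
  unfolding j0_def j1_def using J_scale[OF assms(1) _ assms(2)] by simp_all

lemma j_cong:
  assumes "\<And>i. i < Suc n \<Longrightarrow> w i = w' i"
  shows "j0 (y, w) = j0 (y, w')" "j1 (y, w) = j1 (y, w')"
  unfolding j0_def j1_def using J_cong[of n w w' y] J_cong[of "Suc n" w w' y] assms by simp_all

lemma phi_cong: "(\<And>i. i < Suc n \<Longrightarrow> w i = w' i) \<Longrightarrow> phi (y, w) = phi (y, w')"
  unfolding phi_def mx_def using j_cong[of w w' y] by simp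

lemma mx_scale:
  assumes "y \<in> Y" "r \<ge> 0"
  shows "mx (y, \<lambda>i. r * w i) = r * mx (y, w)"
  unfolding mx_def j_scale[OF assms] using assms(2) by (simp add: max_mult_distrib_left)

lemma phi_scale: "y \<in> Y \<Longrightarrow> r > 0 \<Longrightarrow> phi (y, \<lambda>i. r * w i) = phi (y, w)"
  unfolding phi_def by (simp add: mx_scale j_scale)

lemma j1_zero:
  assumes "y \<in> Y" "j1 (y, w) = 0" "i < Suc n" shows "w i = 0"
  using coord_le_J[OF assms(1) order_refl assms(3), of w] assms(2) by (simp add: j1_def)

lemma phi_zero:
  assumes "y \<in> Y" "phi (y, w) = 0" shows "j1 (y, w) = 0"
proof (rule ccontr)
  assume "j1 (y, w) \<noteq> 0"
  then have "j1 (y, w) > 0" using j_nonneg(2)[of "(y, w)"] assms by simp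
  moreover have "j1 (y, w) \<le> mx (y, w)" by (simp add: mx_def)
  ultimately show False using assms(2) by (simp add: phi_def)
qed

text \<open>As \<open>mx\<close> dominates \<open>j0 / (1 - \<delta>)\<close>, the scaled lower
  gauge \<open>j1 * j0 / mx\<close> is at most \<open>(1 - \<delta>) * j1\<close>.\<close>

lemma j_radial:
  assumes "y \<in> Y" "j1 (y, w) \<le> 1"
  shows "j0 (y, \<lambda>i. phi (y, w) * w i) \<le> 1 - \<delta>" "j1 (y, \<lambda>i. phi (y, w) * w i) \<le> 1"
proof -
  have nn: "0 \<le> phi (y, w)" "phi (y, w) \<le> 1" using phi_bounds[of "(y, w)"] assms by simp_all
  have "j0 (y, w) \<le> (1 - \<delta>) * mx (y, w)"
  proof -
    have "j0 (y, w) / (1 - \<delta>) \<le> mx (y, w)" by (simp add: mx_def)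
    then show ?thesis using \<delta> by (simp add: divide_le_eq mult.commute)
  qed
  then have "phi (y, w) * j0 (y, w) \<le> phi (y, w) * ((1 - \<delta>) * mx (y, w))" using nn by (intro mult_left_mono)
  also have "\<dots> \<le> (1 - \<delta>) * j1 (y, w)"
    using \<delta> j_nonneg(2)[of "(y, w)"] assms(1) by (cases "mx (y, w) = 0") (auto simp: phi_def)
  also have "\<dots> \<le> (1 - \<delta>) * 1" using assms(2) \<delta> by (intro mult_left_mono) auto
  finally show "j0 (y, \<lambda>i. phi (y, w) * w i) \<le> 1 - \<delta>" using j_scale(1)[OF assms(1) nn(1)] by simp
  have "phi (y, w) * j1 (y, w) \<le> 1 * 1"
    using nn assms j_nonneg(2)[of "(y, w)"] by (intro mult_mono) auto
  then show "j1 (y, \<lambda>i. phi (y, w) * w i) \<le> 1" using j_scale(2)[OF assms(1) nn(1)] by simp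
qed

text \<open>\<open>phi\<close> is constant along rays from the centre, so the preimage of
  \<open>z\<close> is \<open>z\<close> scaled by \<open>\<mu> = mx / j1\<close>, the reciprocal of
  \<open>phi\<close>. Its upper gauge is then \<open>mx\<close>, which both bounds on
  \<open>z\<close> keep at most 1.\<close>

lemma radial_surj:
  assumes y: "y \<in> Y" and z: "j1 (y, z) \<le> 1" "j0 (y, z) \<le> 1 - \<delta>"
  shows "\<exists>\<mu>\<ge>0. j1 (y, \<lambda>i. \<mu> * z i) \<le> 1 \<and> (\<forall>i<Suc n. phi (y, \<lambda>i. \<mu> * z i) * (\<mu> * z i) = z i)"
proof (cases "j1 (y, z) = 0")
  case True
  then have "\<forall>i<Suc n. z i = 0" using j1_zero[OF y] by blast
  then show ?thesis using j_scale(2)[OF y, of 0 z] by (intro exI[of _ 0]) simp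
next
  case False
  then have pos: "j1 (y, z) > 0" using j_nonneg(2)[of "(y, z)"] y by simp
  then have mpos: "mx (y, z) > 0" by (simp add: mx_def less_max_iff_disj)
  define \<mu> where "\<mu> = mx (y, z) / j1 (y, z)"
  have \<mu>: "\<mu> > 0" using pos mpos by (simp add: \<mu>_def)
  have "j1 (y, \<lambda>i. \<mu> * z i) = mx (y, z)" using pos \<mu> j_scale(2)[OF y, of \<mu> z] by (simp add: \<mu>_def)
  also have "\<dots> \<le> 1" using z \<delta> by (simp add: mx_def divide_le_eq)
  finally have 1: "j1 (y, \<lambda>i. \<mu> * z i) \<le> 1" .
  have "phi (y, \<lambda>i. \<mu> * z i) * \<mu> = 1"
    using phi_scale[OF y \<mu>, of z] pos mpos by (simp add: phi_def \<mu>_def)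
  then have "phi (y, \<lambda>i. \<mu> * z i) * (\<mu> * z i) = z i" for i by (metis mult.assoc mult_1)
  with 1 \<mu> show ?thesis by (intro exI[of _ \<mu>]) auto
qed

text \<open>The map preserves rays and \<open>phi\<close> is constant on each, so equal images off
  the centre have equal factors, which cancel. The factor vanishes only at the centre.\<close>

lemma radial_inj:
  assumes y: "y \<in> Y" and eq: "\<And>i. i < Suc n \<Longrightarrow> phi (y, w) * w i = phi (y, w') * w' i" and i: "i < Suc n"
  shows "w i = w' i"
proof -
  have *: "phi (y, \<lambda>i. phi (y, w) * w i) = phi (y, w)" if "phi (y, w) \<noteq> 0" for w
    using phi_bounds(1)[of "(y, w)"] that y by (intro phi_scale) auto
  have zero: "w i = 0" if "phi (y, w) = 0" for w
    using j1_zero[OF y phi_zero[OF y that] i] .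
  have zz: "phi (y, w) = 0" if z: "\<And>i. i < Suc n \<Longrightarrow> phi (y, w) * w i = 0" for w
  proof (rule ccontr)
    assume nz: "phi (y, w) \<noteq> 0"
    then have "w i = 0" if "i < Suc n" for i using z[OF that] by simp
    then have "j1 (y, w) = 0" unfolding j1_def using J_zero[OF y order_refl] by simp
    then show False using nz by (simp add: phi_def)
  qed
  show ?thesis
  proof (cases "phi (y, w) = 0 \<or> phi (y, w') = 0")
    case True
    then have "phi (y, w) = 0" "phi (y, w') = 0" using zz[of w] zz[of w'] eq by auto
    then show ?thesis using zero[of w] zero[of w'] by simp
  next
    case False
    have "phi (y, w) = phi (y, w')"
      using *[of w] *[of w'] False phi_cong[of "\<lambda>i. phi (y, w) * w i" "\<lambda>i. phi (y, w') * w' i" y] eq by simp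
    then show ?thesis using eq[OF i] False by simp
  qed
qed

lemma cont_radial:
  assumes "i < Suc n"
  shows "continuous_on (Y \<times> UNIV) (\<lambda>p. phi p * snd p i)"
  unfolding continuous_on_def
proof
  fix p :: "'y \<times> (nat \<Rightarrow> real)" assume p: "p \<in> Y \<times> UNIV"
  then have y: "fst p \<in> Y" by (simp add: mem_Times_iff)
  let ?F = "at p within Y \<times> UNIV"
  have l0: "(j0 \<longlongrightarrow> j0 p) ?F" and l1: "(j1 \<longlongrightarrow> j1 p) ?F"
    using cont_j p unfolding continuous_on_def by blast+
  have li: "((\<lambda>p. snd p i) \<longlongrightarrow> snd p i) ?F"
    using continuous_on_coord[OF continuous_on_snd[OF continuous_on_id], of "Y \<times> UNIV" i] p
    unfolding continuous_on_def by blast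
  show "((\<lambda>p. phi p * snd p i) \<longlongrightarrow> phi p * snd p i) ?F"
  proof (cases "j1 p = 0")
    case False
    then have "j1 p > 0" using j_nonneg(2)[OF y] by simp
    then have "mx p > 0" unfolding mx_def by (rule less_le_trans) simp
    then have "mx p \<noteq> 0" by simp
    moreover have "(mx \<longlongrightarrow> mx p) ?F"
      unfolding mx_def[abs_def] using \<delta> by (intro tendsto_max tendsto_divide tendsto_const l0 l1) auto
    ultimately show ?thesis
      unfolding phi_def[abs_def] by (intro tendsto_mult tendsto_divide li l1)
  next
    case True
    then have zero: "snd p i = 0" using j1_zero[OF y, of "snd p" i] assms by simp
    \<comment> \<open>At the centre \<open>phi\<close> itself need not be continuous, but it is
      bounded by 1 while the coordinate tends to 0.\<close>
    have "((\<lambda>p. phi p * snd p i) \<longlongrightarrow> 0) ?F"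
    proof (rule Lim_null_comparison)
      show "\<forall>\<^sub>F p in ?F. norm (phi p * snd p i) \<le> \<bar>snd p i\<bar>"
        unfolding eventually_at_filter
      proof (intro always_eventually allI impI)
        fix q :: "'y \<times> (nat \<Rightarrow> real)" assume "q \<in> Y \<times> UNIV"
        then have "fst q \<in> Y" by (simp add: mem_Times_iff)
        then have "\<bar>phi q\<bar> \<le> 1" using phi_bounds[of q] by simp
        then show "norm (phi q * snd q i) \<le> \<bar>snd q i\<bar>" by (simp add: abs_mult mult_left_le_one_le)
      qed
      show "((\<lambda>p. \<bar>snd p i\<bar>) \<longlongrightarrow> 0) ?F" using tendsto_rabs[OF li] zero by simp
    qed
    then show ?thesis using zero by simp
  qed
qed

definition rad where "rad p = (fst p, trunc (Suc n) (\<lambda>i. phi p * snd p i))"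
definition sh where "sh q = (fst q, \<lambda>i. snd q i - c (fst q) i)"
text \<open>Division by \<open>1 - \<delta>\<close> expands the shrunken lower projection to the
  full one; the second component carries \<open>{lo p..hi p}\<close> affinely onto
  \<open>{-1..1}\<close>.\<close>

definition cut where
  "cut p = ((fst p, trunc n (\<lambda>i. c (fst p) i + snd p i / (1 - \<delta>))), 2 * (snd p n - lo p) / (hi p - lo p) - 1)"

lemma cont_rad: "continuous_on (Y \<times> UNIV) rad"
  unfolding rad_def[abs_def]
proof (rule continuous_on_Pair[OF continuous_on_fst[OF continuous_on_id]])
  show "continuous_on (Y \<times> UNIV) (\<lambda>p. trunc (Suc n) (\<lambda>i. phi p * snd p i))"
    unfolding trunc_def
  proof (rule continuous_on_coordinatewise_then_product)
    fix i show "continuous_on (Y \<times> UNIV) (\<lambda>p. if i < Suc n then phi p * snd p i else 0)"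
      using cont_radial[of i] by (cases "i < Suc n") simp_all
  qed
qed

lemma cont_c: "S \<subseteq> Y \<times> UNIV \<Longrightarrow> continuous_on S (\<lambda>q. c (fst q) i)"
  by (rule continuous_on_coord, rule continuous_on_compose2[OF c_cont continuous_on_fst[OF continuous_on_id]]) auto

lemma cont_snd_coord: "continuous_on S (\<lambda>q :: 'y \<times> (nat \<Rightarrow> real). snd q i)"
  by (rule continuous_on_coord[OF continuous_on_snd[OF continuous_on_id]])

lemma cont_sh: "continuous_on (Y \<times> UNIV) sh"
  unfolding sh_def[abs_def]
  by (intro continuous_on_Pair continuous_on_fst continuous_on_id continuous_on_coordinatewise_then_product
      continuous_on_diff cont_c cont_snd_coord order_refl)

lemma cont_cut: "continuous_on R cut"
proof -
  have sub: "R \<subseteq> Y \<times> UNIV" by (auto simp: R_def)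
  have "hi p - lo p \<noteq> 0" if "p \<in> R" for p using lo_less_hi[OF that] by simp
  then have 1: "continuous_on R (\<lambda>p. 2 * (snd p n - lo p) / (hi p - lo p) - 1)"
    by (intro continuous_on_diff continuous_on_divide continuous_on_mult continuous_on_const cont_snd_coord cont_lo cont_hi) auto
  have 2: "continuous_on R (\<lambda>p. trunc n (\<lambda>i. c (fst p) i + snd p i / (1 - \<delta>)))"
    using \<delta> by (intro continuous_on_trunc continuous_on_coordinatewise_then_product continuous_on_add continuous_on_divide
      continuous_on_const cont_snd_coord cont_c sub) auto
  show ?thesis unfolding cut_def[abs_def]
    by (intro continuous_on_Pair continuous_on_fst continuous_on_id 1 2)
qed

definition step_map where "step_map q = cut (rad (sh q))"

lemma step_domain:
  assumes "q \<in> tr (Suc n) ` \<Gamma>"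
  shows "fst q \<in> Y" "j1 (sh q) \<le> 1" "rad (sh q) \<in> R" "j1 (rad (sh q)) \<le> 1"
proof -
  have cyl: "cyl \<Gamma> (Suc n) (fst q) (snd q)" using assms in_tr_iff by blast
  then show y: "fst q \<in> Y" by (rule cyl_base)
  show j: "j1 (sh q) \<le> 1"
    using J_le_iff[OF y order_refl zero_less_one, of "\<lambda>i. snd q i - c (fst q) i"] cyl
    by (simp add: j1_def sh_def)
  define w where "w = (\<lambda>i. snd q i - c (fst q) i)"
  have sh: "sh q = (fst q, w)" by (simp add: sh_def w_def)
  have rad: "rad (sh q) = (fst q, trunc (Suc n) (\<lambda>i. phi (fst q, w) * w i))" by (simp add: rad_def sh)
  have cong: "j0 (rad (sh q)) = j0 (fst q, \<lambda>i. phi (fst q, w) * w i)"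
    "j1 (rad (sh q)) = j1 (fst q, \<lambda>i. phi (fst q, w) * w i)"
    unfolding rad by (rule j_cong; simp add: trunc_def)+
  note r = j_radial[OF y j[unfolded sh]]
  show "rad (sh q) \<in> R" using r(1) cong y by (simp add: R_def) (simp add: rad_def sh)
  show "j1 (rad (sh q)) \<le> 1" using r(2) cong by simp
qed

lemma cut_range:
  assumes "p \<in> R" "j1 p \<le> 1"
  shows "cut p \<in> (tr n ` \<Gamma>) \<times> {-1..1}"
proof -
  have y: "fst p \<in> Y" and j: "J n (fst p) (snd p) \<le> 1 - \<delta>" using assms(1) by (auto simp: R_def j0_def)
  have "cyl \<Gamma> n (fst p) (\<lambda>i. c (fst p) i + snd p i / (1 - \<delta>))"
    using J_le_iff[OF y, of n "1 - \<delta>" "snd p"] j \<delta> by simp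
  then have "cyl \<Gamma> n (fst p) (trunc n (\<lambda>i. c (fst p) i + snd p i / (1 - \<delta>)))"
    by (rule cyl_cong[THEN iffD1, rotated]) (simp add: trunc_def)
  then have 1: "fst (cut p) \<in> tr n ` \<Gamma>"
    unfolding in_tr_iff by (simp add: cut_def trunc_trunc)
  have "snd p n \<in> D p" using assms(2) by (simp add: D_def j1_def)
  then have "lo p \<le> snd p n" "snd p n \<le> hi p" using D_le[OF assms(1)] by simp_all
  then have "snd (cut p) \<in> {-1..1}"
    using lo_less_hi[OF assms(1)] by (simp add: cut_def divide_le_eq le_divide_eq)
  with 1 show ?thesis by (simp add: mem_Times_iff)
qed

text \<open>The lower coordinates are recovered first. Since \<open>D\<close> depends on them alone,
  they determine the interval, and then the affine last component can be solved for coordinate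
  \<open>n\<close>.\<close>

lemma cut_inj:
  assumes "p \<in> R" "p' \<in> R" "cut p = cut p'" 
  shows "fst p = fst p'" "\<And>i. i < Suc n \<Longrightarrow> snd p i = snd p' i"
proof -
  show y: "fst p = fst p'" using assms(3) by (simp add: cut_def)
  have tr: "trunc n (\<lambda>i. c (fst p) i + snd p i / (1 - \<delta>)) = trunc n (\<lambda>i. c (fst p') i + snd p' i / (1 - \<delta>))"
    using arg_cong[OF assms(3), of "\<lambda>x. snd (fst x)"] by (simp only: cut_def fst_conv snd_conv)
  have low: "snd p i = snd p' i" if "i < n" for i
    using fun_cong[OF tr, of i] that y \<delta> by (simp add: trunc_def)
  have "D (fst p, snd p) = D (fst p, snd p')" by (rule D_cong) (rule low)
  then have "D p = D p'" by (metis y prod.collapse)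
  then have lh: "lo p = lo p'" "hi p = hi p'" by (simp_all add: lo_def hi_def)
  have "2 * (snd p n - lo p) / (hi p - lo p) = 2 * (snd p' n - lo p) / (hi p - lo p)"
    using assms(3) lh by (simp add: cut_def)
  then have "snd p n = snd p' n" using lo_less_hi[OF assms(1)] by simp
  with low show "snd p i = snd p' i" if "i < Suc n" for i using that by (cases "i = n") auto
qed

text \<open>The preimage inverts the constituents in reverse order: \<open>z0\<close> shrinks the
  lower part again, \<open>r\<close> interpolates between \<open>lo\<close> and \<open>hi\<close>,
  \<open>radial_surj\<close> undoes the push, and adding \<open>c y\<close> undoes the
  shift.\<close>

lemma step_map_surj:
  assumes "b \<in> (tr n ` \<Gamma>) \<times> {-1..1}"
  shows "\<exists>q\<in>tr (Suc n) ` \<Gamma>. step_map q = b"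
proof -
  obtain y x \<tau> where b: "b = ((y, x), \<tau>)" by (metis prod.collapse)
  have cx: "cyl \<Gamma> n y x" and tx: "trunc n x = x" and \<tau>: "-1 \<le> \<tau>" "\<tau> \<le> 1"
    using assms in_tr_iff[of "(y, x)" n] by (auto simp: b)
  have y: "y \<in> Y" using cyl_base[OF cx] .
  define z0 where "z0 = (\<lambda>i. (1 - \<delta>) * (x i - c y i))"
  have "J n y (\<lambda>i. x i - c y i) \<le> 1"
    using J_le_iff[OF y, of n 1 "\<lambda>i. x i - c y i"] cx by simp
  then have jz0: "J n y z0 \<le> 1 - \<delta>"
    unfolding z0_def using J_scale[OF y, of n "1 - \<delta>" "\<lambda>i. x i - c y i"] \<delta> by (simp add: mult_left_le)
  then have z0R: "(y, z0) \<in> R" using y by (simp add: R_def j0_def)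
  define r where "r = lo (y, z0) + (hi (y, z0) - lo (y, z0)) * (\<tau> + 1) / 2"
  define t where "t = (\<tau> + 1) / 2"
  have "r = (1 - t) * lo (y, z0) + t * hi (y, z0)" by (simp add: r_def t_def field_simps)
  then have rD: "r \<in> D (y, z0)"
    using D_convex[OF _ lo_mem[OF z0R] hi_mem[OF z0R], of t] y \<tau> by (simp add: t_def)
  define z where "z = z0(n := r)"
  have jz: "j1 (y, z) \<le> 1" using rD by (simp add: D_def z_def j1_def)
  have j0z: "j0 (y, z) \<le> 1 - \<delta>"
    unfolding j0_def using jz0 J_cong[of n z z0 y] by (simp add: z_def)
  obtain \<mu> where \<mu>: "\<mu> \<ge> 0" "j1 (y, \<lambda>i. \<mu> * z i) \<le> 1" "\<And>i. i < Suc n \<Longrightarrow> phi (y, \<lambda>i. \<mu> * z i) * (\<mu> * z i) = z i"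
    using radial_surj[OF y jz j0z] by blast
  define q where "q = (y, trunc (Suc n) (\<lambda>i. c y i + \<mu> * z i))"
  have "cyl \<Gamma> (Suc n) y (\<lambda>i. c y i + \<mu> * z i)"
    using J_le_iff[OF y order_refl zero_less_one, of "\<lambda>i. \<mu> * z i"] \<mu>(2) by (simp add: j1_def)
  then have "cyl \<Gamma> (Suc n) y (trunc (Suc n) (\<lambda>i. c y i + \<mu> * z i))"
    by (rule cyl_cong[THEN iffD1, rotated]) (simp add: trunc_def)
  then have q: "q \<in> tr (Suc n) ` \<Gamma>" unfolding in_tr_iff by (simp add: q_def trunc_trunc)
  define w where "w = (\<lambda>i. trunc (Suc n) (\<lambda>i. c y i + \<mu> * z i) i - c y i)"
  have w: "w i = \<mu> * z i" if "i < Suc n" for i using that by (simp add: w_def trunc_def)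
  have sh: "sh q = (y, w)" by (simp add: sh_def q_def w_def)
  define u where "u = trunc (Suc n) (\<lambda>i. phi (y, w) * w i)"
  have rad: "rad (sh q) = (y, u)" by (simp add: rad_def sh u_def)
  have u: "u i = z i" if "i < Suc n" for i
    using that \<mu>(3)[OF that] w[OF that] phi_cong[of w "\<lambda>i. \<mu> * z i" y] w by (simp add: u_def trunc_def)
  have "D (y, u) = D (y, z0)" using u by (intro D_cong) (simp add: z_def)
  then have lh: "lo (y, u) = lo (y, z0)" "hi (y, u) = hi (y, z0)" by (simp_all add: lo_def hi_def)
  have "trunc n (\<lambda>i. c y i + u i / (1 - \<delta>)) = trunc n x"
    unfolding trunc_def using u \<delta> by (auto simp: z_def z0_def)
  moreover have "2 * (u n - lo (y, u)) / (hi (y, u) - lo (y, u)) - 1 = \<tau>"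
    using u[of n] lh lo_less_hi[OF z0R] by (simp add: z_def r_def)
  ultimately have "step_map q = b" by (simp add: step_map_def rad cut_def b tx)
  with q show ?thesis by blast
qed

lemma step_map_iso: "iso_onto (tr (Suc n) ` \<Gamma>) ((tr n ` \<Gamma>) \<times> {-1..1}) step_map"
  unfolding iso_onto_def
proof (intro conjI)
  let ?A = "tr (Suc n) ` \<Gamma>"
  have sub: "?A \<subseteq> Y \<times> UNIV"
  proof
    fix q assume "q \<in> ?A" then show "q \<in> Y \<times> UNIV" using step_domain(1)[of q] by (simp add: mem_Times_iff)
  qed
  have 1: "continuous_on ?A (\<lambda>q. rad (sh q))"
  proof (rule continuous_on_compose2[OF cont_rad continuous_on_subset[OF cont_sh sub]])
    show "sh ` ?A \<subseteq> Y \<times> UNIV"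
    proof (rule image_subsetI)
      fix q assume "q \<in> ?A" then show "sh q \<in> Y \<times> UNIV" using step_domain(1)[of q] by (simp add: sh_def)
    qed
  qed
  show "continuous_on ?A step_map"
    unfolding step_map_def[abs_def]
    by (rule continuous_on_compose2[OF cont_cut 1]) (use step_domain(3) in blast)
  show "inj_on step_map ?A"
  proof (rule inj_onI)
    fix q q' assume q: "q \<in> ?A" "q' \<in> ?A" "step_map q = step_map q'"
    note c = cut_inj[OF step_domain(3)[OF q(1)] step_domain(3)[OF q(2)] q(3)[unfolded step_map_def]]
    have y: "fst q = fst q'" using c(1) by (simp add: rad_def sh_def)
    have "snd (sh q) i = snd (sh q') i" if "i < Suc n" for i
    proof (rule radial_inj[OF step_domain(1)[OF q(1)] _ that])
      fix i assume i: "i < Suc n"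
      have *: "snd (rad p) i = phi p * snd p i" for p :: "'y \<times> (nat \<Rightarrow> real)"
        using i by (simp add: rad_def trunc_def)
      have "phi (sh q) * snd (sh q) i = phi (sh q') * snd (sh q') i" using c(2)[OF i] unfolding * .
      moreover have "sh q = (fst q, snd (sh q))" "sh q' = (fst q, snd (sh q'))"
        using y by (simp_all add: sh_def)
      ultimately show "phi (fst q, snd (sh q)) * snd (sh q) i = phi (fst q, snd (sh q')) * snd (sh q') i"
        by simp
    qed
    then have "snd q i = snd q' i" if "i < Suc n" for i using that y by (simp add: sh_def)
    then have "trunc (Suc n) (snd q) = trunc (Suc n) (snd q')" by (auto simp: trunc_def)
    then have "snd q = snd q'" using q(1,2) in_tr_iff by metis
    with y show "q = q'" by (simp add: prod_eq_iff)
  qed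
  show "step_map ` ?A = (tr n ` \<Gamma>) \<times> {-1..1}"
  proof
    show "step_map ` ?A \<subseteq> (tr n ` \<Gamma>) \<times> {-1..1}"
    proof (rule image_subsetI)
      fix q assume "q \<in> ?A"
      then show "step_map q \<in> (tr n ` \<Gamma>) \<times> {-1..1}"
        unfolding step_map_def by (intro cut_range step_domain)
    qed
    show "(tr n ` \<Gamma>) \<times> {-1..1} \<subseteq> step_map ` ?A"
    proof
      fix b assume "b \<in> (tr n ` \<Gamma>) \<times> {-1..1::real}"
      from step_map_surj[OF this] show "b \<in> step_map ` ?A" by (elim bexE) (rule image_eqI[OF sym])
    qed
  qed
qed

text \<open>Off the centre \<open>j0 \<le> j1\<close> gives
  \<open>1 - \<delta> \<le> phi \<le> 1\<close>, so the net factor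
  \<open>phi / (1 - \<delta>)\<close> exceeds 1 by at most \<open>2 * \<delta>\<close>, using
  \<open>\<delta> \<le> 1/2\<close>. Displacements are at most \<open>2 * M\<close> per coordinate,
  and \<open>dist_fun_le\<close> contributes a further factor 2.\<close>

lemma step_map_near:
  assumes "p \<in> \<Gamma>"
  shows "dist (fst (step_map (tr (Suc n) p))) (tr n p) \<le> 8 * M * \<delta>"
proof -
  define q where "q = tr (Suc n) p"
  have q: "q \<in> tr (Suc n) ` \<Gamma>" using assms by (simp add: q_def)
  define y where "y = fst p"
  have y: "y \<in> Y" using step_domain(1)[OF q] by (simp add: q_def tr_def y_def)
  define w where "w = snd (sh q)"
  have sh: "sh q = (y, w)" by (simp add: w_def sh_def q_def tr_def y_def)
  have w: "w i = snd p i - c y i" if "i < Suc n" for i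
    using that by (simp add: w_def sh_def q_def tr_def trunc_def y_def)
  have j: "j1 (y, w) \<le> 1" using step_domain(2)[OF q] sh by simp
  have M0: "0 \<le> M"
  proof -
    have "(fst p, snd p) \<in> \<Gamma>" using assms by simp
    from bound[OF this, of 0] show ?thesis by linarith
  qed
  have wb: "\<bar>w i\<bar> \<le> 2 * M" if "i < Suc n" for i
  proof -
    have "\<bar>w i\<bar> \<le> 2 * M * j1 (y, w)" using coord_le_J[OF y order_refl that, of w] by (simp add: j1_def)
    also have "\<dots> \<le> 2 * M * 1" using j M0 by (intro mult_left_mono) auto
    finally show ?thesis by simp
  qed
  have eq: "fst (step_map q) = (y, trunc n (\<lambda>i. c y i + phi (y, w) * w i / (1 - \<delta>)))"
    by (auto simp: step_map_def cut_def rad_def sh trunc_def)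
  have "dist (trunc n (\<lambda>i. c y i + phi (y, w) * w i / (1 - \<delta>))) (trunc n (snd p)) \<le> 2 * (4 * M * \<delta>)"
  proof (rule dist_fun_le)
    fix i
    show "dist (trunc n (\<lambda>i. c y i + phi (y, w) * w i / (1 - \<delta>)) i) (trunc n (snd p) i) \<le> 4 * M * \<delta>"
    proof (cases "i < n")
      case False
      then show ?thesis using M0 \<delta> by (simp add: trunc_def)
    next
      case True
      have "\<bar>phi (y, w) * w i / (1 - \<delta>) - w i\<bar> \<le> 4 * M * \<delta>"
      proof (cases "j1 (y, w) = 0")
        case z: True
        then have "w i = 0" using j1_zero[OF y] True by simp
        then show ?thesis using M0 \<delta> by simp
      next
        case False
        then have pos: "j1 (y, w) > 0" using j_nonneg(2)[of "(y, w)"] y by simp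
        have "j1 (y, w) \<le> j1 (y, w) / (1 - \<delta>)" "j0 (y, w) / (1 - \<delta>) \<le> j1 (y, w) / (1 - \<delta>)"
          using pos \<delta> j0_le_j1[of "(y, w)"] y by (simp_all add: divide_right_mono le_divide_eq mult_left_le)
        then have "mx (y, w) \<le> j1 (y, w) / (1 - \<delta>)" by (simp add: mx_def)
        moreover have mpos: "mx (y, w) > 0" using pos unfolding mx_def by (rule less_le_trans) simp
        ultimately have lo: "1 - \<delta> \<le> phi (y, w)" using \<delta> by (simp add: phi_def field_simps)
        have hi: "phi (y, w) \<le> 1" using phi_bounds(2)[of "(y, w)"] y by simp
        have "phi (y, w) * w i / (1 - \<delta>) - w i = w i * ((phi (y, w) - (1 - \<delta>)) / (1 - \<delta>))"
          using \<delta> by (simp add: field_simps)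
        then have "\<bar>phi (y, w) * w i / (1 - \<delta>) - w i\<bar> = \<bar>w i\<bar> * ((phi (y, w) - (1 - \<delta>)) / (1 - \<delta>))"
          using lo \<delta> by (simp add: abs_mult)
        also have "\<dots> \<le> (2 * M) * (2 * \<delta>)"
        proof (rule mult_mono)
          show "(phi (y, w) - (1 - \<delta>)) / (1 - \<delta>) \<le> 2 * \<delta>"
          proof -
            have "\<delta> * \<delta> \<le> \<delta> * (1/2)" using \<delta> by (intro mult_left_mono) auto
            then have "\<delta> \<le> 2 * \<delta> * (1 - \<delta>)" by (simp add: algebra_simps)
            then have "phi (y, w) - (1 - \<delta>) \<le> 2 * \<delta> * (1 - \<delta>)" using hi by linarith
            then show ?thesis using \<delta> by (simp add: divide_le_eq)
          qed
        qed (use wb True lo \<delta> M0 in auto)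
        finally show ?thesis by simp
      qed
      then show ?thesis using True w[of i] by (simp add: trunc_def dist_real_def)
    qed
  qed
  moreover have "tr n p = (y, trunc n (snd p))" by (simp add: tr_def y_def)
  ultimately show ?thesis unfolding q_def[symmetric] eq by (simp add: dist_Pair_Pair mult.assoc)
qed

end


section \<open>Triviality of bundles with convex fibres\<close>

lemma iso_onto_product:
  assumes "iso_onto X Y f"
  shows "iso_onto (X \<times> Z) (Y \<times> Z) (map_prod f id)"
proof -
  have "continuous_on (X \<times> Z) (\<lambda>p. f (fst p))"
    by (rule continuous_on_compose2[of X f]) (use assms in \<open>auto simp: iso_onto_def intro!: continuous_intros\<close>)
  then have "continuous_on (X \<times> Z) (\<lambda>p. (f (fst p), snd p))" by (intro continuous_intros)
  then have "continuous_on (X \<times> Z) (map_prod f id)" by (simp add: map_prod_def case_prod_beta)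
  moreover have "inj_on (map_prod f id) (X \<times> Z)"
    using assms by (intro map_prod_inj_on) (simp_all add: iso_onto_def)
  moreover have "map_prod f id ` (X \<times> Z) = Y \<times> Z"
    using assms by (simp add: iso_onto_def map_prod_surj_on)
  ultimately show ?thesis by (simp add: iso_onto_def)
qed

text \<open>\<open>centre\<close> asks that every finite projection of the fibres contain a box of
  uniform size about a continuously moving point. With \<open>k = 0\<close> it also says that no
  fibre is empty.\<close>

locale parametric_keller = convex_fibres Y \<Gamma> M
  for Y :: "'y::complete_space set" and \<Gamma> M +
  assumes centre: "\<And>k. \<exists>c s. continuous_on Y c \<and> s > 0 \<and>
     (\<forall>y w. y \<in> Y \<and> (\<forall>i<k. \<bar>w i - c y i\<bar> \<le> s) \<longrightarrow> cyl \<Gamma> k y w)"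
begin

lemma ex_step:
  assumes "e > 0"
  shows "\<exists>g. iso_onto (tr (Suc n) ` \<Gamma>) ((tr n ` \<Gamma>) \<times> {-1..1::real}) g \<and>
     (\<forall>p\<in>\<Gamma>. dist (fst (g (tr (Suc n) p))) (tr n p) \<le> e)"
proof -
  obtain c s where cs: "continuous_on Y c" "s > 0"
    "\<And>y w. y \<in> Y \<Longrightarrow> (\<And>i. i < Suc n \<Longrightarrow> \<bar>w i - c y i\<bar> \<le> s) \<Longrightarrow> cyl \<Gamma> (Suc n) y w"
    using centre[of "Suc n"] by blast
  \<comment> \<open>Makes the displacement \<open>8 * M * \<delta>\<close> of
    \<open>step_map_near\<close> at most \<open>e\<close>; \<open>\<bar>M\<bar> + 1\<close> keeps
    the denominator positive.\<close>
  define \<delta> where "\<delta> = min (1/2) (e / (8 * (\<bar>M\<bar> + 1)))"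
  have pos: "0 < 8 * (\<bar>M\<bar> + 1)" by simp
  have \<delta>: "0 < \<delta>" "\<delta> \<le> 1/2"
    unfolding \<delta>_def using divide_pos_pos[OF assms pos] by (simp_all only: min_less_iff_conj min.cobounded1) simp
  have "\<delta> \<le> e / (8 * (\<bar>M\<bar> + 1))" by (simp add: \<delta>_def)
  then have "\<delta> * (8 * (\<bar>M\<bar> + 1)) \<le> e" using pos by (simp add: le_divide_eq)
  moreover have "8 * M * \<delta> \<le> \<delta> * (8 * (\<bar>M\<bar> + 1))"
    using \<delta> mult_left_mono[of M "\<bar>M\<bar> + 1" "8 * \<delta>"] by (simp add: algebra_simps)
  ultimately have le: "8 * M * \<delta> \<le> e" by linarith
  interpret keller_step Y \<Gamma> M n c s \<delta>
    by unfold_locales (use cs \<delta> in auto)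
  show ?thesis using step_map_iso step_map_near le by (meson order_trans)
qed

text \<open>Both sides are limits of their truncations \<open>tr j\<close>. At stage 0 each is a
  copy of \<open>Y\<close>, so the ladder starts with the identity, and control of stage 0 in the
  limit is control of base points.\<close>

theorem trivial_bundle:
  assumes "\<epsilon> > 0"
  shows "\<exists>f. iso_onto \<Gamma> (Y \<times> cube) f \<and> (\<forall>p\<in>\<Gamma>. dist (fst (f p)) (fst p) \<le> \<epsilon>)"
proof -
  let ?T = "Y \<times> cube"
  have zero: "tr 0 p = (fst p, \<lambda>i. 0)" for p :: "'y \<times> (nat \<Rightarrow> real)" by (simp add: tr_def trunc_def)
  have ex: "\<exists>v. (y, v) \<in> \<Gamma>" if "y \<in> Y" for y
  proof -
    obtain c s where "\<forall>y w. y \<in> Y \<and> (\<forall>i<0. \<bar>w i - c y i\<bar> \<le> (s::real)) \<longrightarrow> cyl \<Gamma> 0 y w" using centre[of 0] by blast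
    then have "cyl \<Gamma> 0 y (\<lambda>i. 0)" using that by blast
    then show ?thesis unfolding cyl_def by blast
  qed
  have "tr 0 ` \<Gamma> = Y \<times> {\<lambda>i. 0}"
    using ex base by (auto simp: zero image_iff Bex_def)
  moreover have "tr 0 ` ?T = Y \<times> {\<lambda>i. 0}"
  proof -
    have "(\<lambda>i. 0) \<in> cube" by (simp add: cube_def)
    then show ?thesis by (force simp: zero image_iff)
  qed
  ultimately have h0: "iso_onto (tr 0 ` \<Gamma>) (tr 0 ` ?T) id"
    by (simp add: iso_onto_def)
  have "\<exists>f. iso_onto \<Gamma> ?T f \<and> (\<forall>p\<in>\<Gamma>. dist (tr 0 (f p)) (id (tr 0 p)) \<le> \<epsilon>)"
  proof (rule approximate_inverse_limit[OF compact_total compact_Times[OF compact_base compact_cube] continuous_on_tr])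
    fix j and p p' :: "'y \<times> (nat \<Rightarrow> real)" assume "tr (Suc j) p = tr (Suc j) p'"
    then have "tr j (tr (Suc j) p) = tr j (tr (Suc j) p')" by simp
    then show "tr j p = tr j p'" by (simp add: tr_tr)
  next
    fix p p' :: "'y \<times> (nat \<Rightarrow> real)" assume eq: "\<And>j. tr j p = tr j p'"
    have "snd p i = snd p' i" for i
      using arg_cong[OF eq[of "Suc i"], of "\<lambda>x. snd x i"] by (simp add: tr_def trunc_def)
    moreover have "fst p = fst p'" using eq[of 0] by (simp add: tr_def)
    ultimately show "p = p'" by (simp add: prod_eq_iff fun_eq_iff)
  next
    fix j show "tr j ` ?T \<subseteq> ?T" by (auto simp: tr_def trunc_def cube_def)
  next
    fix j and a b :: "'y \<times> (nat \<Rightarrow> real)" show "dist (tr j a) (tr j b) \<le> dist a b" by (rule dist_tr_le)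
  next
    fix i j :: nat and a :: "'y \<times> (nat \<Rightarrow> real)" assume "i \<le> j"
    then show "tr i (tr j a) = tr i a" by (simp add: tr_tr min_absorb1)
  next
    fix e :: real assume "e > 0"
    then obtain k where k: "\<And>v w :: nat \<Rightarrow> real. (\<And>i. i < k \<Longrightarrow> v i = w i) \<Longrightarrow> dist v w < e"
      using dist_fun_eventually_agree[of e] by blast
    have "dist (tr j a) a < e" if "j \<ge> k" for j and a :: "'y \<times> (nat \<Rightarrow> real)"
      using k[of "trunc j (snd a)" "snd a"] that by (simp add: tr_def dist_prod_def trunc_def)
    then show "\<exists>J. \<forall>j\<ge>J. \<forall>a\<in>?T. dist (tr j a) a < e" by blast
  next
    fix j h and \<eta> :: real assume h: "iso_onto (tr j ` \<Gamma>) (tr j ` ?T) h" and \<eta>: "\<eta> > 0"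
    have "uniformly_continuous_on (tr j ` \<Gamma>) h"
      using h by (intro compact_uniformly_continuous compact_tr) (simp add: iso_onto_def)
    then obtain d where d: "d > 0" "\<And>x x'. x \<in> tr j ` \<Gamma> \<Longrightarrow> x' \<in> tr j ` \<Gamma> \<Longrightarrow> dist x' x < d \<Longrightarrow> dist (h x') (h x) < \<eta>"
      using \<eta> unfolding uniformly_continuous_on_def by metis
    obtain g where g: "iso_onto (tr (Suc j) ` \<Gamma>) ((tr j ` \<Gamma>) \<times> {-1..1::real}) g"
      "\<And>p. p \<in> \<Gamma> \<Longrightarrow> dist (fst (g (tr (Suc j) p))) (tr j p) \<le> d / 2"
      using ex_step[of "d / 2" j] d(1) by auto
    \<comment> \<open>Straighten the new coordinate, apply \<open>h\<close> to the rest, and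
      reinsert the coordinate. The motion \<open>d / 2\<close> caused by straightening is turned
      into \<open>\<eta>\<close> by uniform continuity of \<open>h\<close>.\<close>
    define h' where "h' = ins j \<circ> (map_prod h id \<circ> g)"
    have "iso_onto (tr (Suc j) ` \<Gamma>) (tr (Suc j) ` ?T) h'"
      unfolding h'_def by (rule iso_onto_comp[OF iso_onto_comp[OF g(1) iso_onto_product[OF h]] iso_onto_ins])
    moreover have "dist (tr j (h' (tr (Suc j) p))) (h (tr j p)) \<le> \<eta>" if p: "p \<in> \<Gamma>" for p
    proof -
      define b where "b = g (tr (Suc j) p)"
      have b: "fst b \<in> tr j ` \<Gamma>" using g(1) p unfolding iso_onto_def b_def by (metis imageI mem_Times_iff)
      then have "h (fst b) \<in> tr j ` ?T" using h unfolding iso_onto_def by blast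
      then have "tr j (h (fst b)) = h (fst b)" by (auto simp: tr_tr)
      moreover have "tr j (ins j (x, t)) = tr j x" for x :: "'y \<times> (nat \<Rightarrow> real)" and t
        by (auto simp: tr_def ins_def trunc_def)
      ultimately have "tr j (h' (tr (Suc j) p)) = h (fst b)"
        by (simp add: h'_def b_def[symmetric] map_prod_def case_prod_beta)
      moreover have "dist (fst b) (tr j p) < d" using g(2)[OF p] d(1) by (simp add: b_def)
      ultimately show ?thesis using d(2)[OF _ b, of "tr j p"] p by (simp add: less_imp_le)
    qed
    ultimately show "\<exists>h'. iso_onto (tr (Suc j) ` \<Gamma>) (tr (Suc j) ` ?T) h' \<and>
        (\<forall>p\<in>\<Gamma>. dist (tr j (h' (tr (Suc j) p))) (h (tr j p)) \<le> \<eta>)" by blast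
  qed (rule h0, rule assms)
  then obtain f where f: "iso_onto \<Gamma> ?T f" "\<And>p. p \<in> \<Gamma> \<Longrightarrow> dist (tr 0 (f p)) (tr 0 p) \<le> \<epsilon>" by auto
  have "dist (fst (f p)) (fst p) \<le> \<epsilon>" if "p \<in> \<Gamma>" for p
    using f(2)[OF that] by (simp add: zero dist_Pair_Pair)
  with f(1) show ?thesis by blast
qed

end

section \<open>Absorbing a Hilbert cube factor\<close>

lemma cube_times_cube:
  assumes "e > 0"
  shows "\<exists>g. iso_onto (cube \<times> cube) cube g \<and> (\<forall>p\<in>cube \<times> cube. dist (g p) (fst p) \<le> e)"
proof -
  obtain k where k: "\<And>v w :: nat \<Rightarrow> real. (\<And>i. i < k \<Longrightarrow> v i = w i) \<Longrightarrow> dist v w < e"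
    using dist_fun_eventually_agree[OF assms] by blast
  \<comment> \<open>The first \<open>k\<close> coordinates, which decide the distance up to
    \<open>e\<close>, are kept; beyond them the tail of the first factor is interleaved with the
    whole second factor.\<close>
  define g :: "(nat \<Rightarrow> real) \<times> (nat \<Rightarrow> real) \<Rightarrow> nat \<Rightarrow> real" where
    "g p = (\<lambda>i. if i < k then fst p i else if even (i - k) then fst p (k + (i - k) div 2) else snd p ((i - k) div 2))" for p
  define h :: "(nat \<Rightarrow> real) \<Rightarrow> (nat \<Rightarrow> real) \<times> (nat \<Rightarrow> real)" where
    "h r = (\<lambda>i. if i < k then r i else r (k + 2 * (i - k)), \<lambda>j. r (k + 2 * j + 1))" for r
  have "continuous_on (cube \<times> cube) g"
    unfolding g_def[abs_def]
  proof (rule continuous_on_coordinatewise_then_product)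
    fix i
    have "continuous_on (cube \<times> cube) (\<lambda>p :: (nat \<Rightarrow> real) \<times> (nat \<Rightarrow> real). fst p j)"
      "continuous_on (cube \<times> cube) (\<lambda>p :: (nat \<Rightarrow> real) \<times> (nat \<Rightarrow> real). snd p j)" for j
      by (rule continuous_on_coord, intro continuous_intros)+
    then show "continuous_on (cube \<times> cube) (\<lambda>p :: (nat \<Rightarrow> real) \<times> (nat \<Rightarrow> real). if i < k then fst p i
        else if even (i - k) then fst p (k + (i - k) div 2) else snd p ((i - k) div 2))"
      by (cases "i < k"; cases "even (i - k)") simp_all
  qed
  moreover have hg: "h (g p) = p" for p
    by (simp add: h_def g_def prod_eq_iff fun_eq_iff)
  have "inj_on g (cube \<times> cube)" by (rule inj_on_inverseI[of _ h]) (rule hg)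
  moreover have gh: "g (h r) = r" for r
  proof
    fix i
    show "g (h r) i = r i"
    proof (cases "i < k")
      case False
      show ?thesis
      proof (cases "even (i - k)")
        case True
        then have "2 * ((i - k) div 2) = i - k" by simp
        then show ?thesis using False True by (simp add: g_def h_def)
      next
        case odd: False
        then have *: "k + 2 * ((i - k) div 2) + 1 = i" using False by presburger
        have "g (h r) i = r (k + 2 * ((i - k) div 2) + 1)"
          unfolding g_def h_def using False odd by (simp only: if_False snd_conv)
        then show ?thesis unfolding * .
      qed
    qed (simp add: g_def h_def)
  qed
  moreover have "g ` (cube \<times> cube) = cube"
  proof
    show "g ` (cube \<times> cube) \<subseteq> cube" by (auto simp: g_def cube_def)
    show "cube \<subseteq> g ` (cube \<times> cube)"
    proof
      fix r assume "r \<in> cube"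
      then have "h r \<in> cube \<times> cube" by (auto simp: h_def cube_def)
      then show "r \<in> g ` (cube \<times> cube)" using gh[of r] by (metis imageI)
    qed
  qed
  moreover have "dist (g p) (fst p) \<le> e" for p using k[of "g p" "fst p"] by (simp add: g_def less_imp_le)
  ultimately show ?thesis unfolding iso_onto_def by blast
qed

lemma iso_onto_mem: "iso_onto X Y f \<Longrightarrow> x \<in> X \<Longrightarrow> f x \<in> Y"
  unfolding iso_onto_def by auto

lemma times_cube_near_fst:
  fixes Y :: "'y::metric_space set"
  assumes \<theta>: "iso_onto Y cube \<theta>" and Y: "compact Y" and "e > 0"
  shows "\<exists>g. iso_onto (Y \<times> cube) Y g \<and> (\<forall>p\<in>Y \<times> cube. dist (g p) (fst p) \<le> e)"
proof -
  define \<theta>' where "\<theta>' = the_inv_into Y \<theta>"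
  have \<theta>': "iso_onto cube Y \<theta>'" unfolding \<theta>'_def by (rule iso_onto_inv[OF \<theta> Y])
  have inv: "\<theta>' (\<theta> y) = y" if "y \<in> Y" for y
    unfolding \<theta>'_def by (rule the_inv_into_f_f) (use \<theta> that in \<open>auto simp: iso_onto_def\<close>)
  have "uniformly_continuous_on cube \<theta>'"
    using \<theta>' by (intro compact_uniformly_continuous compact_cube) (simp add: iso_onto_def)
  then obtain d where d: "d > 0" "\<And>x x'. x \<in> cube \<Longrightarrow> x' \<in> cube \<Longrightarrow> dist x' x < d \<Longrightarrow> dist (\<theta>' x') (\<theta>' x) < e"
    using \<open>e > 0\<close> unfolding uniformly_continuous_on_def by metis
  obtain g where g: "iso_onto (cube \<times> cube) cube g" "\<And>p. p \<in> cube \<times> cube \<Longrightarrow> dist (g p) (fst p) \<le> d / 2"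
    using cube_times_cube[of "d/2"] d(1) by auto
  define G where "G = \<theta>' \<circ> (g \<circ> map_prod \<theta> id)"
  have "iso_onto (Y \<times> cube) Y G"
    unfolding G_def by (rule iso_onto_comp[OF iso_onto_comp[OF iso_onto_product[OF \<theta>] g(1)] \<theta>'])
  moreover have "dist (G p) (fst p) \<le> e" if p: "p \<in> Y \<times> cube" for p
  proof -
    have y: "fst p \<in> Y" "snd p \<in> cube" using p by (auto simp: mem_Times_iff)
    have m: "(\<theta> (fst p), snd p) \<in> cube \<times> cube" using y iso_onto_mem[OF \<theta>] by simp
    have "dist (g (\<theta> (fst p), snd p)) (\<theta> (fst p)) < d" using g(2)[OF m] d(1) by simp
    then have "dist (\<theta>' (g (\<theta> (fst p), snd p))) (\<theta>' (\<theta> (fst p))) < e"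
      using iso_onto_mem[OF g(1) m] iso_onto_mem[OF \<theta> y(1)] by (intro d(2))
    then show ?thesis by (simp add: G_def map_prod_def case_prod_beta inv[OF y(1)])
  qed
  ultimately show ?thesis by blast
qed

text \<open>A base that is itself a Hilbert cube absorbs the cube factor of the trivial bundle with
  arbitrarily little motion.\<close>

lemma (in parametric_keller) total_near_base:
  assumes \<theta>: "iso_onto Y cube \<theta>" and "e > 0"
  shows "\<exists>g. iso_onto \<Gamma> Y g \<and> (\<forall>p\<in>\<Gamma>. dist (g p) (fst p) \<le> e)"
proof -
  obtain f where f: "iso_onto \<Gamma> (Y \<times> cube) f" "\<And>p. p \<in> \<Gamma> \<Longrightarrow> dist (fst (f p)) (fst p) \<le> e/2"
    using trivial_bundle[of "e/2"] assms(2) by auto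
  obtain g where g: "iso_onto (Y \<times> cube) Y g" "\<And>p. p \<in> Y \<times> cube \<Longrightarrow> dist (g p) (fst p) \<le> e/2"
    using times_cube_near_fst[OF \<theta> compact_base, of "e/2"] assms(2) by auto
  have "dist ((g \<circ> f) p) (fst p) \<le> e" if "p \<in> \<Gamma>" for p
    using f(2)[OF that] g(2)[OF iso_onto_mem[OF f(1) that]] dist_triangle[of "g (f p)" "fst p" "fst (f p)"] by simp
  then show ?thesis using iso_onto_comp[OF f(1) g(1)] by blast
qed

section \<open>Support functions on a dense set of directions\<close>

definition body :: "'a::euclidean_space set \<Rightarrow> bool" where
  "body A \<longleftrightarrow> compact A \<and> convex A \<and> 0 \<in> A"

text \<open>Density makes the sampled support values determine the body; distinctness lets finitely
  many of them be prescribed independently in \<open>cut_caps\<close>. An injective sequence of unit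
  vectors exists only in dimension at least 2.\<close>

locale dense_directions =
  fixes u :: "nat \<Rightarrow> 'a::euclidean_space"
  assumes norm_u: "\<And>i. norm (u i) = 1" and inj_u: "inj u"
    and dense_u: "\<And>d e. norm d = 1 \<Longrightarrow> e > 0 \<Longrightarrow> \<exists>i. dist (u i) d < e"
begin

definition supp :: "'a set \<Rightarrow> nat \<Rightarrow> real" where
  "supp A i = (SUP x\<in>A. x \<bullet> u i)"

definition SS where "SS = supp ` {A. body A}"

text \<open>For \<open>0 \<le> a\<close> these are the bodies between \<open>cball 0 a\<close> and
  \<open>cball 0 b\<close>.\<close>

definition S where "S a b = {v\<in>SS. \<forall>i. a \<le> v i \<and> v i \<le> b}"

definition body_of where "body_of v = {x. \<forall>i. x \<bullet> u i \<le> v i}"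

lemma supp_attained:
  assumes "body A" shows "\<exists>x\<in>A. x \<bullet> u i = supp A i \<and> (\<forall>y\<in>A. y \<bullet> u i \<le> supp A i)"
proof -
  have "compact A" "A \<noteq> {}" using assms by (auto simp: body_def)
  moreover have "continuous_on A (\<lambda>x. x \<bullet> u i)" by (intro continuous_intros)
  ultimately obtain x where x: "x \<in> A" "\<And>y. y \<in> A \<Longrightarrow> y \<bullet> u i \<le> x \<bullet> u i"
    using continuous_attains_sup[of A "\<lambda>x. x \<bullet> u i"] by blast
  have "supp A i = x \<bullet> u i" unfolding supp_def by (rule cSup_eq_maximum) (use x in auto)
  with x show ?thesis by auto
qed

lemma inner_le_supp: "body A \<Longrightarrow> x \<in> A \<Longrightarrow> x \<bullet> u i \<le> supp A i"
  using supp_attained by blast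

lemma supp_le: "body A \<Longrightarrow> (\<And>x. x \<in> A \<Longrightarrow> x \<bullet> u i \<le> c) \<Longrightarrow> supp A i \<le> c"
  using supp_attained by metis

lemma supp_eqI: "body A \<Longrightarrow> (\<And>x. x \<in> A \<Longrightarrow> x \<bullet> u i \<le> c) \<Longrightarrow> x \<in> A \<Longrightarrow> x \<bullet> u i = c \<Longrightarrow> supp A i = c"
  using supp_le inner_le_supp by (metis antisym)

lemma supp_mono: "body A \<Longrightarrow> body B \<Longrightarrow> A \<subseteq> B \<Longrightarrow> supp A i \<le> supp B i"
  by (rule supp_le) (auto intro: inner_le_supp)

lemma supp_nonneg: "body A \<Longrightarrow> 0 \<le> supp A i"
  using inner_le_supp[of A 0 i] by (simp add: body_def)

lemma mem_iff_supp:
  assumes A: "body A"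
  shows "x \<in> A \<longleftrightarrow> (\<forall>i. x \<bullet> u i \<le> supp A i)"
proof
  assume "x \<in> A" then show "\<forall>i. x \<bullet> u i \<le> supp A i" using inner_le_supp[OF A] by blast
next
  assume x: "\<forall>i. x \<bullet> u i \<le> supp A i"
  show "x \<in> A"
  proof (rule ccontr)
    assume "x \<notin> A"
    have cA: "closed A" "convex A" "bounded A" "A \<noteq> {}" using A compact_imp_closed compact_imp_bounded by (auto simp: body_def)
    obtain a b where ab: "a \<bullet> x < b" "\<And>y. y \<in> A \<Longrightarrow> b < a \<bullet> y"
      using separating_hyperplane_closed_point[OF cA(2,1) \<open>x \<notin> A\<close>] by blast
    have a0: "a \<noteq> 0" using ab cA(4) by force
    define d where "d = - a /\<^sub>R norm a"
    have d: "norm d = 1" using a0 by (simp add: d_def)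
    define \<gamma> where "\<gamma> = (b - a \<bullet> x) / norm a"
    have \<gamma>: "\<gamma> > 0" using ab a0 by (simp add: \<gamma>_def)
    have sep: "y \<bullet> d \<le> x \<bullet> d - \<gamma>" if "y \<in> A" for y
    proof -
      have "b / norm a \<le> (a \<bullet> y) / norm a" using ab(2)[OF that] by (intro divide_right_mono) auto
      then show ?thesis by (simp add: d_def \<gamma>_def inner_commute divide_inverse algebra_simps)
    qed
    obtain B where B: "B > 0" "\<And>y. y \<in> A \<Longrightarrow> norm y \<le> B" using cA(3) bounded_pos by blast
    \<comment> \<open>Replacing the separating direction \<open>d\<close> by a sampled one changes
      the inner products with \<open>x\<close> and with a point of \<open>A\<close> by at most
      \<open>(B + norm x) * \<epsilon>\<close> in total, which is half of the gap
      \<open>\<gamma>\<close>.\<close>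
    define \<epsilon> where "\<epsilon> = \<gamma> / 2 / (B + norm x)"
    have pos: "B + norm x > 0" using B(1) by (simp add: add_pos_nonneg)
    then have \<epsilon>: "\<epsilon> > 0" using \<gamma> by (simp add: \<epsilon>_def)
    obtain i where i: "dist (u i) d < \<epsilon>" using dense_u[OF d \<epsilon>] by blast
    have near: "\<bar>y \<bullet> u i - y \<bullet> d\<bar> \<le> norm y * \<epsilon>" for y
    proof -
      have "\<bar>y \<bullet> (u i - d)\<bar> \<le> norm y * norm (u i - d)" by (rule Cauchy_Schwarz_ineq2)
      also have "\<dots> \<le> norm y * \<epsilon>" using i by (intro mult_left_mono) (auto simp: dist_norm)
      finally show ?thesis by (simp add: inner_diff_right)
    qed
    obtain y where y: "y \<in> A" "y \<bullet> u i = supp A i" using supp_attained[OF A] by blast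
    have "norm y * \<epsilon> \<le> B * \<epsilon>" using B(2)[OF y(1)] \<epsilon> by (intro mult_right_mono) auto
    moreover have "(B + norm x) * \<epsilon> = \<gamma> / 2"
      using nonzero_divide_eq_eq[of "B + norm x" "\<gamma> / 2" \<epsilon>] pos by (metis \<epsilon>_def less_irrefl mult.commute)
    moreover have "x \<bullet> u i \<le> y \<bullet> u i" using x y(2) by simp
    ultimately show False
      using near[of x] near[of y] sep[OF y(1)] \<gamma> by (simp add: distrib_right abs_le_iff)
  qed
qed

lemma body_of_supp: "body A \<Longrightarrow> body_of (supp A) = A"
  unfolding body_of_def using mem_iff_supp by blast

lemma norm_le_if_inner_le:
  assumes "\<And>i. x \<bullet> u i \<le> b" "0 \<le> b" shows "norm x \<le> b"
proof (cases "x = 0")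
  case False
  show ?thesis
  proof (rule field_le_epsilon)
    fix e :: real assume "e > 0"
    define d where "d = x /\<^sub>R norm x"
    have d: "norm d = 1" "x \<bullet> d = norm x" using False by (simp_all add: d_def dot_square_norm power2_eq_square)
    have "e / norm x > 0" using \<open>e > 0\<close> False by simp
    then obtain i where i: "dist (u i) d < e / norm x" using dense_u[OF d(1)] by blast
    have "norm x = x \<bullet> u i - x \<bullet> (u i - d)" using d by (simp add: inner_diff_right)
    also have "\<dots> \<le> b + norm x * norm (u i - d)"
      using assms(1)[of i] Cauchy_Schwarz_ineq2[of x "u i - d"] by linarith
    also have "norm x * norm (u i - d) \<le> norm x * (e / norm x)"
      using i by (intro mult_left_mono) (auto simp: dist_norm)
    finally show "norm x \<le> b + e" using False by simp
  qed
qed (use assms in simp)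

lemma inner_u_le_norm: "x \<bullet> u i \<le> norm x"
  using Cauchy_Schwarz_ineq2[of x "u i"] norm_u by simp

lemma body_body_of:
  assumes "\<And>i. 0 \<le> v i" "\<And>i. v i \<le> b"
  shows "body (body_of v)"
proof -
  have "closed {x. x \<bullet> u i \<le> v i}" for i by (intro closed_Collect_le continuous_intros)
  then have "closed (body_of v)" unfolding body_of_def by (intro closed_Collect_all) simp
  moreover have "body_of v \<subseteq> cball 0 b"
  proof
    fix x assume "x \<in> body_of v"
    then have "x \<bullet> u i \<le> b" for i unfolding body_of_def using assms(2) order_trans by blast
    then have "norm x \<le> b" using assms order_trans by (intro norm_le_if_inner_le) blast+
    then show "x \<in> cball 0 b" by simp
  qed
  ultimately have "compact (body_of v)" by (meson bounded_cball bounded_subset compact_eq_bounded_closed)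
  moreover have "convex (body_of v)"
  proof -
    have "body_of v = (\<Inter>i. {x. u i \<bullet> x \<le> v i})" by (auto simp: body_of_def inner_commute)
    then show ?thesis by (simp add: convex_INT convex_halfspace_le)
  qed
  ultimately show ?thesis using assms by (simp add: body_def body_of_def)
qed

lemma SS_nonneg: "v \<in> SS \<Longrightarrow> 0 \<le> v i"
  unfolding SS_def using supp_nonneg by auto

lemma body_S: "0 \<le> a \<Longrightarrow> v \<in> S a b \<Longrightarrow> body (body_of v)"
  by (rule body_body_of[of v b]) (auto simp: S_def SS_nonneg)

lemma supp_body_of: "v \<in> SS \<Longrightarrow> supp (body_of v) = v"
  unfolding SS_def using body_of_supp by auto

lemma body_of_bounds:
  assumes "0 \<le> b" "v \<in> S a b"
  shows "body_of v \<subseteq> cball 0 b" "cball 0 a \<subseteq> body_of v"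
proof
  fix x assume "x \<in> body_of v"
  then have "x \<bullet> u i \<le> b" for i using assms(2) unfolding body_of_def S_def using order_trans by blast
  then show "x \<in> cball 0 b" using norm_le_if_inner_le[of x b] assms(1) by simp
next
  show "cball 0 a \<subseteq> body_of v"
  proof
    fix x :: 'a assume "x \<in> cball 0 a"
    then have "x \<bullet> u i \<le> a" for i using inner_u_le_norm[of x i] by simp
    then show "x \<in> body_of v" using assms(2) unfolding body_of_def S_def using order_trans by blast
  qed
qed

lemma supp_in_S:
  assumes "body A" "cball 0 a \<subseteq> A" "A \<subseteq> cball 0 b" "0 \<le> a"
  shows "supp A \<in> S a b"
proof -
  have "a \<le> supp A i" for i
  proof -
    have "a *\<^sub>R u i \<in> A" using assms(2,4) norm_u by auto
    from inner_le_supp[OF assms(1) this, of i] show ?thesis using norm_u[of i] by (simp add: norm_eq_1)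
  qed
  moreover have "supp A i \<le> b" for i
  proof (rule supp_le[OF assms(1)])
    fix x assume "x \<in> A"
    then have "norm x \<le> b" using assms(3) by auto
    then show "x \<bullet> u i \<le> b" using inner_u_le_norm[of x i] by linarith
  qed
  ultimately show ?thesis using assms(1) by (simp add: S_def SS_def)
qed

section \<open>Operations on bodies, and compactness of \<open>S a b\<close>\<close>

lemma supp_scale:
  assumes "body A" "0 \<le> r"
  shows "body ((*\<^sub>R) r ` A)" "supp ((*\<^sub>R) r ` A) = (\<lambda>i. r * supp A i)"
proof -
  show b: "body ((*\<^sub>R) r ` A)"
    using assms by (auto simp: body_def compact_scaling convex_scaling image_iff intro: bexI[of _ 0])
  show "supp ((*\<^sub>R) r ` A) = (\<lambda>i. r * supp A i)"
  proof
    fix i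
    obtain x where x: "x \<in> A" "x \<bullet> u i = supp A i" "\<And>y. y \<in> A \<Longrightarrow> y \<bullet> u i \<le> supp A i"
      using supp_attained[OF assms(1)] by blast
    show "supp ((*\<^sub>R) r ` A) i = r * supp A i"
      by (rule supp_eqI[OF b, of _ _ "r *\<^sub>R x"]) (use x assms(2) in \<open>auto simp: mult_left_mono\<close>)
  qed
qed

lemma supp_sum:
  assumes "body A" "body B"
  shows "body {x + y |x y. x \<in> A \<and> y \<in> B}" "supp {x + y |x y. x \<in> A \<and> y \<in> B} = (\<lambda>i. supp A i + supp B i)"
proof -
  let ?C = "{x + y |x y. x \<in> A \<and> y \<in> B}"
  have eq: "?C = (\<Union>x\<in>A. \<Union>y\<in>B. {x + y})" by auto
  have "convex ?C" unfolding eq using assms by (intro convex_sums) (auto simp: body_def)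
  moreover have "compact ?C" using assms by (intro compact_sums) (auto simp: body_def)
  moreover have "0 \<in> ?C" using assms by (force simp: body_def)
  ultimately show b: "body ?C" by (simp add: body_def)
  show "supp ?C = (\<lambda>i. supp A i + supp B i)"
  proof
    fix i
    obtain x where x: "x \<in> A" "x \<bullet> u i = supp A i" "\<And>y. y \<in> A \<Longrightarrow> y \<bullet> u i \<le> supp A i"
      using supp_attained[OF assms(1)] by blast
    obtain x' where x': "x' \<in> B" "x' \<bullet> u i = supp B i" "\<And>y. y \<in> B \<Longrightarrow> y \<bullet> u i \<le> supp B i"
      using supp_attained[OF assms(2)] by blast
    show "supp ?C i = supp A i + supp B i"
      by (rule supp_eqI[OF b, of _ _ "x + x'"]) (use x x' in \<open>auto simp: inner_add_left intro!: add_mono\<close>)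
  qed
qed

lemma supp_hull:
  assumes "body A" "body B"
  shows "body (convex hull (A \<union> B))" "supp (convex hull (A \<union> B)) = (\<lambda>i. max (supp A i) (supp B i))"
proof -
  show b: "body (convex hull (A \<union> B))"
    using assms hull_subset[of "A \<union> B" convex]
    by (auto simp: body_def intro!: compact_convex_hull compact_Un)
  show "supp (convex hull (A \<union> B)) = (\<lambda>i. max (supp A i) (supp B i))"
  proof
    fix i
    have "convex hull (A \<union> B) \<subseteq> {x. u i \<bullet> x \<le> max (supp A i) (supp B i)}"
      using inner_le_supp[OF assms(1)] inner_le_supp[OF assms(2)]
      by (intro hull_minimal convex_halfspace_le) (auto simp: inner_commute le_max_iff_disj)
    then have "supp (convex hull (A \<union> B)) i \<le> max (supp A i) (supp B i)"
      by (intro supp_le[OF b]) (auto simp: inner_commute)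
    moreover have "supp A i \<le> supp (convex hull (A \<union> B)) i" "supp B i \<le> supp (convex hull (A \<union> B)) i"
      using hull_subset[of "A \<union> B" convex] by (auto intro!: supp_mono assms b)
    ultimately show "supp (convex hull (A \<union> B)) i = max (supp A i) (supp B i)" by linarith
  qed
qed

lemma SS_comb:
  assumes "v \<in> SS" "w \<in> SS" "0 \<le> r" "0 \<le> s"
  shows "(\<lambda>i. r * v i + s * w i) \<in> SS"
proof -
  obtain A B where AB: "body A" "v = supp A" "body B" "w = supp B" using assms unfolding SS_def by blast
  note sc = supp_scale[OF AB(1) assms(3)] supp_scale[OF AB(3) assms(4)]
  show ?thesis
    unfolding SS_def using supp_sum[OF sc(1) sc(3)] sc(2,4) AB by (intro image_eqI) auto
qed

lemma SS_max: "v \<in> SS \<Longrightarrow> w \<in> SS \<Longrightarrow> (\<lambda>i. max (v i) (w i)) \<in> SS"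
proof -
  assume "v \<in> SS" "w \<in> SS"
  then obtain A B where AB: "body A" "v = supp A" "body B" "w = supp B" unfolding SS_def by blast
  show ?thesis
    unfolding SS_def using supp_hull[OF AB(1,3)] AB by (intro image_eqI[of _ _ "convex hull (A \<union> B)"]) auto
qed

lemma body_cball: "0 \<le> r \<Longrightarrow> body (cball (0::'a) r)"
  by (simp add: body_def)

lemma supp_cball: "0 \<le> r \<Longrightarrow> supp (cball 0 r) = (\<lambda>i. r)"
proof
  fix i assume r: "0 \<le> r"
  show "supp (cball 0 r) i = r"
  proof (rule supp_eqI[OF body_cball[OF r], of _ _ "r *\<^sub>R u i"])
    fix x :: 'a assume "x \<in> cball 0 r" then show "x \<bullet> u i \<le> r" using inner_u_le_norm[of x i] by simp
  qed (use r in \<open>auto simp: norm_u dot_square_norm\<close>)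
qed

lemma SS_const: "0 \<le> r \<Longrightarrow> (\<lambda>i. r) \<in> SS"
  unfolding SS_def using supp_cball[of r] body_cball[of r] by (intro image_eqI[of _ _ "cball 0 r"]) auto

lemma S_comb:
  assumes "v \<in> S a b" "w \<in> S a b" "0 \<le> t" "t \<le> 1"
  shows "(\<lambda>i. (1 - t) * v i + t * w i) \<in> S a b"
proof -
  have "(\<lambda>i. (1 - t) * v i + t * w i) \<in> SS" using assms by (intro SS_comb) (auto simp: S_def)
  moreover have "a \<le> (1 - t) * v i + t * w i" "(1 - t) * v i + t * w i \<le> b" for i
  proof -
    have "(1 - t) * a + t * a \<le> (1 - t) * v i + t * w i" "(1 - t) * v i + t * w i \<le> (1 - t) * b + t * b"
      using assms by (intro add_mono mult_left_mono; auto simp: S_def)+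
    then show "a \<le> (1 - t) * v i + t * w i" "(1 - t) * v i + t * w i \<le> b" by (simp_all add: algebra_simps)
  qed
  ultimately show ?thesis by (simp add: S_def)
qed

text \<open>Compare the two directions at a point of the body where \<open>v i\<close> is attained;
  this point has norm at most \<open>b\<close>.\<close>

lemma S_equicontinuous:
  assumes "0 \<le> b" "v \<in> S 0 b"
  shows "\<bar>v i - v j\<bar> \<le> b * norm (u i - u j)"
proof -
  have *: "v i - v j \<le> b * norm (u i - u j)" for i j
  proof -
    note A = body_S[OF order_refl assms(2)]
    have v: "v = supp (body_of v)" using supp_body_of assms(2) by (simp add: S_def)
    obtain x where x: "x \<in> body_of v" "x \<bullet> u i = v i" using supp_attained[OF A, of i] v by metis
    have "x \<bullet> u j \<le> v j" using x(1) by (simp add: body_of_def)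
    then have "v i - v j \<le> x \<bullet> (u i - u j)" using x(2) by (simp add: inner_diff_right)
    also have "\<dots> \<le> norm x * norm (u i - u j)" using Cauchy_Schwarz_ineq2[of x "u i - u j"] by linarith
    also have "\<dots> \<le> b * norm (u i - u j)"
      using body_of_bounds(1)[OF assms] x(1) by (intro mult_right_mono) auto
    finally show ?thesis .
  qed
  show ?thesis using *[of i j] *[of j i] by (simp add: abs_le_iff norm_minus_commute)
qed

lemma S_subset: "0 \<le> a \<Longrightarrow> S a b \<subseteq> S 0 b"
  by (auto simp: S_def SS_nonneg)

text \<open>A form of Blaschke selection. A coordinatewise limit \<open>v\<close> is again a support
  sequence: points attaining \<open>vs n\<close> in direction \<open>u j\<close> accumulate at a
  point of \<open>body_of v\<close> that attains \<open>v j\<close>.\<close>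

lemma compact_S:
  assumes "0 \<le> a"
  shows "compact (S a b)"
proof -
  let ?B = "{v :: nat \<Rightarrow> real. \<forall>i. v i \<in> {a..b}}"
  have "compact ?B" by (intro compact_box) auto
  moreover have "S a b \<subseteq> ?B" by (auto simp: S_def)
  moreover have "closed (S a b)"
    unfolding closed_sequential_limits
  proof (intro allI impI, elim conjE)
    fix vs :: "nat \<Rightarrow> nat \<Rightarrow> real" and v assume vs: "\<forall>n. vs n \<in> S a b" and "vs \<longlonglongrightarrow> v"
    then have lim: "(\<lambda>n. vs n i) \<longlonglongrightarrow> v i" for i using tendsto_fun_iff[of vs] by blast
    have bnd: "a \<le> v i" "v i \<le> b" for i
      using vs by (auto intro!: LIMSEQ_le_const[OF lim] LIMSEQ_le_const2[OF lim] simp: S_def)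
    have b0: "0 \<le> b" using bnd[of 0] assms by linarith
    have "0 \<le> v i" for i using bnd(1)[of i] assms by linarith
    then have A: "body (body_of v)" by (rule body_body_of) (rule bnd(2))
    have "supp (body_of v) j = v j" for j
    proof -
      have "\<exists>x. x \<in> body_of (vs n) \<and> x \<bullet> u j = vs n j" for n
        using supp_attained[OF body_S[OF assms], of "vs n" b j] supp_body_of[of "vs n"] vs by (auto simp: S_def)
      then obtain x where x: "\<And>n. x n \<in> body_of (vs n)" "\<And>n. x n \<bullet> u j = vs n j" by metis
      have "\<forall>n. x n \<in> cball 0 b"
      proof
        fix n show "x n \<in> cball 0 b" using body_of_bounds(1)[OF b0, of "vs n" a] vs x(1)[of n] by blast
      qed
      then obtain l r where l: "strict_mono (r :: nat \<Rightarrow> nat)" "(x \<circ> r) \<longlonglongrightarrow> l"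
        using compact_cball[of "0::'a" b] unfolding compact_def by meson
      have li: "(\<lambda>n. x (r n) \<bullet> u i) \<longlonglongrightarrow> l \<bullet> u i" for i
        using l(2) by (intro tendsto_inner tendsto_const) (simp add: comp_def)
      have lv: "(\<lambda>n. vs (r n) i) \<longlonglongrightarrow> v i" for i
        using LIMSEQ_subseq_LIMSEQ[OF lim l(1)] by (simp add: comp_def)
      have "l \<bullet> u i \<le> v i" for i
        using x(1) by (intro LIMSEQ_le[OF li lv]) (auto simp: body_of_def)
      then have "l \<in> body_of v" by (simp add: body_of_def)
      moreover have "l \<bullet> u j = v j" using LIMSEQ_unique[OF li[of j]] lv[of j] x(2) by simp
      ultimately show ?thesis by (intro supp_eqI[OF A]) (auto simp: body_of_def)
    qed
    then have "v = supp (body_of v)" by auto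
    then have "v \<in> SS" unfolding SS_def using A by blast
    then show "v \<in> S a b" using bnd by (simp add: S_def)
  qed
  ultimately show ?thesis
    using compact_Int_closed[of ?B "S a b"] by (simp add: Int_absorb1)
qed

text \<open>On \<open>S 0 b\<close> the product metric controls the supremum distance: by
  equicontinuity, closeness at the finitely many directions of an \<open>e\<close>-net of the sphere
  spreads to all directions. The error splits into three parts of \<open>\<eta> / 3\<close>.\<close>

lemma S_uniform:
  assumes "0 \<le> b" "\<eta> > 0"
  shows "\<exists>d>0. \<forall>v\<in>S 0 b. \<forall>w\<in>S 0 b. dist v w < d \<longrightarrow> (\<forall>i. \<bar>v i - w i\<bar> \<le> \<eta>)"
proof -
  define e where "e = \<eta> / (3 * (b + 1))"
  have e: "e > 0" "b * e \<le> \<eta> / 3"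
    using assms by (simp_all add: e_def field_simps)
  have "compact (sphere (0::'a) 1)" by simp
  moreover have "sphere 0 1 \<subseteq> (\<Union>i\<in>UNIV. ball (u i) e)"
    using dense_u[OF _ e(1)] by (force simp: dist_commute)
  ultimately obtain I where I: "finite I" "sphere 0 1 \<subseteq> (\<Union>i\<in>I. ball (u i) e)"
    using compactE_image[of "sphere 0 1" UNIV "\<lambda>i. ball (u i) e"] by auto
  have "\<exists>d>0. \<forall>v\<in>S 0 b. \<forall>w\<in>S 0 b. dist v w < d \<longrightarrow> (\<forall>i\<in>J. \<bar>v i - w i\<bar> < \<eta> / 3)" if "finite J" for J
    using that
  proof induction
    case empty
    then show ?case by (intro exI[of _ 1]) simp
  next
    case (insert j J)
    obtain d where d: "d > 0" "\<And>v w. v \<in> S 0 b \<Longrightarrow> w \<in> S 0 b \<Longrightarrow> dist v w < d \<Longrightarrow> (\<forall>i\<in>J. \<bar>v i - w i\<bar> < \<eta> / 3)"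
      using insert.IH by blast
    have "uniformly_continuous_on (S 0 b) (\<lambda>v. v j)"
      by (intro compact_uniformly_continuous compact_S) (auto intro: continuous_on_coord continuous_on_id)
    then obtain d' where d': "d' > 0" "\<And>v w. v \<in> S 0 b \<Longrightarrow> w \<in> S 0 b \<Longrightarrow> dist w v < d' \<Longrightarrow> dist (w j) (v j) < \<eta> / 3"
      using assms(2) unfolding uniformly_continuous_on_def by (metis zero_less_divide_iff zero_less_numeral)
    have "\<bar>v i - w i\<bar> < \<eta> / 3" if "v \<in> S 0 b" "w \<in> S 0 b" "dist v w < min d d'" "i \<in> insert j J" for v w i
      using d(2)[OF that(1,2)] d'(2)[OF that(2,1)] that(3,4) by (auto simp: dist_real_def)
    then show ?case using d(1) d'(1) by (intro exI[of _ "min d d'"]) auto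
  qed
  from this[OF I(1)] obtain d where d: "d > 0"
    "\<And>v w. v \<in> S 0 b \<Longrightarrow> w \<in> S 0 b \<Longrightarrow> dist v w < d \<Longrightarrow> (\<forall>i\<in>I. \<bar>v i - w i\<bar> < \<eta> / 3)" by blast
  have "\<bar>v i - w i\<bar> \<le> \<eta>" if vw: "v \<in> S 0 b" "w \<in> S 0 b" "dist v w < d" for v w i
  proof -
    have "u i \<in> sphere 0 1" using norm_u by simp
    then obtain j where j: "j \<in> I" "norm (u i - u j) < e" using I(2) by (auto simp: dist_norm norm_minus_commute)
    have "b * norm (u i - u j) \<le> b * e" using j assms(1) by (intro mult_left_mono) auto
    then have "\<bar>v i - v j\<bar> \<le> \<eta> / 3" "\<bar>w i - w j\<bar> \<le> \<eta> / 3"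
      using S_equicontinuous[OF assms(1) vw(1), of i j] S_equicontinuous[OF assms(1) vw(2), of i j] e(2) by linarith+
    moreover have "\<bar>v j - w j\<bar> < \<eta> / 3" using d(2)[OF vw] j(1) by blast
    ultimately show ?thesis by linarith
  qed
  with d(1) show ?thesis by blast
qed

text \<open>Disjoint small caps cut off the unit ball prescribe finitely many support values independently.\<close>

lemma cut_caps:
  assumes "e > 0"
  shows "\<exists>\<sigma>>0. \<sigma> \<le> e \<and> \<sigma> < 1 \<and> (\<forall>s. (\<forall>i<k. 0 \<le> s i \<and> s i \<le> \<sigma>) \<longrightarrow>
     (\<exists>w\<in>SS. (\<forall>i. 1 - \<sigma> \<le> w i \<and> w i \<le> 1) \<and> (\<forall>i<k. w i = 1 - s i)))"
proof -
  define P where "P = {(i, j). i < k \<and> j < k \<and> i \<noteq> j}"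
  have finP: "finite P" by (rule finite_subset[of _ "{..<k} \<times> {..<k}"]) (auto simp: P_def)
  have lt1: "u i \<bullet> u j < 1" if "i \<noteq> j" for i j
  proof -
    have "u i \<bullet> u j \<le> 1" using inner_u_le_norm[of "u i" j] norm_u by simp
    moreover have "u i \<bullet> u j \<noteq> 1"
    proof
      assume "u i \<bullet> u j = 1"
      then have "(norm (u i - u j))\<^sup>2 = 0"
        using norm_u[of i] norm_u[of j]
        by (simp add: power2_norm_eq_inner inner_diff_left inner_diff_right inner_commute norm_eq_1)
      then show False using inj_u that by (simp add: inj_eq)
    qed
    ultimately show ?thesis by simp
  qed
  \<comment> \<open>The largest cosine between two of the first \<open>k\<close> directions, less
    than 1 as they are distinct; inserting 0 covers an empty set of pairs and makes
    \<open>\<rho>\<close> nonnegative.\<close>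
  define \<rho> where "\<rho> = Max (insert 0 ((\<lambda>(i, j). u i \<bullet> u j) ` P))"
  have \<rho>: "0 \<le> \<rho>" "\<And>i j. i < k \<Longrightarrow> j < k \<Longrightarrow> i \<noteq> j \<Longrightarrow> u i \<bullet> u j \<le> \<rho>"
    unfolding \<rho>_def using finP by (auto intro!: Max_ge simp: P_def)
  have "\<rho> < 1"
    unfolding \<rho>_def using finP lt1 by (subst Max_less_iff) (auto simp: P_def)
  \<comment> \<open>With \<open>\<sigma> \<le> 1 - \<rho>\<close> the tip
    \<open>(1 - s i) *\<^sub>R u i\<close> survives every other cut, having inner product at most
    \<open>\<rho> \<le> 1 - s j\<close> with \<open>u j\<close>. The bound \<open>1/2\<close>
    ensures \<open>\<sigma> < 1\<close> when \<open>\<rho> = 0\<close>.\<close>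
  define \<sigma> where "\<sigma> = min e (min ((1 - \<rho>)) (1/2))"
  have \<sigma>: "\<sigma> > 0" "\<sigma> \<le> e" "\<sigma> < 1" "\<sigma> \<le> 1 - \<rho>"
    using \<open>\<rho> < 1\<close> assms by (auto simp: \<sigma>_def)
  have "\<exists>w\<in>SS. (\<forall>i. 1 - \<sigma> \<le> w i \<and> w i \<le> 1) \<and> (\<forall>i<k. w i = 1 - s i)"
    if s: "\<forall>i<k. 0 \<le> s i \<and> s i \<le> \<sigma>" for s
  proof -
    define K where "K = cball (0::'a) 1 \<inter> (\<Inter>i\<in>{..<k}. {x. u i \<bullet> x \<le> 1 - s i})"
    have cK: "closed (\<Inter>i\<in>{..<k}. {x. u i \<bullet> x \<le> 1 - s i})" by (intro closed_INT ballI closed_halfspace_le)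
    have "0 \<in> K" using s \<sigma> by (auto simp: K_def)
    then have K: "body K"
      unfolding body_def K_def using cK
      by (auto intro!: compact_Int_closed convex_Int convex_INT convex_halfspace_le)
    have up: "supp K i \<le> 1" for i
    proof (rule supp_le[OF K])
      fix x assume "x \<in> K"
      then have "norm x \<le> 1" by (simp add: K_def)
      then show "x \<bullet> u i \<le> 1" using inner_u_le_norm[of x i] by linarith
    qed
    have low: "1 - \<sigma> \<le> supp K i" for i
    proof -
      have "(1 - \<sigma>) *\<^sub>R u i \<in> K"
      proof -
        have "u j \<bullet> ((1 - \<sigma>) *\<^sub>R u i) \<le> 1 - s j" if "j < k" for j
        proof -
          have "u j \<bullet> u i \<le> 1" using inner_u_le_norm[of "u j" i] norm_u by simp
          then have "(1 - \<sigma>) * (u j \<bullet> u i) \<le> (1 - \<sigma>) * 1" using \<sigma> by (intro mult_left_mono) auto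
          then show ?thesis using s that by force
        qed
        moreover have "norm ((1 - \<sigma>) *\<^sub>R u i) \<le> 1" using \<sigma> norm_u by simp
        ultimately show ?thesis by (auto simp: K_def)
      qed
      from inner_le_supp[OF K this, of i] show ?thesis using norm_u[of i] by (simp add: norm_eq_1)
    qed
    have eq: "supp K i = 1 - s i" if i: "i < k" for i
    proof (rule supp_eqI[OF K, of _ _ "(1 - s i) *\<^sub>R u i"])
      show "x \<bullet> u i \<le> 1 - s i" if "x \<in> K" for x using that i by (auto simp: K_def inner_commute)
      show "((1 - s i) *\<^sub>R u i) \<bullet> u i = 1 - s i" using norm_u[of i] by (simp add: norm_eq_1)
      have si: "0 \<le> s i" "s i \<le> \<sigma>" using s i by auto
      have "u j \<bullet> ((1 - s i) *\<^sub>R u i) \<le> 1 - s j" if j: "j < k" for j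
      proof (cases "j = i")
        case True
        then show ?thesis using norm_u[of i] by (simp add: norm_eq_1)
      next
        case False
        have "(1 - s i) * (u j \<bullet> u i) \<le> (1 - s i) * \<rho>"
          using \<rho>(2)[OF j i False] si \<sigma> by (intro mult_left_mono) auto
        also have "\<dots> \<le> 1 * \<rho>" using si \<rho>(1) by (intro mult_right_mono) auto
        also have "\<dots> \<le> 1 - s j" using s j \<sigma>(4) by force
        finally show ?thesis by simp
      qed
      moreover have "norm ((1 - s i) *\<^sub>R u i) \<le> 1" using si \<sigma> norm_u by simp
      ultimately show "(1 - s i) *\<^sub>R u i \<in> K" by (auto simp: K_def)
    qed
    show ?thesis
      by (rule bexI[of _ "supp K"]) (use up low eq K in \<open>auto simp: SS_def\<close>)
  qed
  then show ?thesis using \<sigma> by (intro exI[of _ \<sigma>]) auto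
qed

end

section \<open>Raising the floor of a support function\<close>

lemma continuous_on_fst_coord:
  "continuous_on X (\<lambda>p :: (nat \<Rightarrow> real) \<times> 'b::topological_space. fst p i)"
  by (rule continuous_on_coord[OF continuous_on_fst[OF continuous_on_id]])

lemma continuous_on_snd_coord:
  "continuous_on X (\<lambda>p :: 'b::topological_space \<times> (nat \<Rightarrow> real). snd p i)"
  by (rule continuous_on_coord[OF continuous_on_snd[OF continuous_on_id]])

lemma iso_onto_swap: "iso_onto X (prod.swap ` X) prod.swap"
  unfolding iso_onto_def by (auto intro: continuous_on_swap)

context dense_directions
begin

text \<open>Source of all the boxes required by \<open>centre\<close>: the sum of
  \<open>r * v\<close> and \<open>\<kappa>\<close> times a capped unit ball can take any first
  \<open>k\<close> values in the given range. The cap depths \<open>s i\<close> solve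
  \<open>x i = r * v i + \<kappa> * (1 - s i)\<close>.\<close>

lemma SS_capped:
  assumes "v \<in> SS" "\<kappa> > 0" "0 \<le> r"
    and cap: "\<And>s. (\<And>i. i < k \<Longrightarrow> 0 \<le> s i \<and> s i \<le> \<sigma>) \<Longrightarrow>
     \<exists>w\<in>SS. (\<forall>i. 1 - \<sigma> \<le> w i \<and> w i \<le> 1) \<and> (\<forall>i<k. w i = 1 - s i)"
    and x: "\<And>i. i < k \<Longrightarrow> \<bar>x i - (r * v i + \<kappa> * (1 - \<sigma> / 2))\<bar> \<le> \<kappa> * \<sigma> / 2"
  shows "\<exists>w\<in>SS. (\<forall>i. r * v i + \<kappa> * (1 - \<sigma>) \<le> w i \<and> w i \<le> r * v i + \<kappa>) \<and> (\<forall>i<k. x i = w i)"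
proof -
  define s where "s i = 1 - (x i - r * v i) / \<kappa>" for i
  have "0 \<le> s i \<and> s i \<le> \<sigma>" if "i < k" for i
  proof -
    have "x i - r * v i \<le> \<kappa>" "\<kappa> * (1 - \<sigma>) \<le> x i - r * v i"
      using abs_le_D1[OF x[OF that]] abs_le_D2[OF x[OF that]] by (simp_all add: field_simps)
    then have "(x i - r * v i) / \<kappa> \<le> 1" "1 - \<sigma> \<le> (x i - r * v i) / \<kappa>"
      using \<open>\<kappa> > 0\<close> by (simp_all add: divide_le_eq le_divide_eq mult.commute)
    then show ?thesis by (simp add: s_def)
  qed
  then obtain w where w: "w \<in> SS" "\<And>i. 1 - \<sigma> \<le> w i" "\<And>i. w i \<le> 1" "\<And>i. i < k \<Longrightarrow> w i = 1 - s i"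
    using cap[of s] by blast
  have "(\<lambda>i. r * v i + \<kappa> * w i) \<in> SS"
    using assms w(1) by (intro SS_comb) auto
  moreover have "x i = r * v i + \<kappa> * w i" if "i < k" for i
    using w(4)[OF that] \<open>\<kappa> > 0\<close> by (simp add: s_def)
  moreover have "r * v i + \<kappa> * (1 - \<sigma>) \<le> r * v i + \<kappa> * w i" "r * v i + \<kappa> * w i \<le> r * v i + \<kappa>" for i
    using w(2)[of i] w(3)[of i] \<open>\<kappa> > 0\<close> by (simp_all add: mult_left_le)
  ultimately show ?thesis by (intro bexI[of _ "\<lambda>i. r * v i + \<kappa> * w i"]) auto
qed

text \<open>Keller's theorem, as the case of a one-point base.\<close>

theorem S_iso_cube:
  assumes "0 \<le> a" "a < b"
  shows "\<exists>\<theta>. iso_onto (S a b) cube \<theta>"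
proof -
  define Y where "Y = {0::real}"
  define \<Gamma> where "\<Gamma> = Y \<times> S a b"
  interpret parametric_keller Y \<Gamma> b
  proof
    show "compact Y" by (simp add: Y_def)
    then show "compact \<Gamma>" unfolding \<Gamma>_def using compact_S[OF assms(1)] by (rule compact_Times)
    show "y \<in> Y" if "(y, v) \<in> \<Gamma>" for y v using that by (simp add: \<Gamma>_def)
    show "\<bar>v i\<bar> \<le> b" if "(y, v) \<in> \<Gamma>" for y v i
    proof -
      have "a \<le> v i" "v i \<le> b" using that by (auto simp: \<Gamma>_def S_def)
      then show ?thesis using assms(1) by linarith
    qed
    show "(y, \<lambda>i. (1 - t) * v i + t * w i) \<in> \<Gamma>" if "(y, v) \<in> \<Gamma>" "(y, w) \<in> \<Gamma>" "0 \<le> t" "t \<le> 1" for y v w t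
      using that S_comb by (simp add: \<Gamma>_def)
    show "\<exists>d>0. \<forall>y v y'. (y, v) \<in> \<Gamma> \<and> y' \<in> Y \<and> dist y' y < d \<longrightarrow> (\<exists>v'. (y', v') \<in> \<Gamma> \<and> (\<forall>i. \<bar>v' i - v i\<bar> \<le> e))"
      if "e > 0" for e
      using that by (intro exI[of _ 1]) (auto simp: \<Gamma>_def Y_def)
    show "\<exists>c s. continuous_on Y c \<and> s > 0 \<and> (\<forall>y w. y \<in> Y \<and> (\<forall>i<k. \<bar>w i - c y i\<bar> \<le> s) \<longrightarrow> cyl \<Gamma> k y w)" for k
    proof -
      \<comment> \<open>Caps of the ball of radius \<open>b\<close> with relative depth at most
        \<open>e\<close> leave the ball of radius \<open>a\<close> intact.\<close>
      define e where "e = (b - a) / b"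
      have "e > 0" using assms by (simp add: e_def)
      then obtain \<sigma> where \<sigma>: "\<sigma> > 0" "\<sigma> \<le> e" "\<sigma> < 1"
        and cap: "\<And>s. (\<And>i. i < k \<Longrightarrow> 0 \<le> s i \<and> s i \<le> \<sigma>) \<Longrightarrow>
          \<exists>w\<in>SS. (\<forall>i. 1 - \<sigma> \<le> w i \<and> w i \<le> 1) \<and> (\<forall>i<k. w i = 1 - s i)"
        using cut_caps[of e k] by metis
      have b0: "b > 0" using assms by simp
      have "b * \<sigma> \<le> b * e" using \<sigma> b0 by simp
      moreover have "b * e = b - a" using b0 by (simp add: e_def)
      ultimately have low: "a \<le> b * (1 - \<sigma>)" by (simp add: right_diff_distrib)
      have "cyl \<Gamma> k y x" if y: "y \<in> Y" and x: "\<And>i. i < k \<Longrightarrow> \<bar>x i - b * (1 - \<sigma> / 2)\<bar> \<le> b * \<sigma> / 2" for y x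
      proof -
        obtain w where w: "w \<in> SS" "\<And>i. b * (1 - \<sigma>) \<le> w i" "\<And>i. w i \<le> b" "\<And>i. i < k \<Longrightarrow> x i = w i"
          using SS_capped[OF SS_const[of 0] b0 _ cap, of 0 x] x by auto
        have "a \<le> w i" for i using w(2)[of i] low by linarith
        then have "(y, w) \<in> \<Gamma>" using y w by (simp add: \<Gamma>_def S_def)
        then show ?thesis unfolding cyl_def using w(4) by blast
      qed
      then show ?thesis
        using b0 \<sigma> by (intro exI[of _ "\<lambda>y i. b * (1 - \<sigma> / 2)"] exI[of _ "b * \<sigma> / 2"]) auto
    qed
  qed
  obtain f where f: "iso_onto \<Gamma> (Y \<times> cube) f" using trivial_bundle[of 1] by auto
  have 1: "iso_onto (S a b) \<Gamma> (\<lambda>v. (0, v))"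
    unfolding iso_onto_def \<Gamma>_def Y_def by (auto intro!: continuous_intros inj_onI)
  have 2: "iso_onto (Y \<times> cube) cube snd"
    unfolding iso_onto_def Y_def by (auto intro!: continuous_on_snd[OF continuous_on_id] inj_onI)
  show ?thesis using iso_onto_comp[OF iso_onto_comp[OF 1 f] 2] by blast
qed

end

section \<open>The thickened graph of raising the floor\<close>

locale floor_relation = dense_directions u for u :: "nat \<Rightarrow> 'a::euclidean_space" +
  fixes a a' b \<epsilon> :: real
  assumes ab: "0 \<le> a" "a < a'" "a' < b" and \<epsilon>: "0 < \<epsilon>"
begin

text \<open>The relation is a thickening of the graph of the map sending \<open>h\<close> to \<open>max h a'\<close>. That map has no
  continuous family of fibres, but as \<open>\<zeta>\<close> is increasing, the thickened fibres are convex in both directions;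
  the slope \<open>\<epsilon>\<close> of \<open>\<zeta>\<close> and the factor \<open>1 + \<epsilon>\<close> give the slack that makes them full-dimensional and
  continuous.\<close>

definition \<zeta> :: "real \<Rightarrow> real" where "\<zeta> q = max q a' + \<epsilon> * (1 + q)"

definition Rel :: "((nat \<Rightarrow> real) \<times> (nat \<Rightarrow> real)) set" where
  "Rel = {p. fst p \<in> S a' b \<and> snd p \<in> S a b \<and> (\<forall>i. snd p i \<le> (1 + \<epsilon>) * fst p i \<and> fst p i \<le> \<zeta> (snd p i))}"

lemma Rel_iff: "(y, h) \<in> Rel \<longleftrightarrow> y \<in> S a' b \<and> h \<in> S a b \<and> (\<forall>i. h i \<le> (1 + \<epsilon>) * y i \<and> y i \<le> \<zeta> (h i))"
  by (simp add: Rel_def)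

lemma S_bounds: "v \<in> S c d \<Longrightarrow> c \<le> v i" "v \<in> S c d \<Longrightarrow> v i \<le> d"
  by (auto simp: S_def)

lemma S_abs: "0 \<le> c \<Longrightarrow> v \<in> S c d \<Longrightarrow> \<bar>v i\<bar> \<le> d"
  using S_bounds[of v c d i] by linarith

lemma S_subset_S: "S a' b \<subseteq> S a b"
  using ab by (auto simp: S_def intro: order_trans[of a a'])

lemma max_in_S: "h \<in> S a b \<Longrightarrow> (\<lambda>i. max (h i) a') \<in> S a' b"
  using SS_max[of h "\<lambda>i. a'"] SS_const[of a'] ab by (auto simp: S_def)

lemma \<zeta>_mono: "p \<le> q \<Longrightarrow> \<zeta> p + \<epsilon> * (q - p) \<le> \<zeta> q"
  unfolding \<zeta>_def by (simp add: algebra_simps max_def)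

lemma \<zeta>_ge: "0 \<le> q \<Longrightarrow> q + \<epsilon> \<le> \<zeta> q" "0 \<le> q \<Longrightarrow> max q a' + \<epsilon> * (1 + q) \<le> \<zeta> q"
proof -
  assume "0 \<le> q"
  then have "0 \<le> \<epsilon> * q" using \<epsilon> by simp
  then show "q + \<epsilon> \<le> \<zeta> q" using max.cobounded1[of q a'] unfolding \<zeta>_def distrib_left by linarith
qed (simp add: \<zeta>_def)

lemma \<zeta>_lip: "p \<le> q \<Longrightarrow> \<zeta> q \<le> \<zeta> p + (1 + \<epsilon>) * (q - p)"
  unfolding \<zeta>_def by (simp add: algebra_simps max_def)

lemma compact_Rel: "compact Rel"
proof -
  have "closed {p :: (nat \<Rightarrow> real) \<times> (nat \<Rightarrow> real). snd p i \<le> (1 + \<epsilon>) * fst p i}" for i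
    by (intro closed_Collect_le continuous_on_mult continuous_on_const continuous_on_fst_coord continuous_on_snd_coord)
  moreover have "closed {p :: (nat \<Rightarrow> real) \<times> (nat \<Rightarrow> real). fst p i \<le> \<zeta> (snd p i)}" for i
    unfolding \<zeta>_def
    by (intro closed_Collect_le continuous_on_mult continuous_on_add continuous_on_max continuous_on_const
        continuous_on_fst_coord continuous_on_snd_coord)
  ultimately have "closed {p :: (nat \<Rightarrow> real) \<times> (nat \<Rightarrow> real). \<forall>i. snd p i \<le> (1 + \<epsilon>) * fst p i \<and> fst p i \<le> \<zeta> (snd p i)}"
    by (intro closed_Collect_all closed_Collect_conj)
  moreover have "compact (S a' b \<times> S a b)" using ab by (intro compact_Times compact_S) auto
  ultimately have "compact ((S a' b \<times> S a b) \<inter> {p. \<forall>i. snd p i \<le> (1 + \<epsilon>) * fst p i \<and> fst p i \<le> \<zeta> (snd p i)})"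
    by (rule compact_Int_closed[rotated])
  moreover have "(S a' b \<times> S a b) \<inter> {p. \<forall>i. snd p i \<le> (1 + \<epsilon>) * fst p i \<and> fst p i \<le> \<zeta> (snd p i)} = Rel"
    by (auto simp: Rel_def)
  ultimately show ?thesis by simp
qed

text \<open>By \<open>S_uniform\<close>, lower semicontinuity may be checked for perturbations of
  the base point that are small in the supremum distance, where the inequalities defining
  \<open>Rel\<close> are easy to handle.\<close>

lemma uniformly_lsc_transfer:
  assumes "e > 0" "c \<le> b" "0 \<le> c'" 
    and P: "\<And>\<eta>. \<eta> > 0 \<Longrightarrow> \<exists>\<eta>'>0. \<forall>y v y'. (y, v) \<in> \<Gamma> \<and> y' \<in> S c' b \<and> (\<forall>i. \<bar>y' i - y i\<bar> \<le> \<eta>') \<longrightarrow>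
       (\<exists>v'. (y', v') \<in> \<Gamma> \<and> (\<forall>i. \<bar>v' i - v i\<bar> \<le> \<eta>))"
    and sub: "\<And>y v. (y, v) \<in> \<Gamma> \<Longrightarrow> y \<in> S c' b"
  shows "\<exists>d>0. \<forall>y v y'. (y, v) \<in> \<Gamma> \<and> y' \<in> S c' b \<and> dist y' y < d \<longrightarrow>
     (\<exists>v'. (y', v') \<in> \<Gamma> \<and> (\<forall>i. \<bar>v' i - v i\<bar> \<le> e))"
proof -
  obtain \<eta>' where \<eta>': "\<eta>' > 0" "\<And>y v y'. (y, v) \<in> \<Gamma> \<Longrightarrow> y' \<in> S c' b \<Longrightarrow> (\<And>i. \<bar>y' i - y i\<bar> \<le> \<eta>') \<Longrightarrow>
       (\<exists>v'. (y', v') \<in> \<Gamma> \<and> (\<forall>i. \<bar>v' i - v i\<bar> \<le> e))" using P[OF assms(1)] by blast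
  obtain d where d: "d > 0" "\<And>v w i. v \<in> S 0 b \<Longrightarrow> w \<in> S 0 b \<Longrightarrow> dist v w < d \<Longrightarrow> \<bar>v i - w i\<bar> \<le> \<eta>'"
    using S_uniform[of b \<eta>'] ab \<eta>'(1) by force
  have "\<exists>v'. (y', v') \<in> \<Gamma> \<and> (\<forall>i. \<bar>v' i - v i\<bar> \<le> e)" if "(y, v) \<in> \<Gamma>" "y' \<in> S c' b" "dist y' y < d" for y v y'
    using \<eta>'(2)[OF that(1,2)] d(2)[OF _ _ that(3)] sub[OF that(1)] that(2) S_subset[OF assms(3), of b] by blast
  with d(1) show ?thesis by blast
qed

lemma lower_bundle: "parametric_keller (S a' b) Rel b"
proof
  show "compact (S a' b)" using ab by (intro compact_S) simp
  show "compact Rel" by (rule compact_Rel)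
  show "y \<in> S a' b" if "(y, v) \<in> Rel" for y v using that by (simp add: Rel_iff)
  show "\<bar>v i\<bar> \<le> b" if "(y, v) \<in> Rel" for y v i using that S_abs[of a v b i] ab by (simp add: Rel_iff)
next
  fix y v w and t :: real assume vw: "(y, v) \<in> Rel" "(y, w) \<in> Rel" and t: "0 \<le> t" "t \<le> 1"
  let ?z = "\<lambda>i. (1 - t) * v i + t * w i"
  have "?z i \<le> (1 + \<epsilon>) * y i" for i
    by (rule convex_bound_le) (use vw t in \<open>auto simp: Rel_iff\<close>)
  moreover have "y i \<le> \<zeta> (?z i)" for i
  proof -
    have "min (v i) (w i) \<le> ?z i"
    proof -
      have "(1 - t) * min (v i) (w i) + t * min (v i) (w i) \<le> ?z i"
        using t by (intro add_mono mult_left_mono) auto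
      then show ?thesis by (simp add: algebra_simps)
    qed
    then have "\<zeta> (min (v i) (w i)) \<le> \<zeta> (?z i)" using \<zeta>_mono[of "min (v i) (w i)" "?z i"] \<epsilon> by (smt (verit) mult_nonneg_nonneg)
    moreover have "y i \<le> \<zeta> (min (v i) (w i))" using vw by (simp add: Rel_iff min_def)
    ultimately show ?thesis by linarith
  qed
  ultimately show "(y, ?z) \<in> Rel" using vw S_comb[OF _ _ t] by (simp add: Rel_iff)
next
  fix e :: real assume "e > 0"
  show "\<exists>d>0. \<forall>y v y'. (y, v) \<in> Rel \<and> y' \<in> S a' b \<and> dist y' y < d \<longrightarrow>
     (\<exists>v'. (y', v') \<in> Rel \<and> (\<forall>i. \<bar>v' i - v i\<bar> \<le> e))"
  proof (rule uniformly_lsc_transfer[OF \<open>e > 0\<close> order_refl])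
    fix e :: real assume e: "e > 0"
    define t where "t = min 1 (e / b)"
    have t: "0 < t" "t \<le> 1" "t * b \<le> e" using e ab by (auto simp: t_def min_def divide_le_eq)
    \<comment> \<open>The witness moves \<open>h\<close> by the fraction \<open>t\<close> towards
      \<open>y\<close>. This yields slack \<open>t * \<epsilon> * a'\<close> in
      \<open>h \<le> (1 + \<epsilon>) * y\<close>, because \<open>y \<ge> a'\<close>. In
      \<open>y \<le> \<zeta> h\<close> the slack is \<open>\<epsilon> / 2\<close> if
      \<open>y - h \<le> \<epsilon> / 2\<close>, by \<open>\<zeta>_ge\<close>; otherwise
      \<open>h\<close> has risen by \<open>t * \<epsilon> / 2\<close> and \<open>\<zeta>\<close> has
      slope at least \<open>\<epsilon>\<close>. The three bounds on \<open>\<eta>\<close> match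
      these three slacks.\<close>
    define \<eta> where "\<eta> = min (t * \<epsilon> * a' / (1 + \<epsilon>)) (min (\<epsilon> / 2) (\<epsilon> * t * \<epsilon> / 2))"
    have \<eta>: "\<eta> > 0" using t \<epsilon> ab by (simp add: \<eta>_def)
    have "\<eta> \<le> t * \<epsilon> * a' / (1 + \<epsilon>)" by (simp add: \<eta>_def)
    then have \<eta>1: "(1 + \<epsilon>) * \<eta> \<le> t * \<epsilon> * a'" using \<epsilon> by (simp add: le_divide_eq mult.commute)
    have \<eta>2: "\<eta> \<le> \<epsilon> / 2" "\<eta> \<le> \<epsilon> * t * \<epsilon> / 2"
      unfolding \<eta>_def by (rule min.coboundedI2[OF min.cobounded1], rule min.coboundedI2[OF min.cobounded2])
    have "\<exists>v'. (y', v') \<in> Rel \<and> (\<forall>i. \<bar>v' i - h i\<bar> \<le> e)"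
      if yh: "(y, h) \<in> Rel" and y': "y' \<in> S a' b" and close: "\<forall>i. \<bar>y' i - y i\<bar> \<le> \<eta>" for y h y'
    proof (intro exI conjI allI)
      let ?h = "\<lambda>i. (1 - t) * h i + t * y i"
      have yS: "y \<in> S a' b" "h \<in> S a b" and r1: "\<And>i. h i \<le> (1 + \<epsilon>) * y i" and r2: "\<And>i. y i \<le> \<zeta> (h i)"
        using yh by (auto simp: Rel_iff)
      have "?h \<in> S a b" using S_comb[of h a b y t] yS S_subset_S t by auto
      moreover have "?h i \<le> (1 + \<epsilon>) * y' i" for i
      proof -
        have "a' \<le> y i" using yS(1) by (rule S_bounds)
        have "?h i \<le> (1 - t) * ((1 + \<epsilon>) * y i) + t * y i"
          using r1[of i] t by (intro add_mono mult_left_mono) auto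
        also have "\<dots> = (1 + \<epsilon>) * y i - t * \<epsilon> * y i" by (simp add: algebra_simps)
        also have "\<dots> \<le> (1 + \<epsilon>) * y i - t * \<epsilon> * a'" using \<open>a' \<le> y i\<close> t \<epsilon> by (simp add: mult_left_mono)
        also have "\<dots> \<le> (1 + \<epsilon>) * (y i - \<eta>)" using \<eta>1 by (simp add: algebra_simps)
        also have "\<dots> \<le> (1 + \<epsilon>) * y' i" using close[rule_format, of i] \<epsilon> by (intro mult_left_mono) auto
        finally show ?thesis .
      qed
      moreover have "y' i \<le> \<zeta> (?h i)" for i
      proof -
        have h0: "0 \<le> h i" using S_bounds(1)[OF yS(2), of i] ab by linarith
        have eq: "?h i = h i + t * (y i - h i)" by (simp add: algebra_simps)
        have "y i + \<eta> \<le> \<zeta> (?h i)"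
        proof (cases "y i - h i \<le> \<epsilon> / 2")
          case True
          have "y i - \<epsilon> / 2 \<le> ?h i"
          proof -
            have "(1 - t) * (y i - \<epsilon>/2) + t * (y i - \<epsilon>/2) \<le> ?h i"
              using True t \<epsilon> by (intro add_mono mult_left_mono) auto
            moreover have "(1 - t) * X + t * X = X" for X :: real by (simp add: left_diff_distrib)
            ultimately show ?thesis by metis
          qed
          moreover have "0 \<le> ?h i" using h0 S_bounds(1)[OF yS(1), of i] ab t by simp
          ultimately show ?thesis using \<zeta>_ge(1)[of "?h i"] \<eta>2(1) by linarith
        next
          case False
          then have "t * (\<epsilon> / 2) \<le> t * (y i - h i)" using t by (intro mult_left_mono) auto
          then have le: "t * (\<epsilon> / 2) \<le> ?h i - h i" using eq by simp
          moreover have "0 \<le> t * (\<epsilon> / 2)" using t \<epsilon> by simp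
          ultimately have "h i \<le> ?h i" by linarith
          then have "\<zeta> (h i) + \<epsilon> * (?h i - h i) \<le> \<zeta> (?h i)" by (rule \<zeta>_mono)
          moreover have "\<epsilon> * (t * (\<epsilon> / 2)) \<le> \<epsilon> * (?h i - h i)" using le \<epsilon> by (intro mult_left_mono) auto
          moreover have "\<eta> \<le> \<epsilon> * (t * (\<epsilon> / 2))" using \<eta>2(2) by (simp add: mult.assoc)
          ultimately show ?thesis using r2[of i] by linarith
        qed
        then show ?thesis using close[rule_format, of i] by linarith
      qed
      ultimately show "(y', ?h) \<in> Rel" using y' by (simp add: Rel_iff)
      fix i
      have "\<bar>?h i - h i\<bar> = t * \<bar>y i - h i\<bar>"
      proof -
        have "?h i - h i = t * (y i - h i)" by (simp add: algebra_simps)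
        then show ?thesis using t by (simp add: abs_mult)
      qed
      also have "\<dots> \<le> t * b"
        using t S_bounds[OF yS(1), of i] S_bounds[OF yS(2), of i] ab by (intro mult_left_mono) auto
      finally show "\<bar>?h i - h i\<bar> \<le> e" using t(3) by linarith
    qed
    then show "\<exists>\<eta>'>0. \<forall>y v y'. (y, v) \<in> Rel \<and> y' \<in> S a' b \<and> (\<forall>i. \<bar>y' i - y i\<bar> \<le> \<eta>') \<longrightarrow>
       (\<exists>v'. (y', v') \<in> Rel \<and> (\<forall>i. \<bar>v' i - v i\<bar> \<le> e))"
      using \<eta> by blast
  next
    show "0 \<le> a'" using ab by simp
    show "y \<in> S a' b" if "(y, v) \<in> Rel" for y v using that by (simp add: Rel_iff)
  qed
next
  fix k
  \<comment> \<open>The box consists of \<open>h\<close> between \<open>(1 - r) * y\<close> and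
    \<open>y\<close>: the added ball has radius \<open>\<kappa> = r * a' \<le> r * y\<close>. Then
    \<open>r * b \<le> \<epsilon>\<close> gives
    \<open>y \<le> h + \<epsilon> \<le> \<zeta> h\<close>, and \<open>r * a' \<le> a' - a\<close>
    keeps \<open>h\<close> above \<open>a\<close>.\<close>
  define r where "r = min (1/2) (min (\<epsilon> / b) ((a' - a) / a'))"
  have r: "0 < r" "r \<le> 1/2" "r * b \<le> \<epsilon>" "r * a' \<le> a' - a"
  proof -
    show "0 < r" using \<epsilon> ab by (simp add: r_def)
    show "r \<le> 1/2" unfolding r_def by (rule min.cobounded1)
    have "r \<le> \<epsilon> / b" "r \<le> (a' - a) / a'"
      unfolding r_def by (rule min.coboundedI2[OF min.cobounded1], rule min.coboundedI2[OF min.cobounded2])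
    then show "r * b \<le> \<epsilon>" "r * a' \<le> a' - a" using ab by (simp_all add: le_divide_eq)
  qed
  define \<kappa> where "\<kappa> = r * a'"
  have \<kappa>: "\<kappa> > 0" using r ab by (simp add: \<kappa>_def)
  obtain \<sigma> where \<sigma>: "\<sigma> > 0" "\<sigma> < 1"
    and cap: "\<And>s. (\<And>i. i < k \<Longrightarrow> 0 \<le> s i \<and> s i \<le> \<sigma>) \<Longrightarrow>
      \<exists>w\<in>SS. (\<forall>i. 1 - \<sigma> \<le> w i \<and> w i \<le> 1) \<and> (\<forall>i<k. w i = 1 - s i)"
    using cut_caps[of 1 k] by (metis zero_less_one)
  define c where "c = (\<lambda>(y :: nat \<Rightarrow> real) i :: nat. (1 - r) * y i + \<kappa> * (1 - \<sigma> / 2) :: real)"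
  have "cyl Rel k y x" if y: "y \<in> S a' b" and x: "\<And>i. i < k \<Longrightarrow> \<bar>x i - c y i\<bar> \<le> \<kappa> * \<sigma> / 2" for y x
  proof -
    obtain h where h: "h \<in> SS" "\<And>i. (1 - r) * y i + \<kappa> * (1 - \<sigma>) \<le> h i" "\<And>i. h i \<le> (1 - r) * y i + \<kappa>"
      "\<And>i. i < k \<Longrightarrow> x i = h i"
      using SS_capped[of y \<kappa> "1 - r", OF _ \<kappa> _ cap, of x] x y r by (auto simp: c_def S_def)
    have yb: "a' \<le> y i" "y i \<le> b" for i using S_bounds[OF y, of i] by auto
    have up: "h i \<le> y i" for i
    proof -
      have "r * a' \<le> r * y i" using yb(1)[of i] r by (intro mult_left_mono) auto
      then show ?thesis using h(3)[of i] by (simp add: \<kappa>_def algebra_simps)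
    qed
    have low: "(1 - r) * y i \<le> h i" for i
    proof -
      have "0 \<le> \<kappa> * (1 - \<sigma>)" using \<kappa> \<sigma> by simp
      then show ?thesis using h(2)[of i] by linarith
    qed
    have "a \<le> h i" for i
    proof -
      have "(1 - r) * a' \<le> (1 - r) * y i" using yb(1)[of i] r by (intro mult_left_mono) auto
      then show ?thesis using low[of i] r(4) by (simp add: algebra_simps)
    qed
    moreover have "h i \<le> b" for i using up[of i] yb(2)[of i] by linarith
    moreover have "h i \<le> (1 + \<epsilon>) * y i" for i
    proof -
      have "0 \<le> \<epsilon> * y i" using \<epsilon> yb(1)[of i] ab by simp
      then show ?thesis using up[of i] by (simp add: algebra_simps)
    qed
    moreover have "y i \<le> \<zeta> (h i)" for i
    proof -
      have "0 \<le> h i" using \<open>\<And>i. a \<le> h i\<close>[of i] ab by linarith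
      moreover have "r * y i \<le> r * b" using yb(2)[of i] r by (intro mult_left_mono) auto
      ultimately show ?thesis using \<zeta>_ge(1)[of "h i"] low[of i] r(3) by (simp add: algebra_simps)
    qed
    ultimately have "(y, h) \<in> Rel" using y h(1) by (simp add: Rel_iff S_def)
    then show ?thesis unfolding cyl_def using h(4) by blast
  qed
  moreover have "continuous_on (S a' b) c"
    unfolding c_def by (intro continuous_on_coordinatewise_then_product continuous_on_add continuous_on_mult
        continuous_on_const continuous_on_coord[OF continuous_on_id])
  ultimately show "\<exists>c s. continuous_on (S a' b) c \<and> s > 0 \<and>
     (\<forall>y w. y \<in> S a' b \<and> (\<forall>i<k. \<bar>w i - c y i\<bar> \<le> s) \<longrightarrow> cyl Rel k y w)"
    using \<kappa> \<sigma> by (intro exI[of _ c] exI[of _ "\<kappa> * \<sigma> / 2"]) auto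
qed

lemma swap_Rel_iff: "(h, y) \<in> prod.swap ` Rel \<longleftrightarrow> (y, h) \<in> Rel"
  unfolding image_iff by (auto intro: bexI[of _ "(y, h)"])

lemma upper_bundle: "parametric_keller (S a b) (prod.swap ` Rel) b"
proof
  show "compact (S a b)" using ab by (intro compact_S) simp
  show "compact (prod.swap ` Rel)"
    by (rule compact_continuous_image[OF continuous_on_swap compact_Rel])
  show "h \<in> S a b" if "(h, y) \<in> prod.swap ` Rel" for h y using that unfolding swap_Rel_iff by (simp add: Rel_iff)
  show "\<bar>y i\<bar> \<le> b" if "(h, y) \<in> prod.swap ` Rel" for h y i
    using that S_abs[of a' y b i] ab unfolding swap_Rel_iff by (simp add: Rel_iff)
next
  fix h v w and t :: real assume vw: "(h, v) \<in> prod.swap ` Rel" "(h, w) \<in> prod.swap ` Rel" and t: "0 \<le> t" "t \<le> 1"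
  let ?z = "\<lambda>i. (1 - t) * v i + t * w i"
  have vw': "(v, h) \<in> Rel" "(w, h) \<in> Rel" using vw unfolding swap_Rel_iff .
  have "h i \<le> (1 + \<epsilon>) * ?z i" for i
  proof -
    have "(1 - t) * h i + t * h i \<le> (1 - t) * ((1 + \<epsilon>) * v i) + t * ((1 + \<epsilon>) * w i)"
      using vw' t by (intro add_mono mult_left_mono) (auto simp: Rel_iff)
    then show ?thesis by (simp add: algebra_simps)
  qed
  moreover have "?z i \<le> \<zeta> (h i)" for i
    by (rule convex_bound_le) (use vw' t in \<open>auto simp: Rel_iff\<close>)
  ultimately show "(h, ?z) \<in> prod.swap ` Rel"
    using vw' S_comb[OF _ _ t] unfolding swap_Rel_iff by (simp add: Rel_iff)
next
  fix e :: real assume "e > 0"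
  show "\<exists>d>0. \<forall>y v y'. (y, v) \<in> prod.swap ` Rel \<and> y' \<in> S a b \<and> dist y' y < d \<longrightarrow>
     (\<exists>v'. (y', v') \<in> prod.swap ` Rel \<and> (\<forall>i. \<bar>v' i - v i\<bar> \<le> e))"
  proof (rule uniformly_lsc_transfer[OF \<open>e > 0\<close> order_refl])
    fix e :: real assume e: "e > 0"
    define t where "t = min 1 (e / b)"
    have t: "0 < t" "t \<le> 1" "t * b \<le> e" using e ab by (auto simp: t_def min_def divide_le_eq)
    \<comment> \<open>Here \<open>y\<close> moves towards \<open>m = max h a'\<close>, which
      satisfies both inequalities strictly, with slack \<open>\<epsilon> * a'\<close> and
      \<open>\<epsilon>\<close>. Changing \<open>h\<close> by \<open>\<eta>\<close> changes
      \<open>\<zeta> h\<close> by at most \<open>(1 + \<epsilon>) * \<eta>\<close>.\<close>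
    define \<eta> where "\<eta> = min (t * \<epsilon> * a') (t * \<epsilon> / (1 + \<epsilon>))"
    have \<eta>: "\<eta> > 0" "\<eta> \<le> t * \<epsilon> * a'" using t \<epsilon> ab by (auto simp: \<eta>_def)
    have "\<eta> \<le> t * \<epsilon> / (1 + \<epsilon>)" by (simp add: \<eta>_def)
    then have \<eta>1: "(1 + \<epsilon>) * \<eta> \<le> t * \<epsilon>" using \<epsilon> by (simp add: le_divide_eq mult.commute)
    have "\<exists>v'. (h', v') \<in> prod.swap ` Rel \<and> (\<forall>i. \<bar>v' i - y i\<bar> \<le> e)"
      if hy: "(h, y) \<in> prod.swap ` Rel" and h': "h' \<in> S a b" and close: "\<forall>i. \<bar>h' i - h i\<bar> \<le> \<eta>" for y h h'
    proof (intro exI conjI allI)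
      define m where "m i = max (h i) a'" for i
      let ?y = "\<lambda>i. (1 - t) * y i + t * m i"
      have yS: "y \<in> S a' b" "h \<in> S a b" and r1: "\<And>i. h i \<le> (1 + \<epsilon>) * y i" and r2: "\<And>i. y i \<le> \<zeta> (h i)"
        using hy unfolding swap_Rel_iff by (auto simp: Rel_iff)
      have mS: "m \<in> S a' b" unfolding m_def[abs_def] by (rule max_in_S[OF yS(2)])
      have "?y \<in> S a' b" using S_comb[OF yS(1) mS, of t] t by simp
      moreover have "h' i \<le> (1 + \<epsilon>) * ?y i" for i
      proof -
        have "h i + \<epsilon> * a' \<le> (1 + \<epsilon>) * m i"
        proof -
          have "h i \<le> m i" "a' \<le> m i" by (auto simp: m_def)
          moreover have "\<epsilon> * a' \<le> \<epsilon> * m i" using \<epsilon> \<open>a' \<le> m i\<close> by simp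
          ultimately show ?thesis by (simp add: algebra_simps)
        qed
        then have "(1 - t) * h i + t * (h i + \<epsilon> * a') \<le> (1 - t) * ((1 + \<epsilon>) * y i) + t * ((1 + \<epsilon>) * m i)"
          using r1[of i] t by (intro add_mono mult_left_mono) auto
        then have "h i + t * \<epsilon> * a' \<le> (1 + \<epsilon>) * ?y i" by (simp add: algebra_simps)
        then show ?thesis using close[rule_format, of i] \<eta>(2) by linarith
      qed
      moreover have "?y i \<le> \<zeta> (h' i)" for i
      proof -
        have h0: "0 \<le> h i" using S_bounds(1)[OF yS(2), of i] ab by linarith
        have "m i + \<epsilon> \<le> \<zeta> (h i)"
        proof -
          have "0 \<le> \<epsilon> * h i" using h0 \<epsilon> by simp
          then show ?thesis using \<zeta>_ge(2)[OF h0] by (simp add: m_def algebra_simps)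
        qed
        then have "(1 - t) * y i + t * (m i + \<epsilon>) \<le> (1 - t) * \<zeta> (h i) + t * \<zeta> (h i)"
          using r2[of i] t by (intro add_mono mult_left_mono) auto
        then have 1: "?y i + t * \<epsilon> \<le> \<zeta> (h i)" by (simp add: algebra_simps)
        have "\<zeta> (h i) \<le> \<zeta> (h' i) + (1 + \<epsilon>) * \<eta>"
        proof (cases "h i \<le> h' i")
          case True
          have "0 \<le> \<epsilon> * (h' i - h i)" "0 \<le> (1 + \<epsilon>) * \<eta>" using True \<epsilon> \<eta> by simp_all
          then show ?thesis using \<zeta>_mono[OF True] by linarith
        next
          case False
          then have "\<zeta> (h i) \<le> \<zeta> (h' i) + (1 + \<epsilon>) * (h i - h' i)" by (intro \<zeta>_lip) simp
          also have "(1 + \<epsilon>) * (h i - h' i) \<le> (1 + \<epsilon>) * \<eta>"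
            using close[rule_format, of i] \<epsilon> by (intro mult_left_mono) auto
          finally show ?thesis by simp
        qed
        with 1 \<eta>1 show ?thesis by linarith
      qed
      ultimately show "(h', ?y) \<in> prod.swap ` Rel" using h' unfolding swap_Rel_iff by (simp add: Rel_iff)
      fix i
      have "\<bar>?y i - y i\<bar> = t * \<bar>m i - y i\<bar>"
      proof -
        have "?y i - y i = t * (m i - y i)" by (simp add: algebra_simps)
        then show ?thesis using t by (simp add: abs_mult)
      qed
      also have "\<dots> \<le> t * b"
        using t S_bounds[OF yS(1), of i] S_bounds[OF mS, of i] ab by (intro mult_left_mono) auto
      finally show "\<bar>?y i - y i\<bar> \<le> e" using t(3) by linarith
    qed
    then show "\<exists>\<eta>'>0. \<forall>y v y'. (y, v) \<in> prod.swap ` Rel \<and> y' \<in> S a b \<and> (\<forall>i. \<bar>y' i - y i\<bar> \<le> \<eta>') \<longrightarrow>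
       (\<exists>v'. (y', v') \<in> prod.swap ` Rel \<and> (\<forall>i. \<bar>v' i - v i\<bar> \<le> e))"
      using \<eta> by blast
  next
    show "0 \<le> a" using ab by simp
    show "h \<in> S a b" if "(h, y) \<in> prod.swap ` Rel" for h y using that unfolding swap_Rel_iff by (simp add: Rel_iff)
  qed
next
  fix k
  \<comment> \<open>The box consists of \<open>y\<close> near \<open>(1 - r) * m\<close> plus a
    capped ball of radius \<open>\<kappa>\<close>. The first bound gives
    \<open>(1 + \<epsilon>) * (1 - r) \<ge> 1\<close>, hence
    \<open>h \<le> (1 + \<epsilon>) * y\<close>; the second gives
    \<open>y \<le> m + \<epsilon>\<close>. Taking the midpoint of \<open>a'\<close> and
    \<open>b\<close> in \<open>\<kappa>\<close> keeps \<open>y\<close> below \<open>b\<close> and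
    leaves room for caps above \<open>a'\<close>, of relative depth up to the \<open>e\<close>
    below.\<close>
  define r where "r = min (\<epsilon> / (1 + \<epsilon>)) (\<epsilon> / b)"
  have r: "0 < r" "r < 1" "r * b \<le> \<epsilon>" "1 \<le> (1 + \<epsilon>) * (1 - r)"
  proof -
    show "0 < r" using \<epsilon> ab by (simp add: r_def)
    have le: "r \<le> \<epsilon> / (1 + \<epsilon>)" "r \<le> \<epsilon> / b" by (auto simp: r_def)
    then show "r * b \<le> \<epsilon>" using ab by (simp add: le_divide_eq)
    have "\<epsilon> / (1 + \<epsilon>) < 1" using \<epsilon> by simp
    then show "r < 1" using le by linarith
    have "r * (1 + \<epsilon>) \<le> \<epsilon>" using le(1) \<epsilon> by (simp add: le_divide_eq)
    then show "1 \<le> (1 + \<epsilon>) * (1 - r)" by (simp add: algebra_simps)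
  qed
  define \<kappa> where "\<kappa> = r * ((a' + b) / 2)"
  have \<kappa>: "\<kappa> > 0" "\<kappa> \<le> r * b" using r ab by (auto simp: \<kappa>_def intro!: mult_left_mono)
  define e where "e = (b - a') / (a' + b)"
  have "e > 0" using ab by (simp add: e_def)
  then obtain \<sigma> where \<sigma>: "\<sigma> > 0" "\<sigma> < 1" "\<sigma> \<le> e"
    and cap: "\<And>s. (\<And>i. i < k \<Longrightarrow> 0 \<le> s i \<and> s i \<le> \<sigma>) \<Longrightarrow>
      \<exists>w\<in>SS. (\<forall>i. 1 - \<sigma> \<le> w i \<and> w i \<le> 1) \<and> (\<forall>i<k. w i = 1 - s i)"
    using cut_caps[of e k] by metis
  have \<kappa>\<sigma>: "r * a' \<le> \<kappa> * (1 - \<sigma>)"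
  proof -
    have "\<sigma> * (a' + b) \<le> b - a'" using \<sigma>(3) ab by (simp add: e_def le_divide_eq)
    then have "a' \<le> (a' + b) / 2 * (1 - \<sigma>)" by (simp add: field_simps)
    then have "r * a' \<le> r * ((a' + b) / 2 * (1 - \<sigma>))" using r by (intro mult_left_mono) auto
    then show ?thesis by (simp add: \<kappa>_def mult.assoc)
  qed
  define c where "c = (\<lambda>(h :: nat \<Rightarrow> real) i :: nat. (1 - r) * max (h i) a' + \<kappa> * (1 - \<sigma> / 2) :: real)"
  have "cyl (prod.swap ` Rel) k h x" if h: "h \<in> S a b" and x: "\<And>i. i < k \<Longrightarrow> \<bar>x i - c h i\<bar> \<le> \<kappa> * \<sigma> / 2" for h x
  proof -
    define m where "m i = max (h i) a'" for i
    have mS: "m \<in> S a' b" unfolding m_def[abs_def] by (rule max_in_S[OF h])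
    obtain y where y: "y \<in> SS" "\<And>i. (1 - r) * m i + \<kappa> * (1 - \<sigma>) \<le> y i" "\<And>i. y i \<le> (1 - r) * m i + \<kappa>"
      "\<And>i. i < k \<Longrightarrow> x i = y i"
      using SS_capped[of m \<kappa> "1 - r", OF _ \<kappa>(1) _ cap, of x] x mS r by (auto simp: c_def S_def m_def)
    have mb: "a' \<le> m i" "m i \<le> b" "h i \<le> m i" for i using S_bounds[OF mS, of i] by (auto simp: m_def)
    have "a' \<le> y i" for i
    proof -
      have "(1 - r) * a' \<le> (1 - r) * m i" using mb(1)[of i] r by (intro mult_left_mono) auto
      then show ?thesis using y(2)[of i] \<kappa>\<sigma> by (simp add: algebra_simps)
    qed
    moreover have "y i \<le> b" for i
    proof -
      have "(1 - r) * m i \<le> (1 - r) * b" using mb(2)[of i] r by (intro mult_left_mono) auto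
      then show ?thesis using y(3)[of i] \<kappa>(2) by (simp add: algebra_simps)
    qed
    moreover have "h i \<le> (1 + \<epsilon>) * y i" for i
    proof -
      have "0 \<le> \<kappa> * (1 - \<sigma>)" using \<kappa> \<sigma> by simp
      then have "(1 - r) * m i \<le> y i" using y(2)[of i] by linarith
      then have "(1 + \<epsilon>) * ((1 - r) * m i) \<le> (1 + \<epsilon>) * y i" using \<epsilon> by (intro mult_left_mono) auto
      moreover have "1 * m i \<le> ((1 + \<epsilon>) * (1 - r)) * m i"
        using r(4) mb(1)[of i] ab by (intro mult_right_mono) auto
      ultimately show ?thesis using mb(3)[of i] by (simp add: mult.assoc)
    qed
    moreover have "y i \<le> \<zeta> (h i)" for i
    proof -
      have h0: "0 \<le> h i" using S_bounds(1)[OF h, of i] ab by linarith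
      have "0 \<le> r * m i" using r mb(1)[of i] ab by simp
      then have "y i \<le> m i + \<epsilon>" using y(3)[of i] \<kappa>(2) r(3) by (simp add: algebra_simps)
      moreover have "0 \<le> \<epsilon> * h i" using h0 \<epsilon> by simp
      ultimately show ?thesis using \<zeta>_ge(2)[OF h0] by (simp add: m_def algebra_simps)
    qed
    ultimately have "(h, y) \<in> prod.swap ` Rel" using h y(1) unfolding swap_Rel_iff by (simp add: Rel_iff S_def)
    then show ?thesis unfolding cyl_def using y(4) by blast
  qed
  moreover have "continuous_on (S a b) c"
    unfolding c_def by (intro continuous_on_coordinatewise_then_product continuous_on_add continuous_on_mult continuous_on_max
        continuous_on_const continuous_on_coord[OF continuous_on_id])
  ultimately show "\<exists>c s. continuous_on (S a b) c \<and> s > 0 \<and>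
     (\<forall>y w. y \<in> S a b \<and> (\<forall>i<k. \<bar>w i - c y i\<bar> \<le> s) \<longrightarrow> cyl (prod.swap ` Rel) k y w)"
    using \<kappa> \<sigma> by (intro exI[of _ c] exI[of _ "\<kappa> * \<sigma> / 2"]) auto
qed

text \<open>\<open>y \<le> \<zeta> h\<close> bounds \<open>y\<close> from above, while
  \<open>a' \<le> y\<close> and \<open>h \<le> (1 + \<epsilon>) * y\<close> bound it from
  below.\<close>

lemma Rel_near_floor:
  assumes "(y, h) \<in> Rel" shows "\<bar>y i - max (h i) a'\<bar> \<le> \<epsilon> * (1 + b)"
proof -
  have yS: "y \<in> S a' b" "h \<in> S a b" and r1: "h i \<le> (1 + \<epsilon>) * y i" and r2: "y i \<le> \<zeta> (h i)"
    using assms by (auto simp: Rel_iff)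
  have "\<epsilon> * (1 + h i) \<le> \<epsilon> * (1 + b)" using S_bounds(2)[OF yS(2), of i] \<epsilon> by (intro mult_left_mono) auto
  moreover have "\<epsilon> * y i \<le> \<epsilon> * (1 + b)" using S_bounds(2)[OF yS(1), of i] \<epsilon> by (intro mult_left_mono) auto
  moreover have "a' \<le> y i" by (rule S_bounds[OF yS(1)])
  moreover have "0 \<le> \<epsilon> * (1 + b)" using \<epsilon> ab by simp
  ultimately show ?thesis using r1 r2 by (auto simp: \<zeta>_def abs_le_iff max_def algebra_simps)
qed

end

context dense_directions
begin

theorem floor_near_homeomorphism:
  assumes "0 \<le> a" "a < a'" "a' < b" "e > 0"
  shows "\<exists>g. iso_onto (S a b) (S a' b) g \<and> (\<forall>v\<in>S a b. dist (g v) (\<lambda>i. max (v i) a') \<le> e)"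
proof -
  \<comment> \<open>Half of \<open>e\<close> pays for the thickness of \<open>Rel\<close>, after the
    doubling in \<open>dist_fun_le\<close>; a quarter goes to each of the two approximated
    projections.\<close>
  define \<epsilon> where "\<epsilon> = e / (4 * (1 + b))"
  have eps: "\<epsilon> > 0" "2 * (\<epsilon> * (1 + b)) = e / 2" using assms by (simp_all add: \<epsilon>_def field_simps)
  interpret floor_relation u a a' b \<epsilon> by unfold_locales (use assms eps in auto)
  interpret low: parametric_keller "S a' b" Rel b by (rule lower_bundle)
  interpret up: parametric_keller "S a b" "prod.swap ` Rel" b by (rule upper_bundle)
  obtain \<theta>1 \<theta>2 where \<theta>: "iso_onto (S a' b) cube \<theta>1" "iso_onto (S a b) cube \<theta>2"
    using S_iso_cube[of a' b] S_iso_cube[of a b] assms by auto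
  obtain \<beta> where \<beta>: "iso_onto Rel (S a' b) \<beta>" "\<And>p. p \<in> Rel \<Longrightarrow> dist (\<beta> p) (fst p) \<le> e/4"
    using low.total_near_base[OF \<theta>(1), of "e/4"] assms(4) by auto
  obtain \<alpha> where \<alpha>: "iso_onto (prod.swap ` Rel) (S a b) \<alpha>" "\<And>p. p \<in> prod.swap ` Rel \<Longrightarrow> dist (\<alpha> p) (fst p) \<le> e/4"
    using up.total_near_base[OF \<theta>(2) divide_pos_pos[OF assms(4) zero_less_numeral]] by blast
  define A where "A = \<alpha> \<circ> prod.swap"
  have A: "iso_onto Rel (S a b) A" unfolding A_def by (rule iso_onto_comp[OF iso_onto_swap \<alpha>(1)])
  define B where "B = the_inv_into Rel A"
  have B: "iso_onto (S a b) Rel B" unfolding B_def by (rule iso_onto_inv[OF A compact_Rel])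
  have AB: "A (B v) = v" if "v \<in> S a b" for v
    unfolding B_def by (rule f_the_inv_into_f) (use A that in \<open>auto simp: iso_onto_def\<close>)
  have "dist (\<beta> (B v)) (\<lambda>i. max (v i) a') \<le> e" if v: "v \<in> S a b" for v
  proof -
    have m: "B v \<in> Rel" by (rule iso_onto_mem[OF B v])
    define y h where "y = fst (B v)" and "h = snd (B v)"
    have yh: "(y, h) \<in> Rel" using m by (simp add: y_def h_def)
    have "prod.swap (B v) \<in> prod.swap ` Rel" using m by (rule imageI)
    from \<alpha>(2)[OF this] have "dist v h \<le> e/4" using AB[OF v] by (simp add: A_def h_def)
    moreover have "dist (\<lambda>i. max (h i) a') (\<lambda>i. max (v i) a') \<le> dist h v"
      by (rule dist_fun_lipschitz) (auto simp: dist_real_def max_def)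
    moreover have "dist y (\<lambda>i. max (h i) a') \<le> 2 * (\<epsilon> * (1 + b))"
      by (rule dist_fun_le) (use Rel_near_floor[OF yh] in \<open>simp add: dist_real_def\<close>)
    moreover have "dist (\<beta> (B v)) y \<le> e/4" using \<beta>(2)[OF m] by (simp add: y_def)
    ultimately show ?thesis
      using dist_triangle[of "\<beta> (B v)" "\<lambda>i. max (v i) a'" y]
        dist_triangle[of y "\<lambda>i. max (v i) a'" "\<lambda>i. max (h i) a'"] eps(2) by (simp add: dist_commute)
  qed
  then show ?thesis using iso_onto_comp[OF B \<beta>(1)] by (intro exI[of _ "\<beta> \<circ> B"]) simp
qed

end

section \<open>Polarity and truncation by balls\<close>

definition polar :: "'a::euclidean_space set \<Rightarrow> 'a set" where
  "polar A = {y. \<forall>x\<in>A. x \<bullet> y \<le> 1}"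

lemma polar_bounds:
  fixes A :: "'a::euclidean_space set"
  assumes "cball 0 d \<subseteq> A" "A \<subseteq> cball 0 l" "0 < d" "0 < l"
  shows "body (polar A)" "cball 0 (1/l) \<subseteq> polar A" "polar A \<subseteq> cball 0 (1/d)"
proof -
  show low: "cball 0 (1/l) \<subseteq> polar A"
  proof
    fix y :: 'a assume "y \<in> cball 0 (1/l)"
    then have y: "norm y \<le> 1/l" by simp
    have "x \<bullet> y \<le> 1" if "x \<in> A" for x
    proof -
      have "norm x \<le> l" using assms(2) that by auto
      then have "norm x * norm y \<le> l * (1/l)" using y assms(4) by (intro mult_mono) auto
      then show ?thesis using Cauchy_Schwarz_ineq2[of x y] assms(4) by simp
    qed
    then show "y \<in> polar A" by (simp add: polar_def)
  qed
  show up: "polar A \<subseteq> cball 0 (1/d)"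
  proof
    fix y assume y: "y \<in> polar A"
    show "y \<in> cball 0 (1/d)"
    proof (cases "y = 0")
      case False
      have "(d / norm y) *\<^sub>R y \<in> A" using assms(1,3) False by auto
      then have "((d / norm y) *\<^sub>R y) \<bullet> y \<le> 1" using y unfolding polar_def by blast
      moreover have "((d / norm y) *\<^sub>R y) \<bullet> y = d * norm y"
        using False by (simp add: power2_norm_eq_inner[symmetric] power2_eq_square)
      ultimately have "d * norm y \<le> 1" by metis
      then show ?thesis using assms(3) by (simp add: le_divide_eq mult.commute)
    qed (use assms in simp)
  qed
  have eq: "polar A = (\<Inter>x\<in>A. {y. x \<bullet> y \<le> 1})" by (auto simp: polar_def)
  have "closed (polar A)" unfolding eq by (intro closed_INT ballI closed_halfspace_le)
  moreover have "bounded (polar A)" using up bounded_cball bounded_subset by blast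
  moreover have "convex (polar A)" unfolding eq by (intro convex_INT ballI convex_halfspace_le)
  moreover have "0 \<in> polar A" by (simp add: polar_def)
  ultimately show "body (polar A)" by (simp add: body_def compact_eq_bounded_closed)
qed

text \<open>The bipolar theorem. Since \<open>0 \<in> A\<close>, a hyperplane separating
  \<open>x\<close> from \<open>A\<close> has \<open>b < 0\<close>; its normalised normal
  \<open>(1/b) *\<^sub>R a\<close> lies in the polar of \<open>A\<close> and excludes
  \<open>x\<close> from the second polar.\<close>

lemma polar_polar:
  assumes "body A"
  shows "polar (polar A) = A"
proof
  show "A \<subseteq> polar (polar A)" by (auto simp: polar_def inner_commute)
  show "polar (polar A) \<subseteq> A"
  proof (rule subsetI, rule ccontr)
    fix x assume x: "x \<in> polar (polar A)" "x \<notin> A"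
    have "convex A" "closed A" "0 \<in> A" using assms compact_imp_closed by (auto simp: body_def)
    then obtain a b where ab: "a \<bullet> x < b" "\<And>y. y \<in> A \<Longrightarrow> b < a \<bullet> y"
      using separating_hyperplane_closed_point[of A x] x(2) by blast
    have b: "b < 0" using ab(2)[OF \<open>0 \<in> A\<close>] by simp
    have "y \<bullet> ((1/b) *\<^sub>R a) \<le> 1" if "y \<in> A" for y
      using ab(2)[OF that] b by (simp add: inner_commute divide_le_eq)
    then have "(1/b) *\<^sub>R a \<in> polar A" by (simp add: polar_def)
    then have "((1/b) *\<^sub>R a) \<bullet> x \<le> 1"
      using x(1) unfolding polar_def[of "polar A"] by blast
    then show False using ab(1) b by (simp add: divide_le_eq)
  qed
qed

lemma polar_scale:
  assumes "0 < r" "A \<subseteq> (*\<^sub>R) r ` B"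
  shows "polar B \<subseteq> (*\<^sub>R) r ` polar A"
proof
  fix y assume y: "y \<in> polar B"
  have "x \<bullet> ((1/r) *\<^sub>R y) \<le> 1" if xA: "x \<in> A" for x
  proof -
    obtain z where z: "z \<in> B" "x = r *\<^sub>R z" using assms(2) xA by blast
    then show ?thesis using y assms(1) by (simp add: polar_def)
  qed
  then have "(1/r) *\<^sub>R y \<in> polar A" by (simp add: polar_def)
  then show "y \<in> (*\<^sub>R) r ` polar A"
    using assms(1) by (intro image_eqI[of _ _ "(1/r) *\<^sub>R y"]) auto
qed

lemma polar_convex_hull: "polar (convex hull A) = polar A"
proof
  show "polar (convex hull A) \<subseteq> polar A" using hull_subset[of A convex] by (auto simp: polar_def)
  show "polar A \<subseteq> polar (convex hull A)"
  proof
    fix y assume y: "y \<in> polar A"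
    have "convex hull A \<subseteq> {x. y \<bullet> x \<le> 1}"
      using y by (intro hull_minimal convex_halfspace_le) (auto simp: polar_def inner_commute)
    then show "y \<in> polar (convex hull A)" by (auto simp: polar_def inner_commute)
  qed
qed

lemma polar_Un: "polar (A \<union> B) = polar A \<inter> polar B"
  by (auto simp: polar_def)

lemma polar_cball:
  assumes "0 < r" shows "polar (cball (0::'a::euclidean_space) r) = cball 0 (1/r)"
  using polar_bounds(2,3)[of r "cball 0 r" r] assms by auto

section \<open>Truncation as the polar of raising the floor\<close>

context dense_directions
begin

lemma continuous_on_S:
  assumes "0 \<le> c" "0 \<le> b"
    and "\<And>e. e > 0 \<Longrightarrow> \<exists>\<eta>>0. \<forall>v\<in>S c b. \<forall>w\<in>S c b. (\<forall>i. \<bar>v i - w i\<bar> \<le> \<eta>) \<longrightarrow> (\<forall>i. \<bar>F v i - F w i\<bar> \<le> e)"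
  shows "continuous_on (S c b) (F :: (nat \<Rightarrow> real) \<Rightarrow> nat \<Rightarrow> real)"
  unfolding continuous_on_iff
proof (intro ballI allI impI)
  fix v and e :: real assume v: "v \<in> S c b" and e: "e > 0"
  obtain \<eta> where \<eta>: "\<eta> > 0" "\<And>w. w \<in> S c b \<Longrightarrow> (\<And>i. \<bar>w i - v i\<bar> \<le> \<eta>) \<Longrightarrow> (\<forall>i. \<bar>F w i - F v i\<bar> \<le> e/3)"
    using assms(3)[of "e/3"] e v by fastforce
  obtain d where d: "d > 0" "\<And>v w i. v \<in> S 0 b \<Longrightarrow> w \<in> S 0 b \<Longrightarrow> dist v w < d \<Longrightarrow> \<bar>v i - w i\<bar> \<le> \<eta>"
    using S_uniform[OF assms(2) \<eta>(1)] by blast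
  have "dist (F w) (F v) < e" if w: "w \<in> S c b" "dist w v < d" for w
  proof -
    have "\<bar>w i - v i\<bar> \<le> \<eta>" for i using d(2)[OF _ _ w(2)] w(1) v S_subset[OF assms(1)] by blast
    then have "\<forall>i. \<bar>F w i - F v i\<bar> \<le> e/3" by (rule \<eta>(2)[OF w(1)])
    then have "dist (F w) (F v) \<le> 2 * (e/3)" by (intro dist_fun_le) (simp add: dist_real_def)
    then show ?thesis using e by simp
  qed
  with d(1) show "\<exists>d>0. \<forall>w\<in>S c b. dist w v < d \<longrightarrow> dist (F w) (F v) < e" by blast
qed

definition \<kappa> where "\<kappa> v = supp (polar (body_of v))"

lemma body_of_\<kappa>:
  assumes "0 < d" "0 < l" "v \<in> S d l"
  shows "body_of (\<kappa> v) = polar (body_of v)" "\<kappa> v \<in> S (1/l) (1/d)" "\<kappa> (\<kappa> v) = v"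
proof -
  note A = body_of_bounds(2,1)[OF less_imp_le[OF assms(2)] assms(3)]
  note P = polar_bounds[OF A assms(1,2)]
  show eq: "body_of (\<kappa> v) = polar (body_of v)" unfolding \<kappa>_def by (rule body_of_supp[OF P(1)])
  show "\<kappa> v \<in> S (1/l) (1/d)" unfolding \<kappa>_def by (rule supp_in_S[OF P]) (use assms in simp)
  have "\<kappa> (\<kappa> v) = supp (polar (polar (body_of v)))" unfolding \<kappa>_def[of "\<kappa> v"] eq ..
  also have "\<dots> = supp (body_of v)"
    using polar_polar[OF body_S[OF _ assms(3)]] assms(1) by simp
  also have "\<dots> = v" using assms(3) by (intro supp_body_of) (simp add: S_def)
  finally show "\<kappa> (\<kappa> v) = v" .
qed

text \<open>As all values are at least \<open>d\<close>, the additive error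
  \<open>\<eta> * d\<close> is a relative error \<open>\<eta>\<close>, so one body lies in the other
  dilated by \<open>1 + \<eta>\<close>. Polarity reverses this inclusion, and since
  \<open>\<kappa> v\<close> is at most \<open>1/d\<close> the relative error becomes
  \<open>\<eta> / d\<close>.\<close>

lemma \<kappa>_anti:
  assumes "0 < d" "0 < l" "v \<in> S d l" "w \<in> S d l" "0 \<le> \<eta>" "\<And>i. v i \<le> w i + \<eta> * d"
  shows "\<kappa> w i \<le> \<kappa> v i + \<eta> / d"
proof -
  have pos: "0 < 1 + \<eta>" using assms by simp
  have "body_of v \<subseteq> (*\<^sub>R) (1 + \<eta>) ` body_of w"
  proof
    fix x assume x: "x \<in> body_of v"
    have "x \<bullet> u j \<le> (1 + \<eta>) * w j" for j
    proof -
      have "x \<bullet> u j \<le> v j" using x by (simp add: body_of_def)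
      moreover have "\<eta> * d \<le> \<eta> * w j" using assms(4,5) by (intro mult_left_mono) (auto simp: S_def)
      ultimately show ?thesis using assms(6)[of j] by (simp add: distrib_right)
    qed
    then have "(1 / (1 + \<eta>)) *\<^sub>R x \<in> body_of w"
      using pos by (simp add: body_of_def divide_le_eq mult.commute)
    then show "x \<in> (*\<^sub>R) (1 + \<eta>) ` body_of w"
      using pos by (intro image_eqI[of _ _ "(1 / (1 + \<eta>)) *\<^sub>R x"]) auto
  qed
  then have sub: "polar (body_of w) \<subseteq> (*\<^sub>R) (1 + \<eta>) ` polar (body_of v)" by (rule polar_scale[OF pos])
  note Pv = polar_bounds[OF body_of_bounds(2,1)[OF less_imp_le[OF assms(2)] assms(3)] assms(1,2)]
  note Pw = polar_bounds[OF body_of_bounds(2,1)[OF less_imp_le[OF assms(2)] assms(4)] assms(1,2)]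
  note sc = supp_scale[OF Pv(1) less_imp_le[OF pos]]
  have "\<kappa> w i \<le> (1 + \<eta>) * \<kappa> v i"
    using supp_mono[OF Pw(1) sc(1) sub, of i] sc(2) by (simp add: \<kappa>_def)
  moreover have "\<eta> * \<kappa> v i \<le> \<eta> * (1/d)"
    using body_of_\<kappa>(2)[OF assms(1-3)] assms(5) by (intro mult_left_mono) (auto simp: S_def)
  ultimately show ?thesis by (simp add: distrib_right)
qed

lemma continuous_\<kappa>:
  assumes "0 < d" "0 < l"
  shows "continuous_on (S d l) \<kappa>"
proof (rule continuous_on_S)
  fix e :: real assume e: "e > 0"
  define \<eta> where "\<eta> = e * d"
  have \<eta>: "\<eta> > 0" "\<eta> / d = e" using e assms by (simp_all add: \<eta>_def)
  have "\<bar>\<kappa> v i - \<kappa> w i\<bar> \<le> e" if vw: "v \<in> S d l" "w \<in> S d l" "\<forall>i. \<bar>v i - w i\<bar> \<le> \<eta> * d" for v w i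
  proof -
    have "v i \<le> w i + \<eta> * d" "w i \<le> v i + \<eta> * d" for i using vw(3)[rule_format, of i] by linarith+
    then have "\<kappa> w i \<le> \<kappa> v i + \<eta> / d" "\<kappa> v i \<le> \<kappa> w i + \<eta> / d"
      using \<kappa>_anti[OF assms vw(1,2)] \<kappa>_anti[OF assms vw(2,1)] \<eta>(1) by simp_all
    then show ?thesis using \<eta>(2) by linarith
  qed
  then show "\<exists>\<eta>>0. \<forall>v\<in>S d l. \<forall>w\<in>S d l. (\<forall>i. \<bar>v i - w i\<bar> \<le> \<eta>) \<longrightarrow> (\<forall>i. \<bar>\<kappa> v i - \<kappa> w i\<bar> \<le> e)"
    using \<eta> assms by (intro exI[of _ "\<eta> * d"]) auto
qed (use assms in auto)

lemma iso_\<kappa>: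
  assumes "0 < d" "0 < l"
  shows "iso_onto (S d l) (S (1/l) (1/d)) \<kappa>"
  unfolding iso_onto_def
proof (intro conjI continuous_\<kappa>[OF assms])
  show "inj_on \<kappa> (S d l)" by (rule inj_on_inverseI[of _ \<kappa>]) (rule body_of_\<kappa>(3)[OF assms])
  show "\<kappa> ` S d l = S (1/l) (1/d)"
  proof
    show "\<kappa> ` S d l \<subseteq> S (1/l) (1/d)" using body_of_\<kappa>(2)[OF assms] by blast
    show "S (1/l) (1/d) \<subseteq> \<kappa> ` S d l"
    proof
      fix v assume v: "v \<in> S (1/l) (1/d)"
      have "\<kappa> v \<in> S d l" using body_of_\<kappa>(2)[OF _ _ v] assms by simp
      moreover have "\<kappa> (\<kappa> v) = v" using body_of_\<kappa>(3)[OF _ _ v] assms by simp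
      ultimately show "v \<in> \<kappa> ` S d l" by (metis imageI)
    qed
  qed
qed

definition trc where "trc \<mu> v = supp (body_of v \<inter> cball 0 \<mu>)"

lemma body_Int_cball: "body A \<Longrightarrow> 0 \<le> \<mu> \<Longrightarrow> body (A \<inter> cball 0 \<mu>)"
  by (auto simp: body_def intro!: compact_Int convex_Int)

text \<open>\<open>supp B + \<eta>\<close> is the support sequence of the sum of \<open>B\<close>
  and the ball of radius \<open>\<eta>\<close>, so \<open>A\<close> lies in that sum.\<close>

lemma supp_le_subset_nbhd:
  assumes "body A" "body B" "0 \<le> \<eta>" "\<And>i. supp A i \<le> supp B i + \<eta>" "x \<in> A"
  shows "\<exists>y\<in>B. norm (x - y) \<le> \<eta>"
proof -
  note s = supp_sum[OF assms(2) body_cball[OF assms(3)]]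
  have "x \<bullet> u i \<le> supp B i + \<eta>" for i using inner_le_supp[OF assms(1,5), of i] assms(4)[of i] by linarith
  then have "x \<in> {y + z |y z. y \<in> B \<and> z \<in> cball 0 \<eta>}"
    using mem_iff_supp[OF s(1), of x] s(2) supp_cball[OF assms(3)] by simp
  then obtain y z where "x = y + z" "y \<in> B" "z \<in> cball 0 \<eta>" by blast
  then show ?thesis by (intro bexI[of _ y]) auto
qed

text \<open>A point \<open>x\<close> of the first truncation has a neighbour \<open>z\<close> in
  \<open>body_of w\<close> at distance at most \<open>\<eta>\<close>, which may stick out of the
  ball by \<open>\<eta>\<close>. Shrinking \<open>z\<close> towards the origin by
  \<open>\<mu> / (\<mu> + \<eta>)\<close> brings it back at the cost of another
  \<open>\<eta>\<close>.\<close>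

lemma trc_lip:
  assumes "0 < \<mu>" "v \<in> S 0 l" "w \<in> S 0 l" "0 \<le> \<eta>" "\<And>i. v i \<le> w i + \<eta>"
  shows "trc \<mu> v i \<le> trc \<mu> w i + 2 * \<eta>"
proof -
  note bv = body_S[OF order_refl assms(2)] and bw = body_S[OF order_refl assms(3)]
  note tv = body_Int_cball[OF bv less_imp_le[OF assms(1)]] and tw = body_Int_cball[OF bw less_imp_le[OF assms(1)]]
  have v: "supp (body_of v) = v" "supp (body_of w) = w" using supp_body_of assms(2,3) by (auto simp: S_def)
  show ?thesis
    unfolding trc_def[of \<mu> v]
  proof (rule supp_le[OF tv])
    fix x assume x: "x \<in> body_of v \<inter> cball 0 \<mu>"
    obtain z where z: "z \<in> body_of w" "norm (x - z) \<le> \<eta>"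
      using supp_le_subset_nbhd[OF bv bw assms(4), of x] x v assms(5) by auto
    have nz: "norm z \<le> \<mu> + \<eta>" using z(2) x norm_triangle_ineq4[of x "x - z"] by simp
    have pos: "\<mu> + \<eta> > 0" using assms by simp
    define s where "s = \<mu> / (\<mu> + \<eta>)"
    have s: "0 \<le> s" "s \<le> 1" "1 - s = \<eta> / (\<mu> + \<eta>)" using pos assms by (simp_all add: s_def field_simps)
    have "s *\<^sub>R z \<in> body_of w"
      using convexD_alt[of "body_of w" 0 z s] bw z(1) s by (simp add: body_def)
    moreover have "norm (s *\<^sub>R z) \<le> \<mu>"
    proof -
      have "s * norm z \<le> s * (\<mu> + \<eta>)" using nz s by (intro mult_left_mono) auto
      moreover have "s * (\<mu> + \<eta>) = \<mu>" using pos by (simp add: s_def)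
      moreover have "norm (s *\<^sub>R z) = s * norm z" using s(1) by simp
      ultimately show ?thesis by linarith
    qed
    ultimately have "s *\<^sub>R z \<in> body_of w \<inter> cball 0 \<mu>" by simp
    then have 1: "s * (z \<bullet> u i) \<le> trc \<mu> w i" unfolding trc_def using inner_le_supp[OF tw, of "s *\<^sub>R z" i] by simp
    have "(1 - s) * (z \<bullet> u i) \<le> (1 - s) * (\<mu> + \<eta>)"
      using inner_u_le_norm[of z i] nz s(2) by (intro mult_left_mono) auto
    also have "\<dots> = \<eta>" using s(3) pos by simp
    finally have 2: "z \<bullet> u i \<le> trc \<mu> w i + \<eta>" using 1 by (simp add: left_diff_distrib)
    have "(x - z) \<bullet> u i \<le> \<eta>" using inner_u_le_norm[of "x - z" i] z(2) by linarith
    then show "x \<bullet> u i \<le> trc \<mu> w i + 2 * \<eta>" using 2 by (simp add: inner_diff_left)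
  qed
qed

lemma continuous_trc:
  assumes "0 < \<mu>" "0 \<le> l"
  shows "continuous_on (S 0 l) (trc \<mu>)"
proof (rule continuous_on_S)
  fix e :: real assume e: "e > 0"
  have "\<bar>trc \<mu> v i - trc \<mu> w i\<bar> \<le> e" if vw: "v \<in> S 0 l" "w \<in> S 0 l" "\<forall>i. \<bar>v i - w i\<bar> \<le> e / 2" for v w i
  proof -
    have "v i \<le> w i + e / 2" "w i \<le> v i + e / 2" for i using vw(3)[rule_format, of i] by linarith+
    then have "trc \<mu> v i \<le> trc \<mu> w i + 2 * (e/2)" "trc \<mu> w i \<le> trc \<mu> v i + 2 * (e/2)"
      using trc_lip[OF assms(1) vw(1,2)] trc_lip[OF assms(1) vw(2,1)] e by (meson half_gt_zero less_imp_le)+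
    then show ?thesis by linarith
  qed
  then show "\<exists>\<eta>>0. \<forall>v\<in>S 0 l. \<forall>w\<in>S 0 l. (\<forall>i. \<bar>v i - w i\<bar> \<le> \<eta>) \<longrightarrow> (\<forall>i. \<bar>trc \<mu> v i - trc \<mu> w i\<bar> \<le> e)"
    using e by (intro exI[of _ "e / 2"]) auto
qed (use assms in auto)

text \<open>By the bipolar theorem the truncated body is the polar of the convex hull of
  \<open>polar (body_of v)\<close> and the ball of radius \<open>1/\<mu>\<close>; the support
  sequence of this hull is the pointwise maximum.\<close>

lemma trc_eq_polar_floor:
  assumes "0 < d" "d < \<mu>" "\<mu> < l" "v \<in> S d l"
  shows "trc \<mu> v = \<kappa> (\<lambda>i. max (\<kappa> v i) (1/\<mu>))"
proof -
  have pos: "0 < l" "0 < \<mu>" using assms by auto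
  note P = polar_bounds[OF body_of_bounds(2,1)[OF less_imp_le[OF pos(1)] assms(4)] assms(1) pos(1)]
  have r: "0 \<le> 1/\<mu>" using pos by simp
  let ?H = "convex hull (polar (body_of v) \<union> cball 0 (1/\<mu>))"
  note H = supp_hull[OF P(1) body_cball[OF r]]
  have "(\<lambda>i. max (\<kappa> v i) (1/\<mu>)) = supp ?H" using H(2) supp_cball[OF r] by (simp add: \<kappa>_def)
  then have "body_of (\<lambda>i. max (\<kappa> v i) (1/\<mu>)) = ?H" using body_of_supp[OF H(1)] by simp
  then have "\<kappa> (\<lambda>i. max (\<kappa> v i) (1/\<mu>)) = supp (polar ?H)" unfolding \<kappa>_def[of "\<lambda>i. max (\<kappa> v i) (1/\<mu>)"] by simp
  also have "polar ?H = polar (polar (body_of v)) \<inter> polar (cball 0 (1/\<mu>))"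
    by (simp add: polar_convex_hull polar_Un)
  also have "\<dots> = body_of v \<inter> cball 0 \<mu>"
  proof -
    have "polar (cball (0::'a) (1/\<mu>)) = cball 0 \<mu>" using pos by (subst polar_cball) simp_all
    then show ?thesis using polar_polar[OF body_S[OF _ assms(4)]] assms(1) by simp
  qed
  finally show ?thesis by (simp add: trc_def)
qed

lemma uniform_S:
  assumes "continuous_on (S c b) (F :: (nat \<Rightarrow> real) \<Rightarrow> nat \<Rightarrow> real)" "0 \<le> c" "e > 0"
  shows "\<exists>d>0. \<forall>v\<in>S c b. \<forall>w\<in>S c b. dist v w < d \<longrightarrow> dist (F v) (F w) < e"
  using compact_uniformly_continuous[OF assms(1) compact_S[OF assms(2)]] assms(3)
  unfolding uniformly_continuous_on_def by (metis dist_commute)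

text \<open>Bodies in \<open>S 0 l\<close> are first fattened to contain a small ball
  (\<open>\<alpha>\<close>), so that polarity applies. Between two polarities \<open>\<phi>\<close>
  approximates raising the floor to \<open>1/\<mu>\<close>, and the inverse of the fattening
  \<open>\<beta>\<close> leads back to \<open>S 0 \<mu>\<close>.\<close>

theorem truncation_near_homeomorphism:
  assumes "0 < \<mu>" "\<mu> < l" "e > 0"
  shows "\<exists>g. iso_onto (S 0 l) (S 0 \<mu>) g \<and> (\<forall>v\<in>S 0 l. dist (g v) (trc \<mu> v) \<le> e)"
proof -
  have l: "0 < l" using assms by simp
  have e4: "e / 4 > 0" using assms by simp
  obtain \<delta> where \<delta>: "\<delta> > 0" "\<And>v w. v \<in> S 0 l \<Longrightarrow> w \<in> S 0 l \<Longrightarrow> dist v w < \<delta> \<Longrightarrow> dist (trc \<mu> v) (trc \<mu> w) < e/4"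
    using uniform_S[OF continuous_trc[OF assms(1) less_imp_le[OF l]] order_refl e4] by blast
  \<comment> \<open>Raising the floor to \<open>d\<close> moves points by at most
    \<open>2 * d\<close>. With the errors of \<open>\<alpha>\<close> and \<open>\<beta>\<close>, the
    first fattening moves by less than \<open>\<delta>\<close>, where \<open>trc \<mu>\<close>
    varies by less than \<open>e/4\<close>, and undoing the second moves by at most
    \<open>e/4\<close>.\<close>
  define d where "d = min (\<mu> / 2) (min (\<delta> / 8) (e / 16))"
  have d: "0 < d" "d \<le> \<mu> / 2" "d \<le> \<delta> / 8" "d \<le> e / 16"
  proof -
    show "0 < d" using assms \<delta> by (simp add: d_def)
    show "d \<le> \<mu> / 2" unfolding d_def by (rule min.cobounded1)
    show "d \<le> \<delta> / 8" unfolding d_def by (rule min.coboundedI2[OF min.cobounded1])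
    show "d \<le> e / 16" unfolding d_def by (rule min.coboundedI2[OF min.cobounded2])
  qed
  have d\<mu>: "d < \<mu>" "d < l" using d assms by linarith+
  have floor: "dist (\<lambda>i. max (v i) d) v \<le> 2 * d" if "v \<in> S 0 b" for v b
    by (rule dist_fun_le) (use that d in \<open>auto simp: S_def dist_real_def max_def\<close>)
  obtain \<alpha> where \<alpha>: "iso_onto (S 0 l) (S d l) \<alpha>" "\<And>v. v \<in> S 0 l \<Longrightarrow> dist (\<alpha> v) (\<lambda>i. max (v i) d) \<le> \<delta> / 4"
    using floor_near_homeomorphism[OF order_refl d(1) d\<mu>(2), of "\<delta>/4"] \<delta>(1) by auto
  obtain \<beta> where \<beta>: "iso_onto (S 0 \<mu>) (S d \<mu>) \<beta>" "\<And>v. v \<in> S 0 \<mu> \<Longrightarrow> dist (\<beta> v) (\<lambda>i. max (v i) d) \<le> e / 8"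
    using floor_near_homeomorphism[OF order_refl d(1) d\<mu>(1), of "e/8"] assms(3) by auto
  have inv: "1 / l < 1 / \<mu>" "1 / \<mu> < 1 / d" "0 < 1 / \<mu>" "0 < 1 / d" "0 \<le> 1 / l"
    using assms l d d\<mu> by (simp_all add: frac_less2)
  obtain \<delta>' where \<delta>': "\<delta>' > 0"
    "\<And>v w. v \<in> S (1/\<mu>) (1/d) \<Longrightarrow> w \<in> S (1/\<mu>) (1/d) \<Longrightarrow> dist v w < \<delta>' \<Longrightarrow> dist (\<kappa> v) (\<kappa> w) < e/4"
    using uniform_S[OF continuous_\<kappa>[OF inv(3,4)] less_imp_le[OF inv(3)] e4] by blast
  obtain \<phi> where \<phi>: "iso_onto (S (1/l) (1/d)) (S (1/\<mu>) (1/d)) \<phi>"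
    "\<And>v. v \<in> S (1/l) (1/d) \<Longrightarrow> dist (\<phi> v) (\<lambda>i. max (v i) (1/\<mu>)) \<le> \<delta>' / 2"
    using floor_near_homeomorphism[OF inv(5,1,2), of "\<delta>'/2"] \<delta>'(1) by auto
  have \<kappa>2: "iso_onto (S (1/\<mu>) (1/d)) (S d \<mu>) \<kappa>" using iso_\<kappa>[OF inv(3,4)] by simp
  define \<gamma> where "\<gamma> = \<kappa> \<circ> (\<phi> \<circ> \<kappa>)"
  have \<gamma>: "iso_onto (S d l) (S d \<mu>) \<gamma>"
    unfolding \<gamma>_def by (rule iso_onto_comp[OF iso_onto_comp[OF iso_\<kappa>[OF d(1) l] \<phi>(1)] \<kappa>2])
  have \<gamma>_near: "dist (\<gamma> w) (trc \<mu> w) < e/4" if w: "w \<in> S d l" for w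
  proof -
    have kw: "\<kappa> w \<in> S (1/l) (1/d)" by (rule body_of_\<kappa>(2)[OF d(1) l w])
    have "(\<lambda>i. 1/\<mu>) \<in> SS" using inv by (intro SS_const) simp
    then have m: "(\<lambda>i. max (\<kappa> w i) (1/\<mu>)) \<in> S (1/\<mu>) (1/d)"
      using SS_max[of "\<kappa> w" "\<lambda>i. 1/\<mu>"] kw inv by (auto simp: S_def)
    have "dist (\<phi> (\<kappa> w)) (\<lambda>i. max (\<kappa> w i) (1/\<mu>)) < \<delta>'" using \<phi>(2)[OF kw] \<delta>'(1) by simp
    from \<delta>'(2)[OF iso_onto_mem[OF \<phi>(1) kw] m this]
    show ?thesis using trc_eq_polar_floor[OF d(1) d\<mu>(1) assms(2) w] by (simp add: \<gamma>_def)
  qed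
  define \<beta>' where "\<beta>' = the_inv_into (S 0 \<mu>) \<beta>"
  have \<beta>': "iso_onto (S d \<mu>) (S 0 \<mu>) \<beta>'" unfolding \<beta>'_def by (rule iso_onto_inv[OF \<beta>(1) compact_S[OF order_refl]])
  have \<beta>\<beta>': "\<beta> (\<beta>' z) = z" if "z \<in> S d \<mu>" for z
    using f_the_inv_into_f[of \<beta> "S 0 \<mu>" z] \<beta>(1) that by (simp add: \<beta>'_def iso_onto_def)
  have \<beta>'_near: "dist (\<beta>' z) z \<le> e/4" if z: "z \<in> S d \<mu>" for z
  proof -
    have m: "\<beta>' z \<in> S 0 \<mu>" by (rule iso_onto_mem[OF \<beta>' z])
    have "dist z (\<lambda>i. max (\<beta>' z i) d) \<le> e / 8" using \<beta>(2)[OF m] \<beta>\<beta>'[OF z] by simp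
    then show ?thesis
      using floor[OF m] d(4) dist_triangle[of "\<beta>' z" z "\<lambda>i. max (\<beta>' z i) d"] by (simp add: dist_commute)
  qed
  define g where "g = \<beta>' \<circ> (\<gamma> \<circ> \<alpha>)"
  have g: "iso_onto (S 0 l) (S 0 \<mu>) g"
    unfolding g_def by (rule iso_onto_comp[OF iso_onto_comp[OF \<alpha>(1) \<gamma>] \<beta>'])
  have "dist (g v) (trc \<mu> v) \<le> e" if v: "v \<in> S 0 l" for v
  proof -
    have a: "\<alpha> v \<in> S d l" by (rule iso_onto_mem[OF \<alpha>(1) v])
    then have a0: "\<alpha> v \<in> S 0 l" using S_subset[OF less_imp_le[OF d(1)], of l] by blast
    have "dist (\<alpha> v) v < \<delta>"
      using \<alpha>(2)[OF v] floor[OF v] d(3) \<delta>(1) dist_triangle[of "\<alpha> v" v "\<lambda>i. max (v i) d"] by linarith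
    then have 1: "dist (trc \<mu> (\<alpha> v)) (trc \<mu> v) < e/4" by (rule \<delta>(2)[OF a0 v])
    have 2: "dist (\<gamma> (\<alpha> v)) (trc \<mu> (\<alpha> v)) < e/4" by (rule \<gamma>_near[OF a])
    have 3: "dist (g v) (\<gamma> (\<alpha> v)) \<le> e/4" using \<beta>'_near[OF iso_onto_mem[OF \<gamma> a]] by (simp add: g_def)
    show ?thesis
      using 1 2 3 assms(3) dist_triangle[of "g v" "trc \<mu> v" "\<gamma> (\<alpha> v)"]
        dist_triangle[of "\<gamma> (\<alpha> v)" "trc \<mu> v" "trc \<mu> (\<alpha> v)"] by linarith
  qed
  with g show ?thesis by blast
qed

end

section \<open>The space of closed convex sets containing the origin\<close>

text \<open>In dimension at least 2 the sphere is connected with more than one point, hence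
  uncountable; so a countable dense subset is infinite and can be enumerated injectively.\<close>

lemma ex_dense_directions:
  assumes "2 \<le> DIM('a::euclidean_space)"
  shows "\<exists>u :: nat \<Rightarrow> 'a. dense_directions u"
proof -
  let ?S = "sphere (0::'a) 1"
  obtain T where T: "countable T" "T \<subseteq> ?S" "?S \<subseteq> closure T" using separable[of ?S] by blast
  obtain b :: 'a where b: "b \<in> Basis" using nonempty_Basis by blast
  have "b \<noteq> - b"
  proof
    assume "b = - b"
    then have "b \<bullet> b = - (b \<bullet> b)" by (metis inner_minus_right)
    then show False using b by (simp add: inner_Basis)
  qed
  moreover have "b \<in> ?S" "- b \<in> ?S" using b by auto
  ultimately have "uncountable ?S" using connected_uncountable[OF connected_sphere[OF assms]] by blast
  have "infinite T"
  proof
    assume "finite T"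
    then have "closure T = T" by (intro closure_closed finite_imp_closed)
    then show False using T \<open>finite T\<close> \<open>uncountable ?S\<close> by (metis countable_finite countable_subset)
  qed
  define u where "u = from_nat_into T"
  have bij: "bij_betw u UNIV T" unfolding u_def by (rule bij_betw_from_nat_into[OF T(1) \<open>infinite T\<close>])
  have "dense_directions u"
  proof
    show "norm (u i) = 1" for i
    proof -
      have "u i \<in> T" using bij by (auto simp: bij_betw_def)
      then show ?thesis using T(2) by auto
    qed
    show "inj u" using bij by (simp add: bij_betw_def)
    fix d :: 'a and e :: real assume "norm d = 1" "e > 0"
    then have "d \<in> closure T" using T(3) by auto
    then obtain x where "x \<in> T" "dist x d < e" using \<open>e > 0\<close> unfolding closure_approachable by blast
    moreover have "x \<in> range u" using bij \<open>x \<in> T\<close> by (simp add: bij_betw_def)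
    ultimately show "\<exists>i. dist (u i) d < e" by blast
  qed
  then show ?thesis by blast
qed

lemma K0_D: "A \<in> K0 \<Longrightarrow> closed A \<and> convex A \<and> 0 \<in> A"
  by (simp add: K0_def)

text \<open>Since \<open>0 \<in> A\<close>, the angle criterion for the nearest point
  \<open>a\<close> gives \<open>norm a * norm a \<le> x \<bullet> a\<close>, so \<open>a\<close>
  already lies in the ball.\<close>

lemma infdist_K0_truncate:
  assumes "A \<in> K0" "norm x \<le> r"
  shows "infdist x A = infdist x (A \<inter> cball 0 r)"
proof (rule antisym)
  note A = K0_D[OF assms(1)]
  have r: "0 \<le> r" using assms(2) norm_ge_zero order_trans by blast
  have "A \<inter> cball 0 r \<noteq> {}" using A r by auto
  then show "infdist x A \<le> infdist x (A \<inter> cball 0 r)" by (intro infdist_mono) auto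
  obtain a where a: "a \<in> A" "infdist x A = dist x a"
    using infdist_attains_inf[of A x] A by auto
  have "\<forall>z\<in>A. dist x a \<le> dist x z" using a(2) infdist_le by metis
  then have "(x - a) \<bullet> (0 - a) \<le> 0" using any_closest_point_dot[of A a 0 x] A a(1) by blast
  then have "norm a * norm a \<le> x \<bullet> a"
    by (simp add: inner_diff_left flip: power2_norm_eq_inner power2_eq_square)
  also have "\<dots> \<le> norm x * norm a" using Cauchy_Schwarz_ineq2[of x a] by linarith
  finally have "norm a \<le> norm x" by (metis mult_right_le_imp_le norm_ge_zero norm_zero order_le_less)
  then have "a \<in> A \<inter> cball 0 r" using a(1) assms(2) by simp
  then show "infdist x (A \<inter> cball 0 r) \<le> infdist x A" using infdist_le[of a] a(2) by metis
qed

section \<open>The Attouch-Wets metric\<close>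

definition gap :: "nat \<Rightarrow> 'a::euclidean_space set \<Rightarrow> 'a set \<Rightarrow> real" where
  "gap j A K = (SUP x\<in>ball 0 (real j). \<bar>infdist x A - infdist x K\<bar>)"

lemma dAW_gap: "dAW A K = (SUP j\<in>{1::nat..}. min (1 / real j) (gap j A K))"
  by (simp add: dAW_def gap_def)

lemma gap_bdd:
  fixes A K :: "'a::euclidean_space set"
  shows "bdd_above ((\<lambda>x. \<bar>infdist x A - infdist x K\<bar>) ` ball 0 (real j))"
proof (rule bdd_aboveI2)
  fix x :: 'a assume "x \<in> ball 0 (real j)"
  then have "norm x < real j" by simp
  then show "\<bar>infdist x A - infdist x K\<bar> \<le> infdist 0 A + infdist 0 K + real j"
    using infdist_triangle[of x A 0] infdist_triangle[of x K 0] infdist_nonneg[of x A] infdist_nonneg[of x K]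
      infdist_nonneg[of 0 A] infdist_nonneg[of 0 K] by simp
qed

lemma le_gap:
  assumes "norm x < real j"
  shows "\<bar>infdist x A - infdist x K\<bar> \<le> gap j A K"
  unfolding gap_def by (rule cSUP_upper[OF _ gap_bdd]) (use assms in simp)

lemma gap_le:
  assumes "1 \<le> j" "\<And>x. norm x < real j \<Longrightarrow> \<bar>infdist x A - infdist x K\<bar> \<le> c"
  shows "gap j A K \<le> c"
  unfolding gap_def
proof (rule cSUP_least)
  show "ball (0::'a) (real j) \<noteq> {}" using assms(1) by simp
qed (use assms(2) in simp)

lemma gap_nonneg: "1 \<le> j \<Longrightarrow> 0 \<le> gap j A K"
  using le_gap[of 0 j A K] by simp

lemma le_dAW:
  assumes "1 \<le> j" shows "min (1 / real j) (gap j A K) \<le> dAW A K"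
  unfolding dAW_gap
proof (rule cSUP_upper)
  show "bdd_above ((\<lambda>j. min (1 / real j) (gap j A K)) ` {1..})"
  proof (rule bdd_aboveI2)
    fix j :: nat assume "j \<in> {1..}"
    then have "1 / real j \<le> 1" by simp
    then show "min (1 / real j) (gap j A K) \<le> 1" by linarith
  qed
qed (use assms in simp)

lemma dAW_le:
  assumes "\<And>j. 1 \<le> j \<Longrightarrow> min (1 / real j) (gap j A K) \<le> c" shows "dAW A K \<le> c"
  unfolding dAW_gap by (rule cSUP_least) (use assms in auto)

lemma K0_eqI:
  assumes "A \<in> K0" "K \<in> K0" "\<And>x. infdist x A = infdist x K"
  shows "A = K"
  using K0_D[OF assms(1)] K0_D[OF assms(2)] in_closed_iff_infdist_zero[of A] in_closed_iff_infdist_zero[of K] assms(3)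
  by (metis empty_iff subsetI subset_antisym)

theorem Metric_space_K0: "Metric_space (K0 :: 'a::euclidean_space set set) dAW"
proof
  show "dAW A K = dAW K A" for A K :: "'a set" by (simp add: dAW_def abs_minus_commute)
  show nn: "0 \<le> dAW A K" for A K :: "'a set"
    using le_dAW[of 1 A K] gap_nonneg[of 1 A K] by simp
  have le0: "A = K" if AK: "A \<in> K0" "K \<in> K0" "dAW A K \<le> 0" for A K :: "'a set"
  proof (rule K0_eqI[OF AK(1,2)])
    fix x :: 'a
    obtain j :: nat where j: "norm x < real j" using reals_Archimedean2 by blast
    then have j1: "1 \<le> j" using norm_ge_zero[of x] by (cases j) auto
    then have "min (1 / real j) (gap j A K) \<le> 0" using le_dAW[OF j1, of A K] AK(3) by linarith
    moreover have "0 < 1 / real j" using j1 by simp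
    ultimately have "gap j A K \<le> 0" by linarith
    then show "infdist x A = infdist x K" using le_gap[OF j, of A K] by linarith
  qed
  show "dAW A K = 0 \<longleftrightarrow> A = K" if "A \<in> K0" "K \<in> K0" for A K :: "'a set"
  proof
    assume "dAW A K = 0" then show "A = K" using le0[OF that] by simp
  next
    assume "A = K"
    have "dAW A K \<le> 0"
    proof (rule dAW_le)
      fix j :: nat assume "1 \<le> j"
      then have "gap j A K \<le> 0" unfolding \<open>A = K\<close> by (intro gap_le) auto
      then show "min (1 / real j) (gap j A K) \<le> 0" by linarith
    qed
    then show "dAW A K = 0" using nn[of A K] by linarith
  qed
  show "dAW A C \<le> dAW A B + dAW B C" if ABC: "A \<in> K0" "B \<in> K0" "C \<in> K0" for A B C :: "'a set"
  proof (rule dAW_le)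
    fix j :: nat assume j: "1 \<le> j"
    have "gap j A C \<le> gap j A B + gap j B C"
    proof (rule gap_le[OF j])
      fix x :: 'a assume "norm x < real j"
      then show "\<bar>infdist x A - infdist x C\<bar> \<le> gap j A B + gap j B C"
        using le_gap[of x j A B] le_gap[of x j B C] by linarith
    qed
    moreover have "0 \<le> gap j A B" "0 \<le> gap j B C" using gap_nonneg[OF j] by blast+
    \<comment> \<open>Capping preserves subadditivity of nonnegative quantities, so the triangle
      inequality holds for each \<open>j\<close> before the supremum is taken.\<close>
    moreover have "min c p \<le> min c q + min c r" if "p \<le> q + r" "0 \<le> q" "0 \<le> r" "0 \<le> c" for c p q r :: real
      using that by (auto simp: min_def)
    ultimately have "min (1 / real j) (gap j A C) \<le> min (1 / real j) (gap j A B) + min (1 / real j) (gap j B C)"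
      by simp
    then show "min (1 / real j) (gap j A C) \<le> dAW A B + dAW B C"
      using le_dAW[OF j, of A B] le_dAW[OF j, of B C] by linarith
  qed
qed

section \<open>The inverse limit of truncations\<close>

context dense_directions
begin

text \<open>Stage \<open>j\<close> truncates at radius \<open>Suc j\<close>, so that all radii are
  positive, as the lemmas on \<open>trc\<close> require.\<close>

definition \<rho> :: "nat \<Rightarrow> 'a set \<Rightarrow> nat \<Rightarrow> real" where
  "\<rho> j A = supp (A \<inter> cball 0 (real (Suc j)))"

definition threads :: "(nat \<Rightarrow> nat \<Rightarrow> real) set" where
  "threads = {x. \<forall>j. x j \<in> S 0 (real (Suc j)) \<and> trc (real (Suc j)) (x (Suc j)) = x j}"

definition glue :: "(nat \<Rightarrow> nat \<Rightarrow> real) \<Rightarrow> 'a set" where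
  "glue x = (\<Union>j. body_of (x j))"

lemma body_slice: "A \<in> K0 \<Longrightarrow> 0 \<le> r \<Longrightarrow> body (A \<inter> cball 0 r)"
  using K0_D[of A] by (auto simp: body_def intro!: closed_Int_compact convex_Int)

lemma body_of_\<rho>: "A \<in> K0 \<Longrightarrow> body_of (\<rho> j A) = A \<inter> cball 0 (real (Suc j))"
  unfolding \<rho>_def by (rule body_of_supp[OF body_slice]) auto

lemma \<rho>_in_S: "A \<in> K0 \<Longrightarrow> \<rho> j A \<in> S 0 (real (Suc j))"
  unfolding \<rho>_def using K0_D[of A] by (intro supp_in_S body_slice) auto

lemma \<rho>_threads:
  assumes "A \<in> K0" shows "(\<lambda>j. \<rho> j A) \<in> threads"
proof -
  have "A \<inter> cball 0 (real (Suc (Suc j))) \<inter> cball 0 (real (Suc j)) = A \<inter> cball 0 (real (Suc j))" for j by auto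
  then have "trc (real (Suc j)) (\<rho> (Suc j) A) = \<rho> j A" for j
    unfolding trc_def body_of_\<rho>[OF assms] by (simp only: \<rho>_def)
  then show ?thesis using \<rho>_in_S[OF assms] by (simp add: threads_def)
qed

lemma thread_nested:
  assumes x: "x \<in> threads" and "j \<le> m"
  shows "body_of (x m) \<inter> cball 0 (real (Suc j)) = body_of (x j)"
  using assms(2)
proof (induction m rule: dec_induct)
  case base
  have "x j \<in> S 0 (real (Suc j))" using x by (simp add: threads_def)
  from body_of_bounds(1)[OF _ this] show ?case by auto
next
  case (step m)
  have xS: "x (Suc m) \<in> S 0 (real (Suc (Suc m)))" and tr: "trc (real (Suc m)) (x (Suc m)) = x m"
    using x unfolding threads_def by blast+
  have "body_of (x m) = body_of (x (Suc m)) \<inter> cball 0 (real (Suc m))"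
    using body_of_supp[OF body_Int_cball[OF body_S[OF order_refl xS], of "real (Suc m)"]] tr unfolding trc_def by simp
  moreover have "cball (0::'a) (real (Suc m)) \<inter> cball 0 (real (Suc j)) = cball 0 (real (Suc j))"
    using step.hyps by auto
  ultimately show ?case using step.IH by (metis Int_assoc)
qed

lemma glue_slice:
  assumes "x \<in> threads"
  shows "glue x \<inter> cball 0 (real (Suc j)) = body_of (x j)"
proof
  show "body_of (x j) \<subseteq> glue x \<inter> cball 0 (real (Suc j))"
    using thread_nested[OF assms, of j j] by (auto simp: glue_def)
  show "glue x \<inter> cball 0 (real (Suc j)) \<subseteq> body_of (x j)"
  proof
    fix p assume p: "p \<in> glue x \<inter> cball 0 (real (Suc j))"
    then obtain m where m: "p \<in> body_of (x m)" by (auto simp: glue_def)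
    have "body_of (x (max m j)) \<inter> cball 0 (real (Suc m)) = body_of (x m)"
      by (rule thread_nested[OF assms]) simp
    then have "p \<in> body_of (x (max m j))" using m by blast
    moreover have "body_of (x (max m j)) \<inter> cball 0 (real (Suc j)) = body_of (x j)"
      by (rule thread_nested[OF assms]) simp
    ultimately show "p \<in> body_of (x j)" using p by blast
  qed
qed

lemma in_slice:
  assumes "x \<in> threads" "p \<in> glue x" "norm p \<le> real (Suc j)"
  shows "p \<in> body_of (x j)"
proof -
  have "p \<in> glue x \<inter> cball 0 (real (Suc j))" using assms(2,3) by simp
  then show ?thesis by (simp only: glue_slice[OF assms(1)])
qed

lemma slice_in_glue: "p \<in> body_of (x j) \<Longrightarrow> p \<in> glue x"
  unfolding glue_def by (rule UN_I[OF UNIV_I])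

lemma glue_in_K0:
  assumes x: "x \<in> threads" shows "glue x \<in> K0"
proof -
  have b: "body (body_of (x j))" for j
    using body_S[OF order_refl, of "x j" "real (Suc j)"] x by (simp add: threads_def)
  have "0 \<in> glue x" by (rule slice_in_glue[of _ _ 0]) (use b[of 0] in \<open>simp add: body_def\<close>)
  moreover have "convex (glue x)"
  proof (rule convexI)
    fix p q and a c :: real assume pq: "p \<in> glue x" "q \<in> glue x" and ac: "0 \<le> a" "0 \<le> c" "a + c = 1"
    obtain j :: nat where j: "max (norm p) (norm q) < real j" using reals_Archimedean2 by blast
    then have "p \<in> body_of (x j)" "q \<in> body_of (x j)" by (intro in_slice[OF x] pq; simp)+
    then have "a *\<^sub>R p + c *\<^sub>R q \<in> body_of (x j)" using b[of j] ac by (intro convexD) (auto simp: body_def)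
    then show "a *\<^sub>R p + c *\<^sub>R q \<in> glue x" by (rule slice_in_glue)
  qed
  moreover have "closed (glue x)"
    unfolding closed_sequential_limits
  proof (intro allI impI, elim conjE)
    fix ps p assume ps: "\<forall>n. ps n \<in> glue x" and lim: "ps \<longlonglongrightarrow> p"
    \<comment> \<open>A convergent sequence is bounded and therefore stays in a single slice, which
      is compact.\<close>
    obtain B where B: "\<And>n. norm (ps n) \<le> B"
      using convergent_imp_bounded[OF lim] unfolding bounded_iff by auto
    obtain j :: nat where j: "B < real j" using reals_Archimedean2 by blast
    have mem: "ps n \<in> body_of (x j)" for n
    proof -
      have "norm (ps n) \<le> real (Suc j)" using B[of n] j by simp
      then show ?thesis by (rule in_slice[OF x ps[rule_format]])
    qed
    have "closed (body_of (x j))" using b[of j] compact_imp_closed by (auto simp: body_def)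
    then have "p \<in> body_of (x j)" using mem lim by (rule closed_sequentially)
    then show "p \<in> glue x" by (rule slice_in_glue)
  qed
  ultimately show ?thesis by (simp add: K0_def)
qed

lemma \<rho>_glue:
  assumes "x \<in> threads" shows "\<rho> j (glue x) = x j"
proof -
  have "x j \<in> SS" using assms by (simp add: threads_def S_def)
  then show ?thesis unfolding \<rho>_def glue_slice[OF assms] by (rule supp_body_of)
qed

lemma glue_\<rho>:
  assumes "A \<in> K0" shows "glue (\<lambda>j. \<rho> j A) = A"
proof
  show "glue (\<lambda>j. \<rho> j A) \<subseteq> A" unfolding glue_def body_of_\<rho>[OF assms] by blast
  show "A \<subseteq> glue (\<lambda>j. \<rho> j A)"
  proof
    fix p assume p: "p \<in> A"
    obtain j :: nat where j: "norm p < real j" using reals_Archimedean2 by blast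
    then have "p \<in> body_of (\<rho> j A)" unfolding body_of_\<rho>[OF assms] using p by simp
    then show "p \<in> glue (\<lambda>j. \<rho> j A)" by (rule slice_in_glue)
  qed
qed

lemma compact_threads: "compact threads"
proof -
  let ?B = "{x :: nat \<Rightarrow> nat \<Rightarrow> real. \<forall>j. x j \<in> S 0 (real (Suc j))}"
  have B: "compact ?B" by (intro compact_box compact_S) simp
  have "closed {x \<in> ?B. dist (trc (real (Suc j)) (x (Suc j))) (x j) = 0}" for j
  proof (rule continuous_closed_preimage_constant[OF _ compact_imp_closed[OF B]])
    have c: "continuous_on ?B (\<lambda>x. x i)" for i by (rule continuous_on_coord[OF continuous_on_id])
    have "continuous_on ?B (\<lambda>x. trc (real (Suc j)) (x (Suc j)))"
    proof (rule continuous_on_compose2[OF continuous_trc[of "real (Suc j)" "real (Suc (Suc j))"] c])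
      show "(\<lambda>x. x (Suc j)) ` ?B \<subseteq> S 0 (real (Suc (Suc j)))" by blast
    qed simp_all
    then show "continuous_on ?B (\<lambda>x. dist (trc (real (Suc j)) (x (Suc j))) (x j))"
      by (rule continuous_on_dist[OF _ c])
  qed
  then have "closed (\<Inter>j. {x \<in> ?B. dist (trc (real (Suc j)) (x (Suc j))) (x j) = 0})" by (rule closed_INT[rule_format])
  then have "compact (?B \<inter> (\<Inter>j. {x \<in> ?B. dist (trc (real (Suc j)) (x (Suc j))) (x j) = 0}))"
    by (rule compact_Int_closed[OF B])
  moreover have "?B \<inter> (\<Inter>j. {x \<in> ?B. dist (trc (real (Suc j)) (x (Suc j))) (x j) = 0}) = threads"
    by (auto simp: threads_def)
  ultimately show ?thesis by simp
qed

text \<open>Every stage is a Hilbert cube already, so the target can be the first stage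
  \<open>S 0 1\<close> itself. The stage map \<open>h\<close> is lifted to
  \<open>h \<circ> g\<close>, with \<open>g\<close> a homeomorphism so close to truncation that
  uniform continuity of \<open>h\<close> keeps the error below \<open>\<eta>\<close>.\<close>

lemma threads_iso_cube: "\<exists>f. iso_onto threads cube f"
proof -
  have img: "(\<lambda>x. x j) ` threads = S 0 (real (Suc j))" for j
  proof
    show "(\<lambda>x. x j) ` threads \<subseteq> S 0 (real (Suc j))" by (auto simp: threads_def)
    show "S 0 (real (Suc j)) \<subseteq> (\<lambda>x. x j) ` threads"
    proof
      fix v assume v: "v \<in> S 0 (real (Suc j))"
      \<comment> \<open>A body is itself a closed convex set containing the origin, so its own
        truncations form a thread through \<open>v\<close>.\<close>
      have "body_of v \<in> K0" using body_S[OF order_refl v] compact_imp_closed by (auto simp: body_def K0_def)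
      moreover have "\<rho> j (body_of v) = v"
      proof -
        have "body_of v \<inter> cball 0 (real (Suc j)) = body_of v" using body_of_bounds(1)[OF _ v] by auto
        then show ?thesis using supp_body_of v by (simp add: \<rho>_def S_def)
      qed
      ultimately show "v \<in> (\<lambda>x. x j) ` threads"
        by (intro image_eqI[OF _ \<rho>_threads[of "body_of v"]]) simp_all
    qed
  qed
  have "\<exists>f. iso_onto threads (S 0 1) f \<and> (\<forall>x\<in>threads. dist (id (f x)) (id (x 0)) \<le> 1)"
  proof (rule approximate_inverse_limit[where \<rho> = "\<lambda>j x. x j" and q = "\<lambda>j. id" and ?h0.0 = id])
    show "compact threads" by (rule compact_threads)
    show "compact (S 0 1)" by (rule compact_S) simp
    show "continuous_on threads (\<lambda>x. x j)" for j by (rule continuous_on_coord[OF continuous_on_id])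
    show "x j = x' j" if "x \<in> threads" "x' \<in> threads" "x (Suc j) = x' (Suc j)" for j x x'
    proof -
      have "trc (real (Suc j)) (x (Suc j)) = x j" "trc (real (Suc j)) (x' (Suc j)) = x' j"
        using that(1,2) unfolding threads_def by blast+
      then show ?thesis using that(3) by simp
    qed
    show "x = x'" if "\<And>j. x j = x' j" for x x' :: "nat \<Rightarrow> nat \<Rightarrow> real" using that by (rule ext)
    show "iso_onto ((\<lambda>x. x 0) ` threads) (id ` S 0 1) id"
      unfolding img by (simp add: iso_onto_def)
    fix j h and \<eta> :: real
    assume "iso_onto ((\<lambda>x. x j) ` threads) (id ` S 0 1) h" and \<eta>: "\<eta> > 0"
    then have h: "iso_onto (S 0 (real (Suc j))) (S 0 1) h" unfolding img by simp
    then obtain d where d: "d > 0" "\<And>v w. v \<in> S 0 (real (Suc j)) \<Longrightarrow> w \<in> S 0 (real (Suc j)) \<Longrightarrow> dist v w < d \<Longrightarrow> dist (h v) (h w) < \<eta>"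
      using uniform_S[of 0 "real (Suc j)" h \<eta>] \<eta> unfolding iso_onto_def by blast
    obtain g where g: "iso_onto (S 0 (real (Suc (Suc j)))) (S 0 (real (Suc j))) g"
      "\<And>v. v \<in> S 0 (real (Suc (Suc j))) \<Longrightarrow> dist (g v) (trc (real (Suc j)) v) \<le> d / 2"
      using truncation_near_homeomorphism[of "real (Suc j)" "real (Suc (Suc j))" "d/2"] d(1) by auto
    have "dist (h (g (x (Suc j)))) (h (x j)) \<le> \<eta>" if "x \<in> threads" for x
    proof -
      have x: "x j \<in> S 0 (real (Suc j))" "x (Suc j) \<in> S 0 (real (Suc (Suc j)))" "trc (real (Suc j)) (x (Suc j)) = x j"
        using that unfolding threads_def by blast+
      have "dist (g (x (Suc j))) (x j) < d" using g(2)[OF x(2)] x(3) d(1) by simp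
      from d(2)[OF iso_onto_mem[OF g(1) x(2)] x(1) this] show ?thesis by simp
    qed
    then show "\<exists>h'. iso_onto ((\<lambda>x. x (Suc j)) ` threads) (id ` S 0 1) h' \<and>
        (\<forall>x\<in>threads. dist (id (h' (x (Suc j)))) (h (x j)) \<le> \<eta>)"
      using iso_onto_comp[OF g(1) h] unfolding img by (intro exI[of _ "h \<circ> g"]) simp
  qed auto
  then obtain f where f: "iso_onto threads (S 0 1) f" by blast
  obtain \<theta> where \<theta>: "iso_onto (S 0 1) cube \<theta>" using S_iso_cube[of 0 1] by auto
  show ?thesis using iso_onto_comp[OF f \<theta>] by blast
qed

lemma infdist_body_of_le:
  assumes "v \<in> S 0 b" "w \<in> S 0 b" "0 \<le> \<eta>" "\<And>i. \<bar>v i - w i\<bar> \<le> \<eta>"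
  shows "\<bar>infdist z (body_of v) - infdist z (body_of w)\<bar> \<le> \<eta>"
proof -
  have *: "infdist z (body_of w) \<le> infdist z (body_of v) + \<eta>"
    if v: "v \<in> S 0 b" and w: "w \<in> S 0 b" and le: "\<And>i. v i \<le> w i + \<eta>" for v w
  proof -
    note bv = body_S[OF order_refl v] and bw = body_S[OF order_refl w]
    have "closed (body_of v)" "body_of v \<noteq> {}" using bv compact_imp_closed by (auto simp: body_def)
    then obtain a where a: "a \<in> body_of v" "infdist z (body_of v) = dist z a" using infdist_attains_inf by blast
    have sv: "supp (body_of v) = v" "supp (body_of w) = w" using supp_body_of v w by (auto simp: S_def)
    obtain y where y: "y \<in> body_of w" "norm (a - y) \<le> \<eta>"
      using supp_le_subset_nbhd[OF bv bw assms(3) _ a(1)] sv le by auto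
    have "infdist z (body_of w) \<le> dist z y" by (rule infdist_le[OF y(1)])
    then show ?thesis using a(2) y(2) dist_triangle[of z y a] by (simp add: dist_norm)
  qed
  have "v i \<le> w i + \<eta>" "w i \<le> v i + \<eta>" for i using assms(4)[of i] by linarith+
  then show ?thesis using *[OF assms(1,2)] *[OF assms(2,1)] by (simp add: abs_le_iff)
qed

text \<open>Terms of the metric with index at least \<open>J\<close> are capped by
  \<open>1 / real J\<close>. For smaller \<open>m\<close>, the distances seen from the ball of
  radius \<open>m\<close> depend only on the slice of that radius, which has index
  \<open>m - 1\<close>.\<close>

lemma dAW_glue_le:
  assumes xy: "x \<in> threads" "y \<in> threads" and \<eta>: "0 \<le> \<eta>" and J: "1 / real J \<le> \<eta>" "1 \<le> J"
    and close: "\<And>j i. j < J \<Longrightarrow> \<bar>x j i - y j i\<bar> \<le> \<eta>"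
  shows "dAW (glue x) (glue y) \<le> \<eta>"
proof (rule dAW_le)
  fix m :: nat assume m: "1 \<le> m"
  show "min (1 / real m) (gap m (glue x) (glue y)) \<le> \<eta>"
  proof (cases "J \<le> m")
    case True
    then have "1 / real m \<le> 1 / real J" using J(2) by (intro divide_left_mono) auto
    then show ?thesis using J(1) by linarith
  next
    case False
    define j where "j = m - 1"
    have j: "m = Suc j" "j < J" using m False by (auto simp: j_def)
    have "gap m (glue x) (glue y) \<le> \<eta>"
    proof (rule gap_le[OF m])
      fix z :: 'a assume "norm z < real m"
      then have z: "norm z \<le> real (Suc j)" using j by simp
      have "infdist z (glue x) = infdist z (body_of (x j))" "infdist z (glue y) = infdist z (body_of (y j))"
        using infdist_K0_truncate[OF glue_in_K0[OF xy(1)] z] infdist_K0_truncate[OF glue_in_K0[OF xy(2)] z]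
          glue_slice[OF xy(1)] glue_slice[OF xy(2)] by simp_all
      moreover have "x j \<in> S 0 (real (Suc j))" "y j \<in> S 0 (real (Suc j))" using xy unfolding threads_def by blast+
      ultimately show "\<bar>infdist z (glue x) - infdist z (glue y)\<bar> \<le> \<eta>"
        using infdist_body_of_le[of "x j" "real (Suc j)" "y j" \<eta> z] \<eta> close[OF j(2)] by simp
    qed
    then show ?thesis by linarith
  qed
qed

text \<open>\<open>glue\<close> is a bijection from a compact space to a Hausdorff space, so its
  continuity suffices.\<close>

theorem K0_homeomorphic_threads:
  "top_of_set threads homeomorphic_space Metric_space.mtopology (K0 :: 'a set set) dAW"
proof -
  interpret K: Metric_space "K0 :: 'a set set" dAW by (rule Metric_space_K0)
  have "homeomorphic_map (top_of_set threads) K.mtopology glue"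
  proof (rule continuous_imp_homeomorphic_map)
    show "continuous_map (top_of_set threads) K.mtopology glue"
      unfolding K.continuous_map_to_metric
    proof (intro ballI allI impI)
      fix x :: "nat \<Rightarrow> nat \<Rightarrow> real" and \<epsilon> :: real assume "x \<in> topspace (top_of_set threads)" and \<epsilon>: "\<epsilon> > 0"
      then have x: "x \<in> threads" by simp
      define \<eta> where "\<eta> = \<epsilon> / 2"
      have \<eta>: "\<eta> > 0" "\<eta> < \<epsilon>" using \<epsilon> by (simp_all add: \<eta>_def)
      obtain J0 :: nat where "1 / \<eta> < real J0" using reals_Archimedean2 by blast
      define J where "J = Suc J0"
      have "1 / \<eta> \<le> real J" using \<open>1 / \<eta> < real J0\<close> by (simp add: J_def)
      then have J: "1 / real J \<le> \<eta>" "1 \<le> J" using \<eta>(1) by (simp_all add: J_def divide_le_eq mult.commute)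
      have "\<forall>j. \<exists>d>0. \<forall>v\<in>S 0 (real (Suc j)). \<forall>w\<in>S 0 (real (Suc j)). dist v w < d \<longrightarrow> (\<forall>i. \<bar>v i - w i\<bar> \<le> \<eta>)"
        using S_uniform[OF _ \<eta>(1)] by simp
      from choice[OF this] obtain d where d': "\<forall>j. d j > 0 \<and> (\<forall>v\<in>S 0 (real (Suc j)). \<forall>w\<in>S 0 (real (Suc j)). dist v w < d j \<longrightarrow> (\<forall>i. \<bar>v i - w i\<bar> \<le> \<eta>))"
        by blast
      then have d: "\<And>j. d j > 0"
        "\<And>j v w i. v \<in> S 0 (real (Suc j)) \<Longrightarrow> w \<in> S 0 (real (Suc j)) \<Longrightarrow> dist v w < d j \<Longrightarrow> \<bar>v i - w i\<bar> \<le> \<eta>"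
        by blast+
      \<comment> \<open>Only finitely many slices matter for a given \<open>\<eta>\<close>; on each,
        \<open>S_uniform\<close> converts closeness in the product metric into uniform closeness of
        support values.\<close>
      define U where "U = (\<Inter>j\<in>{..<J}. {y :: nat \<Rightarrow> nat \<Rightarrow> real. dist (x j) (y j) < d j})"
      have "open {y :: nat \<Rightarrow> nat \<Rightarrow> real. dist (x j) (y j) < d j}" for j
        by (rule open_Collect_less[OF continuous_on_dist[OF continuous_on_const
              continuous_on_coord[OF continuous_on_id]] continuous_on_const])
      then have "open U" unfolding U_def by (intro open_INT) auto
      moreover have "x \<in> U" using d(1) by (simp add: U_def)
      moreover have "glue y \<in> K.mball (glue x) \<epsilon>" if y: "y \<in> threads \<inter> U" for y
      proof -
        have y': "y \<in> threads" using y by blast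
        have "dAW (glue x) (glue y) \<le> \<eta>"
        proof (rule dAW_glue_le[OF x y' less_imp_le[OF \<eta>(1)] J])
          fix j i assume "j < J"
          then have "dist (x j) (y j) < d j" using y by (auto simp: U_def)
          moreover have "x j \<in> S 0 (real (Suc j))" "y j \<in> S 0 (real (Suc j))" using x y' unfolding threads_def by blast+
          ultimately show "\<bar>x j i - y j i\<bar> \<le> \<eta>" using d(2) by blast
        qed
        then show ?thesis using \<eta>(2) glue_in_K0 x y' by simp
      qed
      ultimately show "\<exists>U. openin (top_of_set threads) U \<and> x \<in> U \<and> (\<forall>y\<in>U. glue y \<in> K.mball (glue x) \<epsilon>)"
        using x by (intro exI[of _ "threads \<inter> U"]) (auto intro: openin_open_Int)
    qed
    show "compact_space (top_of_set threads)"
      using compact_threads by (simp add: compact_space_subtopology)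
    show "Hausdorff_space K.mtopology" by (rule K.Hausdorff_space_mtopology)
    show "glue ` topspace (top_of_set threads) = topspace K.mtopology"
    proof -
      have "glue ` threads = K0"
      proof
        show "glue ` threads \<subseteq> K0" using glue_in_K0 by blast
        show "K0 \<subseteq> glue ` threads"
        proof
          fix A :: "'a set" assume "A \<in> K0"
          then show "A \<in> glue ` threads" by (intro image_eqI[OF _ \<rho>_threads]) (simp_all add: glue_\<rho>)
        qed
      qed
      then show ?thesis by simp
    qed
    show "inj_on glue (topspace (top_of_set threads))"
      by (rule inj_on_inverseI[of _ "\<lambda>A j. \<rho> j A"]) (simp add: \<rho>_glue)
  qed
  then show ?thesis by (rule homeomorphic_map_imp_homeomorphic_space)
qed

end

lemma hilbert_cube_eq: "hilbert_cube = top_of_set cube"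
proof -
  have "cube = Pi\<^sub>E UNIV (\<lambda>i. {-1..1})" by (auto simp: cube_def)
  then show ?thesis
    using subtopology_product_topology[of "\<lambda>i. euclidean" UNIV "\<lambda>i::nat. {-1..1::real}"]
    by (simp add: hilbert_cube_def euclidean_product_topology)
qed

lemma iso_onto_homeomorphic_space:
  fixes X :: "'a::metric_space set" and Y :: "'b::metric_space set"
  assumes "iso_onto X Y f" "compact X"
  shows "top_of_set X homeomorphic_space top_of_set Y"
proof -
  have f: "continuous_on X f" "inj_on f X" "f ` X = Y" using assms(1) by (simp_all add: iso_onto_def)
  have "homeomorphic_map (top_of_set X) (top_of_set Y) f"
  proof (rule continuous_imp_homeomorphic_map)
    show "continuous_map (top_of_set X) (top_of_set Y) f" using f by auto
    show "Hausdorff_space (top_of_set Y)" by (intro Hausdorff_space_subtopology Hausdorff_space_euclidean)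
  qed (use f assms(2) in \<open>simp_all add: compact_space_subtopology\<close>)
  then show ?thesis by (rule homeomorphic_map_imp_homeomorphic_space)
qed

theorem theorem3p4:
  assumes "CARD('n::finite) \<ge> 2"
  shows "Metric_space (K0 :: (real^'n) set set) dAW \<and>
         Metric_space.mtopology (K0 :: (real^'n) set set) dAW homeomorphic_space hilbert_cube"
proof
  show "Metric_space (K0 :: (real^'n) set set) dAW" by (rule Metric_space_K0)
  have "2 \<le> DIM(real^'n)" using assms by simp
  then obtain u :: "nat \<Rightarrow> real^'n" where "dense_directions u" using ex_dense_directions by blast
  then interpret dense_directions u .
  obtain f where f: "iso_onto threads cube f" using threads_iso_cube by blast
  have "Metric_space.mtopology (K0 :: (real^'n) set set) dAW homeomorphic_space top_of_set threads"
    using K0_homeomorphic_threads homeomorphic_space_sym by blast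
  also have "top_of_set threads homeomorphic_space top_of_set cube"
    by (rule iso_onto_homeomorphic_space[OF f compact_threads])
  finally show "Metric_space.mtopology (K0 :: (real^'n) set set) dAW homeomorphic_space hilbert_cube"
    by (simp add: hilbert_cube_eq)
qed

end
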